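(* Let $r>q\ge2$ be integers, $\rho(P)=\frac{2\sqrt{qr}}{q+r}$, and let $(S_n)$ be an increasing family of tetrahedra in $\mathrm{DL}(q,r)$, $S_n$ having height $n$, whose union is $\mathrm{DL}(q,r)$. Then the cumulative spectral measures $\tilde\mu_n$ associated with (non-truncated) simple random walk on $S_n$ converge weakly to the measure $\tilde\mu+\tilde\nu$, where $$\begin{aligned}\tilde\mu=(q-1)(r-1)\sum_{N=2}^\infty r^{-N}\sum_{m=1}^{N-1}\delta_{\lambda_{m,N}}&+(r-q)(r-1)\sum_{2\le N\le\frac{r+q}{r-q}}r^{-N-1}\sum_{m=0}^{N-1}\delta_{\lambda'_{m,N}}\\&+(r-q)(r-1)\sum_{N>\frac{r+q}{r-q}}r^{-N-1}\sum_{m=1}^{N-2}\delta_{\lambda'_{m,N}},\end{aligned}$$ $$\tilde\nu=(r-q)(r-1)\sum_{N>\frac{r+q}{r-q}}r^{-N-1}\bigl(\delta_{\lambda'_{0,N}}+\delta_{-\lambda'_{0,N}}\bigr).$$ Here $\lambda_{m,N}=\rho(P)\cos(\frac mN\pi)$, and the numbers $\lambda'_{m,N}$ are as follows. - If $N<\frac{r+q}{r-q}$: $\lambda'_{m,N}=\rho(P)\cos\alpha_{m,N}$, $m=0,\dots,N-1$, where $\alpha_{0,N},\dots,\alpha_{N-1,N}$ are the exactly $N$ distinct solutions $\alpha\in(0,\pi)$ of $\cot(N\alpha)=\frac{r-q}{r+q}\cot\alpha$. - If $N=\frac{r+q}{r-q}$: $\lambda'_{m,N}=\rho(P)\cos\alpha_{m,N}$,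 $m=0,\dots,N-1$, where $\alpha_{0,N}=0$, $\alpha_{N-1,N}=\pi$ and $\alpha_{1,N},\dots,\alpha_{N-2,N}$ are the exactly $N-2$ distinct solutions in $(0,\pi)$ of the same equation. - If $N>\frac{r+q}{r-q}$: for $m=1,\dots,N-2$, $\lambda'_{m,N}=\rho(P)\cos\alpha_{m,N}$, where $\alpha_{1,N},\dots,\alpha_{N-2,N}$ are the exactly $N-2$ distinct solutions in $(0,\pi)$ of the same equation; and $\lambda'_{0,N}=\rho(P)\cosh\alpha_{0,N}$, where $\alpha_{0,N}$ is the unique $\alpha>0$ with $e^{2N\alpha}=\dfrac{q-re^{2\alpha}}{qe^{2\alpha}-r}$. The support of the measure $\tilde\mu$ is the interval $[-\rho(P),\rho(P)]$. The support $\{\pm\lambda'_{0,N}:N>\frac{r+q}{r-q}\}$ of $\tilde\nu$ is contained in $[-1,-\rho(P)]\cup[\rho(P),1]$. The sequence $(\lambda'_{0,N})$ is strictly increasing with limit $1$.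
   Context: Trees. For an integer $p\ge2$, $\mathbb T_p$ is the homogeneous tree of degree $p+1$ with a chosen root $o$ and a chosen reference end $\omega$ (an end is an equivalence class of geodesic rays, two rays being equivalent if their supports have finite symmetric difference). For a vertex $x$, $\overline{x\,\omega}$ is the unique geodesic ray from $x$ representing $\omega$; for vertices $v,z$ the confluent $b=v\curlywedge z$ is defined by $\overline{v\,\omega}\cap\overline{z\,\omega}=\overline{b\,\omega}$. Write $z\preccurlyeq v$ if $z\curlywedge v=z$. With $d$ the graph distance, the Busemann function is $\mathfrak h(x)=d(x,x\curlywedge o)-d(o,x\curlywedge o)$. Diestel-Leader graph. Let $\mathbb T_q$, $\mathbb T_r$ have roots $o_1,o_2$ and reference ends $\omega_1,\omega_2$. $\mathrm{DL}(q,r)$ has vertex set $\{x_1x_2\in\mathbb T_q\times\mathbb T_r:\mathfrak h(x_1)+\mathfrak h(x_2)=0\}$, with $x_1x_2\sim y_1y_2$ (neighbours) iff $x_1\sim y_1$ and $x_2\sim y_2$. For $a_1\in\mathbb T_q$, $a_2\in\mathbb T_r$ with $-\mathfrak h(a_2)=\mathfrak h(a_1)+n$, $n\ge0$, the tetrahedron $S(a_1,a_2)$ of height $n$ is the induced subgraph $\{x_1x_2\in\mathrm{DL}(q,r):a_1\preccurlyeq x_1,\ a_2\preccurlyeq x_2\}$. The number $\rho(P)$ is the spectral radius of the simple random walk operator $P$ on $\mathrm{DL}(q,r)$. Measures. $\delta_\lambda$ is the unit point mass at $\lambda$. Simple random walk on the finite graph $S_n$ moves from $x$ to each neighbour of $x$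 in $S_n$ with probability $1/\deg_{S_n}(x)$, where $\deg_{S_n}$ is the degree in $S_n$; $P_n$ is its transition operator. The cumulative spectral measure is $\tilde\mu_n=\frac1{|S_n|}\sum_{\lambda\in\mathrm{spec}(P_n)}\mathrm{mult}(\lambda)\,\delta_\lambda$, with $\mathrm{mult}(\lambda)$ the multiplicity of the eigenvalue $\lambda$.
   Formalization: The second sum in μ̃ runs over 1≤N≤(r+q)/(r−q) instead of 2≤N≤(r+q)/(r−q); without the N=1 term (an atom at 0) the limit would have total mass 1−(r−q)(r−1)/r²<1, which is impossible for a weak limit of probability measures on [−1,1]. *)

theory Defs
  imports "HOL-Probability.Probability" "HOL-Library.Function_Algebras"
begin

section \<open>Homogeneous trees with a root and a reference end\<close>

text \<open>A graph is a symmetric irreflexive relation; the vertex set is the whole type.\<close>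

definition is_tree :: "('a \<Rightarrow> 'a \<Rightarrow> bool) \<Rightarrow> bool" where
  "is_tree E \<longleftrightarrow> symp E \<and> irreflp E \<and> (\<forall>x y. E\<^sup>*\<^sup>* x y) \<and>
     \<not> (\<exists>xs. length xs \<ge> 3 \<and> distinct xs \<and> successively E xs \<and> E (last xs) (hd xs))"

definition gdist :: "('a \<Rightarrow> 'a \<Rightarrow> bool) \<Rightarrow> 'a \<Rightarrow> 'a \<Rightarrow> nat" where
  "gdist E x y = (LEAST n. (E ^^ n) x y)"

definition geodesic_ray :: "('a \<Rightarrow> 'a \<Rightarrow> bool) \<Rightarrow> (nat \<Rightarrow> 'a) \<Rightarrow> bool" where
  "geodesic_ray E \<pi> \<longleftrightarrow> (\<forall>i j. gdist E (\<pi> i) (\<pi> (i + j)) = j)"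

definition ray_equiv :: "('a \<Rightarrow> 'a \<Rightarrow> bool) \<Rightarrow> ((nat \<Rightarrow> 'a) \<times> (nat \<Rightarrow> 'a)) set" where
  "ray_equiv E = {(\<pi>, \<sigma>). geodesic_ray E \<pi> \<and> geodesic_ray E \<sigma> \<and>
     finite (sym_diff (range \<pi>) (range \<sigma>))}"

definition ends :: "('a \<Rightarrow> 'a \<Rightarrow> bool) \<Rightarrow> (nat \<Rightarrow> 'a) set set" where
  "ends E = {\<pi>. geodesic_ray E \<pi>} // ray_equiv E"

record 'a ended_tree =
  adj :: "'a \<Rightarrow> 'a \<Rightarrow> bool"
  base :: 'a
  ref_end :: "(nat \<Rightarrow> 'a) set"

text \<open>\<open>T\<close> is a copy of the homogeneous tree of degree \<open>p + 1\<close>.\<close>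

definition homogeneous_tree :: "nat \<Rightarrow> 'a ended_tree \<Rightarrow> bool" where
  "homogeneous_tree p T \<longleftrightarrow> is_tree (adj T) \<and> (\<forall>x. card {y. adj T x y} = p + 1) \<and>
     ref_end T \<in> ends (adj T)"

definition ray_from :: "'a ended_tree \<Rightarrow> 'a \<Rightarrow> nat \<Rightarrow> 'a" where
  "ray_from T x = (THE \<pi>. \<pi> \<in> ref_end T \<and> \<pi> 0 = x)"

definition confluent :: "'a ended_tree \<Rightarrow> 'a \<Rightarrow> 'a \<Rightarrow> 'a" where
  "confluent T v z =
     (THE b. range (ray_from T v) \<inter> range (ray_from T z) = range (ray_from T b))"

definition above :: "'a ended_tree \<Rightarrow> 'a \<Rightarrow> 'a \<Rightarrow> bool" where
  "above T z v \<longleftrightarrow> confluent T z v = z"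

definition busemann :: "'a ended_tree \<Rightarrow> 'a \<Rightarrow> int" where
  "busemann T x = int (gdist (adj T) x (confluent T x (base T)))
                - int (gdist (adj T) (base T) (confluent T x (base T)))"

section \<open>Diestel-Leader graphs and tetrahedra\<close>

definition dl_verts :: "'a ended_tree \<Rightarrow> 'b ended_tree \<Rightarrow> ('a \<times> 'b) set" where
  "dl_verts T1 T2 = {(x1, x2). busemann T1 x1 + busemann T2 x2 = 0}"

text \<open>To be used for vertices in \<^const>\<open>dl_verts\<close> only.\<close>

definition dl_adj :: "'a ended_tree \<Rightarrow> 'b ended_tree \<Rightarrow> 'a \<times> 'b \<Rightarrow> 'a \<times> 'b \<Rightarrow> bool" where
  "dl_adj T1 T2 x y \<longleftrightarrow> adj T1 (fst x) (fst y) \<and> adj T2 (snd x) (snd y)"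

definition tetrahedron ::
    "'a ended_tree \<Rightarrow> 'b ended_tree \<Rightarrow> 'a \<Rightarrow> 'b \<Rightarrow> ('a \<times> 'b) set" where
  "tetrahedron T1 T2 a1 a2 = {(x1, x2) \<in> dl_verts T1 T2. above T1 a1 x1 \<and> above T2 a2 x2}"

definition has_height ::
    "'a ended_tree \<Rightarrow> 'b ended_tree \<Rightarrow> 'a \<Rightarrow> 'b \<Rightarrow> nat \<Rightarrow> bool" where
  "has_height T1 T2 a1 a2 n \<longleftrightarrow> - busemann T2 a2 = busemann T1 a1 + int n"

section \<open>Simple random walk on an induced subgraph\<close>

definition nbrs :: "('v \<Rightarrow> 'v \<Rightarrow> bool) \<Rightarrow> 'v set \<Rightarrow> 'v \<Rightarrow> 'v set" where
  "nbrs E S x = {y \<in> S. E x y}"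

text \<open>Functions on \<open>S\<close> are represented by functions on the whole type that vanish off \<open>S\<close>.\<close>

definition srw_op :: "('v \<Rightarrow> 'v \<Rightarrow> bool) \<Rightarrow> 'v set \<Rightarrow> ('v \<Rightarrow> real) \<Rightarrow> 'v \<Rightarrow> real" where
  "srw_op E S f x =
     (if x \<in> S then (\<Sum>y\<in>nbrs E S x. 1 / real (card (nbrs E S x)) * f y) else 0)"

text \<open>\<open>lim sup p\<^sup>(\<^sup>n\<^sup>)(x,x)\<^sup>1\<^sup>/\<^sup>n\<close>, where \<open>p\<^sup>(\<^sup>n\<^sup>)(x,y)\<close> are the \<open>n\<close>-step transition probabilities.\<close>

definition srw_spectral_radius :: "('v \<Rightarrow> 'v \<Rightarrow> bool) \<Rightarrow> 'v set \<Rightarrow> 'v \<Rightarrow> ereal" where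
  "srw_spectral_radius E S x =
     limsup (\<lambda>n. ereal (root n ((srw_op E S ^^ n) (indicator {x}) x)))"

definition eigenspace :: "('v \<Rightarrow> 'v \<Rightarrow> bool) \<Rightarrow> 'v set \<Rightarrow> real \<Rightarrow> ('v \<Rightarrow> real) set" where
  "eigenspace E S l = {f. (\<forall>x. x \<notin> S \<longrightarrow> f x = 0) \<and> (\<forall>x\<in>S. srw_op E S f x = l * f x)}"

text \<open>For finite \<open>S\<close>, \<open>srw_op E S\<close> is self-adjoint with respect to the weights \<open>deg\<^sub>S(x)\<close>. Hence all its
  eigenvalues are real and their geometric and algebraic multiplicities agree.\<close>

definition spec :: "('v \<Rightarrow> 'v \<Rightarrow> bool) \<Rightarrow> 'v set \<Rightarrow> real set" where
  "spec E S = {l. \<exists>f\<in>eigenspace E S l. \<exists>x. f x \<noteq> 0}"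

definition mult :: "('v \<Rightarrow> 'v \<Rightarrow> bool) \<Rightarrow> 'v set \<Rightarrow> real \<Rightarrow> nat" where
  "mult E S l = vector_space.dim (\<lambda>c f x. c * f x) (eigenspace E S l)"

lemma vector_space_real_fun: "vector_space (\<lambda>(c::real) (f::'v \<Rightarrow> real) x. c * f x)"
  by unfold_locales (auto simp: fun_eq_iff algebra_simps)

section \<open>Measures on the real line\<close>

abbreviation delta :: "real \<Rightarrow> real measure" where
  "delta \<equiv> return borel"

definition measure_sum :: "'i set \<Rightarrow> ('i \<Rightarrow> real measure) \<Rightarrow> real measure" where
  "measure_sum I M =
     measure_of UNIV (sets borel) (\<lambda>A. \<integral>\<^sup>+i. emeasure (M i) A \<partial>count_space I)"

definition measure_add :: "real measure \<Rightarrow> real measure \<Rightarrow> real measure"  (infixl \<open>\<oplus>\<^sub>M\<close> 65) where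
  "M \<oplus>\<^sub>M N = measure_of UNIV (sets borel) (\<lambda>A. emeasure M A + emeasure N A)"

lemma sets_measure_sum [simp]: "sets (measure_sum I M) = sets borel"
  and space_measure_sum [simp]: "space (measure_sum I M) = UNIV"
  and sets_measure_add [simp]: "sets (K \<oplus>\<^sub>M L) = sets borel"
  and space_measure_add [simp]: "space (K \<oplus>\<^sub>M L) = UNIV"
  unfolding measure_sum_def measure_add_def
  using sets.sigma_sets_eq[of "borel :: real measure"] by (auto simp: sets_measure_of_conv space_measure_of_conv)

lemma emeasure_measure_sum:
  assumes sets: "\<And>i. i \<in> I \<Longrightarrow> sets (M i) = sets borel" and A: "A \<in> sets borel"
  shows "emeasure (measure_sum I M) A = (\<integral>\<^sup>+i. emeasure (M i) A \<partial>count_space I)"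
proof (rule emeasure_measure_of[OF measure_sum_def])
  show "countably_additive (sets (measure_sum I M)) (\<lambda>A. \<integral>\<^sup>+i. emeasure (M i) A \<partial>count_space I)"
  proof (rule countably_additiveI)
    fix F :: "nat \<Rightarrow> real set"
    assume F: "range F \<subseteq> sets (measure_sum I M)" "disjoint_family F"
    have "(\<Sum>n. \<integral>\<^sup>+i. emeasure (M i) (F n) \<partial>count_space I)
        = (\<integral>\<^sup>+i. (\<Sum>n. emeasure (M i) (F n)) \<partial>count_space I)"
      by (rule nn_integral_suminf[symmetric]) auto
    also have "\<dots> = (\<integral>\<^sup>+i. emeasure (M i) (\<Union>n. F n) \<partial>count_space I)"
      using F sets by (intro nn_integral_cong suminf_emeasure) auto
    finally show "(\<Sum>n. \<integral>\<^sup>+i. emeasure (M i) (F n) \<partial>count_space I)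
        = (\<integral>\<^sup>+i. emeasure (M i) (\<Union>n. F n) \<partial>count_space I)" .
  qed
qed (use A in \<open>auto simp: positive_def\<close>)

lemma emeasure_measure_add:
  assumes sets: "sets K = sets borel" "sets L = sets borel" and A: "A \<in> sets borel"
  shows "emeasure (K \<oplus>\<^sub>M L) A = emeasure K A + emeasure L A"
proof (rule emeasure_measure_of[OF measure_add_def])
  show "countably_additive (sets (K \<oplus>\<^sub>M L)) (\<lambda>A. emeasure K A + emeasure L A)"
  proof (rule countably_additiveI)
    fix F :: "nat \<Rightarrow> real set"
    assume F: "range F \<subseteq> sets (K \<oplus>\<^sub>M L)" "disjoint_family F"
    have "(\<Sum>n. emeasure K (F n) + emeasure L (F n))
        = (\<Sum>n. emeasure K (F n)) + (\<Sum>n. emeasure L (F n))"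
      by (rule suminf_add[symmetric]) auto
    also have "\<dots> = emeasure K (\<Union>n. F n) + emeasure L (\<Union>n. F n)"
      using F sets by (intro arg_cong2[where f = "(+)"] suminf_emeasure) auto
    finally show "(\<Sum>n. emeasure K (F n) + emeasure L (F n))
        = emeasure K (\<Union>n. F n) + emeasure L (\<Union>n. F n)" .
  qed
qed (use A in \<open>auto simp: positive_def\<close>)

definition measure_supp :: "real measure \<Rightarrow> real set" where
  "measure_supp M = {x. \<forall>U. open U \<longrightarrow> x \<in> U \<longrightarrow> emeasure M U \<noteq> 0}"

definition cumulative_spectral_measure :: "('v \<Rightarrow> 'v \<Rightarrow> bool) \<Rightarrow> 'v set \<Rightarrow> real measure" where
  "cumulative_spectral_measure E S = scale_measure (ennreal (1 / real (card S)))
     (measure_sum (spec E S) (\<lambda>l. scale_measure (of_nat (mult E S l)) (delta l)))"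

section \<open>The limit measures\<close>

definition rho :: "nat \<Rightarrow> nat \<Rightarrow> real" where
  "rho q r = 2 * sqrt (real q * real r) / (real q + real r)"

definition threshold :: "nat \<Rightarrow> nat \<Rightarrow> real" where
  "threshold q r = (real r + real q) / (real r - real q)"

definition lambda :: "nat \<Rightarrow> nat \<Rightarrow> nat \<Rightarrow> nat \<Rightarrow> real" where
  "lambda q r m N = rho q r * cos (real m / real N * pi)"

text \<open>The condition \<open>sin (N \<alpha>) \<noteq> 0\<close> says that \<open>cot (N \<alpha>)\<close> is defined. It is not redundant: division
  by zero makes the library's \<^const>\<open>cot\<close> vanish at its poles, which for even \<open>N\<close> would add
  the spurious solution \<open>\<pi>/2\<close>.\<close>

definition cot_solutions :: "nat \<Rightarrow> nat \<Rightarrow> nat \<Rightarrow> real set" where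
  "cot_solutions q r N = {\<alpha>. 0 < \<alpha> \<and> \<alpha> < pi \<and> sin (real N * \<alpha>) \<noteq> 0 \<and>
     cot (real N * \<alpha>) = (real r - real q) / (real r + real q) * cot \<alpha>}"

definition is_exp_solution :: "nat \<Rightarrow> nat \<Rightarrow> nat \<Rightarrow> real \<Rightarrow> bool" where
  "is_exp_solution q r N \<alpha> \<longleftrightarrow> \<alpha> > 0 \<and>
     exp (2 * real N * \<alpha>) =
       (real q - real r * exp (2 * \<alpha>)) / (real q * exp (2 * \<alpha>) - real r)"

text \<open>The solutions in \<open>(0, \<pi>)\<close> are numbered in increasing order.\<close>

definition alpha :: "nat \<Rightarrow> nat \<Rightarrow> nat \<Rightarrow> nat \<Rightarrow> real" where
  "alpha q r m N =
     (if real N < threshold q r then sorted_list_of_set (cot_solutions q r N) ! m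
      else if real N = threshold q r then
        (if m = 0 then 0
         else if m = N - 1 then pi
         else sorted_list_of_set (cot_solutions q r N) ! (m - 1))
      else
        (if m = 0 then (THE \<alpha>. is_exp_solution q r N \<alpha>)
         else sorted_list_of_set (cot_solutions q r N) ! (m - 1)))"

definition lambda' :: "nat \<Rightarrow> nat \<Rightarrow> nat \<Rightarrow> nat \<Rightarrow> real" where
  "lambda' q r m N =
     (if real N > threshold q r \<and> m = 0 then rho q r * cosh (alpha q r 0 N)
      else rho q r * cos (alpha q r m N))"

text \<open>The second sum must start at \<open>N = 1\<close>, where \<open>cot_solutions q r 1 = {\<pi>/2}\<close> and hence
  \<open>lambda' q r 0 1 = 0\<close>: without this term, the total mass of the two limit measures would only be
  \<open>1 - (r - q) (r - 1) / r\<^sup>2\<close>.\<close>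

definition mu_lim :: "nat \<Rightarrow> nat \<Rightarrow> real measure" where
  "mu_lim q r =
     scale_measure (ennreal ((real q - 1) * (real r - 1)))
       (measure_sum {2..} (\<lambda>N. scale_measure (ennreal (1 / real r ^ N))
          (measure_sum {1..N - 1} (\<lambda>m. delta (lambda q r m N)))))
     \<oplus>\<^sub>M
     scale_measure (ennreal ((real r - real q) * (real r - 1)))
       (measure_sum {N. 1 \<le> N \<and> real N \<le> threshold q r}
          (\<lambda>N. scale_measure (ennreal (1 / real r ^ (N + 1)))
            (measure_sum {0..N - 1} (\<lambda>m. delta (lambda' q r m N)))))
     \<oplus>\<^sub>M
     scale_measure (ennreal ((real r - real q) * (real r - 1)))
       (measure_sum {N. real N > threshold q r}
          (\<lambda>N. scale_measure (ennreal (1 / real r ^ (N + 1)))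
            (measure_sum {1..N - 2} (\<lambda>m. delta (lambda' q r m N)))))"

definition nu_lim :: "nat \<Rightarrow> nat \<Rightarrow> real measure" where
  "nu_lim q r =
     scale_measure (ennreal ((real r - real q) * (real r - 1)))
       (measure_sum {N. real N > threshold q r}
          (\<lambda>N. scale_measure (ennreal (1 / real r ^ (N + 1)))
            (delta (lambda' q r 0 N) \<oplus>\<^sub>M delta (- lambda' q r 0 N))))"

end

theory Submission
  imports Defs
begin

text \<open>
  Seen from its reference end, a homogeneous tree is nothing but a predecessor map that lowers the
  Busemann function by one, every vertex having the same number of successors
  (\<open>homogeneous_tree_ancestral\<close>). In these terms the tetrahedron with apices \<open>a1\<close>, \<open>a2\<close> and height \<open>n\<close>
  consists of the pairs of a descendant of \<open>a1\<close> at depth \<open>k\<close> and a descendant of \<open>a2\<close> at depth \<open>n - k\<close>,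
  where \<open>k\<close> is called the level. At an interior level the walk replaces \<open>(x, y)\<close> by one of the \<open>q\<close>
  pairs (child of \<open>x\<close>, parent of \<open>y\<close>) or one of the \<open>r\<close> pairs (parent of \<open>x\<close>, child of \<open>y\<close>); at the two
  extreme levels only one of these directions is left.

  The spectrum is found by separation of variables. Take a Haar function of each tree, that is, the
  difference of the indicators of the descendants of two siblings, or, in the first tree, the constant
  one. Its sum over the children of a vertex is a multiple of its value at that vertex, so the product of
  two Haar functions with a function of the level is an eigenfunction as soon as the latter satisfies a
  three-term recurrence. With \<open>t = sqrt (r / q)\<close>, conjugation by \<open>t\<^sup>k\<close> turns this recurrence into that of the
  Chebyshev polynomials \<open>U\<^sub>k\<close> of the second kind (numbered such that \<open>U\<^sub>k(cos \<alpha>) sin \<alpha> = sin (k \<alpha>)\<close>), and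
  the eigenvalue at the parameter \<open>x\<close> is \<open>\<rho> x\<close>. If both Haar functions have mean zero, the product lives
  inside a sub-tetrahedron of some height \<open>N\<close> and has to vanish at both of its ends: \<open>U\<^sub>N(x) = 0\<close>, whence
  the eigenvalues \<open>\<lambda>\<^sub>m\<^sub>,\<^sub>N\<close>. If the first factor is constant, the support reaches the level of \<open>a1\<close>, where
  the degree is \<open>q\<close>; the condition there becomes \<open>r U\<^sub>N\<^sub>-\<^sub>1(x) = q U\<^sub>N\<^sub>+\<^sub>1(x)\<close>. This polynomial equation of
  degree \<open>N\<close> has \<open>N\<close> distinct real solutions, which are the numbers \<open>\<lambda>'\<close> divided by \<open>\<rho>\<close>: sign changes at
  the points \<open>cos (j \<pi> / N)\<close> give those in \<open>(-1, 1)\<close>, and exactly when \<open>N\<close> exceeds \<open>(r + q) / (r - q)\<close> there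
  is a pair \<open>\<plusminus> cosh \<alpha>\<close> outside \<open>[-1, 1]\<close>.

  These eigenfunctions are linearly independent (\<open>eigenfun_independent\<close>), which bounds multiplicities from
  below (\<open>mult_ge\<close>). Counting the pairs of Haar functions for fixed \<open>N\<close> gives, per vertex of the
  tetrahedron and in the limit, the weights \<open>(q - 1) (r - 1) r\<^sup>-\<^sup>N\<close> and \<open>(r - q) (r - 1) r\<^sup>-\<^sup>N\<^sup>-\<^sup>1\<close> of the
  limit measures. Conversely the multiplicities add up to at most the number of vertices
  (\<open>sum_mult_le_card\<close>), while the limit measures have total mass one (\<open>limit_term_total\<close>). So there is no
  room left: the lower bounds for a set and for its complement force convergence
  (\<open>tendsto_of_lower_bounds\<close>), and this for every Borel set.

  The spectral radius is at most \<open>\<rho>\<close> because \<open>t\<^sup>h\<close>, with \<open>h\<close> the first Busemann function, is a positive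
  eigenfunction of the walk with eigenvalue \<open>\<rho>\<close>. It is at least \<open>\<rho> cos (\<pi> / n)\<close> because \<open>t\<^sup>k sin (k \<pi> / n)\<close>,
  restricted to a tetrahedron of height \<open>n\<close>, is subharmonic up to this factor.
\<close>

section \<open>The predecessor map towards the reference end\<close>

locale acyclic_connected =
  fixes E :: "'a \<Rightarrow> 'a \<Rightarrow> bool"
  assumes tree: "is_tree E"
begin

abbreviation d :: "'a \<Rightarrow> 'a \<Rightarrow> nat" where "d \<equiv> gdist E"

lemma adj_sym: "E x y \<Longrightarrow> E y x"
  using tree by (auto simp: is_tree_def dest: sympD)

lemma adj_neq: "E x y \<Longrightarrow> x \<noteq> y"
  using tree by (auto simp: is_tree_def dest: irreflpD)

lemma no_cycle: "length xs \<ge> 3 \<Longrightarrow> distinct xs \<Longrightarrow> successively E xs \<Longrightarrow> \<not> E (last xs) (hd xs)"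
  using tree by (auto simp: is_tree_def)

lemma walk_of_length_d: "(E ^^ d x y) x y"
proof -
  have "E\<^sup>*\<^sup>* x y"
    using tree by (auto simp: is_tree_def)
  then obtain n where "(E ^^ n) x y"
    by (auto simp: rtranclp_power)
  then show ?thesis
    unfolding gdist_def by (rule LeastI)
qed

lemma d_le_walk: "(E ^^ n) x y \<Longrightarrow> d x y \<le> n"
  unfolding gdist_def by (rule Least_le)

lemma d_triangle: "d x z \<le> d x y + d y z"
  by (rule d_le_walk) (rule relpowp_trans[OF walk_of_length_d walk_of_length_d])

lemma d_eq_0_iff: "d x y = 0 \<longleftrightarrow> x = y"
  using walk_of_length_d[of x y] d_le_walk[of 0 x x] by auto

lemma d_le_1: "E x y \<Longrightarrow> d x y \<le> 1"
  using d_le_walk[of 1 x y] by auto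

lemma adj_of_d: "d x y = 1 \<Longrightarrow> E x y"
  using walk_of_length_d[of x y] by auto

lemma d_step_le: "E x y \<Longrightarrow> d x z \<le> Suc (d y z)"
  using d_triangle[of x z y] d_le_1[of x y] by linarith

lemma nearer_neighbour:
  assumes "d x z = Suc m"
  obtains y where "E x y" "d y z = m"
proof -
  have "(E ^^ Suc m) x z"
    using walk_of_length_d[of x z] assms by simp
  then obtain y where y: "E x y" "(E ^^ m) y z"
    by (blast dest: relpowp_Suc_D2)
  then have "d y z = m"
    using d_le_walk[OF y(2)] d_step_le[OF y(1), of z] assms by linarith
  with y that show ?thesis by blast
qed

text \<open>Descend towards \<open>z\<close> from both vertices simultaneously until the two descents meet. An edge between
  \<open>x\<close> and \<open>y\<close>, or a common neighbour farther out, would close the resulting path to a cycle.\<close>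

lemma joined_within_ball:
  assumes "d x z = m" "d y z = m" "x \<noteq> y"
  shows "\<exists>xs. 3 \<le> length xs \<and> distinct xs \<and> successively E xs \<and> hd xs = x \<and> last xs = y \<and>
    (\<forall>v\<in>set xs. d v z \<le> m)"
  using assms
proof (induction m arbitrary: x y)
  case 0
  then show ?case by (simp add: d_eq_0_iff)
next
  case (Suc m)
  obtain x' where x': "E x x'" "d x' z = m"
    using Suc.prems(1) by (rule nearer_neighbour)
  obtain y' where y': "E y y'" "d y' z = m"
    using Suc.prems(2) by (rule nearer_neighbour)
  show ?case
  proof (cases "x' = y'")
    case True
    have "x \<noteq> x'" "y \<noteq> x'"
      using x' y' True adj_neq by auto
    then show ?thesis
      using x' y' True Suc.prems by (intro exI[of _ "[x, x', y]"]) (auto simp: adj_sym)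
  next
    case False
    from Suc.IH[OF x'(2) y'(2) False] obtain xs where
      xs: "3 \<le> length xs" "distinct xs" "successively E xs" "hd xs = x'" "last xs = y'"
        "\<forall>v\<in>set xs. d v z \<le> m" by blast
    have "xs \<noteq> []" using xs(1) by auto
    have "x \<notin> set xs" "y \<notin> set xs"
      using xs(6) Suc.prems by auto
    then show ?thesis
      using xs x' y' \<open>xs \<noteq> []\<close> Suc.prems
      by (intro exI[of _ "x # xs @ [y]"])
        (auto simp: successively_append_iff successively_Cons adj_sym le_SucI)
  qed
qed

lemma d_neq_of_adj:
  assumes "E x y"
  shows "d x z \<noteq> d y z"
proof
  assume eq: "d x z = d y z"
  have "x \<noteq> y" using assms adj_neq by auto
  from joined_within_ball[OF eq refl this] no_cycle adj_sym[OF assms] show False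
    by blast
qed

lemma nearer_neighbour_unique:
  assumes "d x z = Suc m" "E x y" "E x y'" "d y z = m" "d y' z = m"
  shows "y = y'"
proof (rule ccontr)
  assume "y \<noteq> y'"
  from joined_within_ball[OF assms(4,5) this] obtain xs where
    xs: "3 \<le> length xs" "distinct xs" "successively E xs" "hd xs = y" "last xs = y'"
      "\<forall>v\<in>set xs. d v z \<le> m" by blast
  have "x \<notin> set xs" using xs(6) assms(1) by auto
  then show False
    using no_cycle[of "x # xs"] xs(1-5) assms(2,3) adj_sym[of x y'] by (cases xs) (simp_all split: if_splits)
qed

end

locale tree_with_ray = acyclic_connected +
  fixes \<pi> :: "nat \<Rightarrow> 'a"
  assumes ray: "geodesic_ray E \<pi>"
begin

lemma d_ray: "i \<le> j \<Longrightarrow> d (\<pi> i) (\<pi> j) = j - i"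
  using ray unfolding geodesic_ray_def by (metis le_add_diff_inverse)

text \<open>By the triangle inequality the integers \<open>d(x, \<pi> n) - n\<close> decrease in \<open>n\<close> and are bounded below, so
  they become constant. Their limit is the Busemann function of the ray that vanishes at \<open>\<pi> 0\<close>.\<close>

lemma busemann_limit_exists: "\<exists>b. \<exists>n0. \<forall>n\<ge>n0. int (d x (\<pi> n)) = b + int n"
proof -
  define f where "f n = d x (\<pi> n) + d (\<pi> 0) x - n" for n
  have low: "n \<le> d x (\<pi> n) + d (\<pi> 0) x" for n
    using d_triangle[of "\<pi> 0" "\<pi> n" x] d_ray[of 0 n] by simp
  have dec: "f (Suc n) \<le> f n" for n
  proof -
    have "d x (\<pi> (Suc n)) \<le> Suc (d x (\<pi> n))"
      using d_triangle[of x "\<pi> (Suc n)" "\<pi> n"] d_ray[of n "Suc n"] by simp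
    then show ?thesis
      using low[of n] low[of "Suc n"] by (simp add: f_def)
  qed
  have anti: "f n \<le> f m" if "m \<le> n" for m n
    using dec that by (rule lift_Suc_antimono_le)
  define n0 where "n0 = (ARG_MIN f n. True)"
  have "f n0 \<le> f n" for n
    unfolding n0_def by (rule arg_min_nat_le) simp
  with anti have "f n = f n0" if "n \<ge> n0" for n
    using that by (metis le_antisym)
  then have const: "d x (\<pi> n) + d (\<pi> 0) x = f n0 + n" if "n \<ge> n0" for n
    using low[of n] that by (metis f_def le_add_diff_inverse2)
  have "int (d x (\<pi> n)) = (int (f n0) - int (d (\<pi> 0) x)) + int n" if "n \<ge> n0" for n
    using const[OF that] by linarith
  then show ?thesis by blast
qed

definition bus :: "'a \<Rightarrow> int" where
  "bus x = (SOME b. \<exists>n0. \<forall>n\<ge>n0. int (d x (\<pi> n)) = b + int n)"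

lemma bus_eventually: "eventually (\<lambda>n. int (d x (\<pi> n)) = bus x + int n) sequentially"
  unfolding eventually_sequentially bus_def by (rule someI_ex[OF busemann_limit_exists])

lemma bus_le: "bus x \<le> int (d x (\<pi> n)) - int n"
proof -
  obtain m where m: "m \<ge> n" "int (d x (\<pi> m)) = bus x + int m"
    using eventually_conj[OF bus_eventually[of x] eventually_ge_at_top[of n]]
    by (auto simp: eventually_sequentially)
  have "d x (\<pi> m) \<le> d x (\<pi> n) + (m - n)"
    using d_triangle[of x "\<pi> m" "\<pi> n"] d_ray[OF m(1)] by simp
  with m show ?thesis by linarith
qed

lemma bus_ray: "bus (\<pi> n) = - int n"
proof -
  obtain m where m: "m \<ge> n" "int (d (\<pi> n) (\<pi> m)) = bus (\<pi> n) + int m"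
    using eventually_conj[OF bus_eventually[of "\<pi> n"] eventually_ge_at_top[of n]]
    by (auto simp: eventually_sequentially)
  then show ?thesis using d_ray[OF m(1)] by simp
qed

lemma bus_adj:
  assumes "E x y"
  shows "bus y = bus x + 1 \<or> bus y = bus x - 1"
proof -
  obtain n where n: "int (d x (\<pi> n)) = bus x + int n" "int (d y (\<pi> n)) = bus y + int n"
    using eventually_conj[OF bus_eventually[of x] bus_eventually[of y]]
    by (auto simp: eventually_sequentially)
  then show ?thesis
    using d_neq_of_adj[OF assms, of "\<pi> n"] d_step_le[OF assms, of "\<pi> n"]
      d_step_le[OF adj_sym[OF assms], of "\<pi> n"] by linarith
qed

text \<open>The parent is the neighbour on the way to the end: a vertex has exactly one neighbour that is nearer
  to a given far point of the ray, and for a point far enough out the distances compute the Busemann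
  function of all vertices concerned.\<close>

lemma parent_exists_unique: "\<exists>!y. E x y \<and> bus y = bus x - 1"
proof (rule ex_ex1I)
  obtain n where n: "int (d x (\<pi> n)) = bus x + int n" "n \<ge> nat (1 - bus x)"
    using eventually_conj[OF bus_eventually[of x] eventually_ge_at_top[of "nat (1 - bus x)"]]
    by (auto simp: eventually_sequentially)
  then have "d x (\<pi> n) = Suc (d x (\<pi> n) - 1)" by linarith
  then obtain y where y: "E x y" "d y (\<pi> n) = d x (\<pi> n) - 1"
    by (rule nearer_neighbour)
  have "bus y \<le> bus x - 1"
    using bus_le[of y n] y n by linarith
  with bus_adj[OF y(1)] y(1) show "\<exists>y. E x y \<and> bus y = bus x - 1" by auto
next
  fix y z
  assume yz: "E x y \<and> bus y = bus x - 1" "E x z \<and> bus z = bus x - 1"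
  obtain n where n: "int (d x (\<pi> n)) = bus x + int n" "int (d y (\<pi> n)) = bus y + int n"
    "int (d z (\<pi> n)) = bus z + int n"
    using eventually_conj[OF bus_eventually[of x] eventually_conj[OF bus_eventually[of y] bus_eventually[of z]]]
    by (auto simp: eventually_sequentially)
  show "y = z"
    by (rule nearer_neighbour_unique[of x "\<pi> n" "d y (\<pi> n)"]) (use n yz in auto)
qed

definition par :: "'a \<Rightarrow> 'a" where
  "par x = (THE y. E x y \<and> bus y = bus x - 1)"

lemma adj_par: "E x (par x)" and bus_par: "bus (par x) = bus x - 1"
  using theI'[OF parent_exists_unique[of x]] unfolding par_def by auto

lemma par_eqI: "E x y \<Longrightarrow> bus y = bus x - 1 \<Longrightarrow> par x = y"
  using parent_exists_unique[of x] adj_par[of x] bus_par[of x] by auto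

lemma adj_iff_par: "E x y \<longleftrightarrow> y = par x \<or> x = par y"
  using bus_adj[of x y] par_eqI[of x y] par_eqI[of y x] adj_sym adj_par by (metis add_diff_cancel_right')

lemma bus_par_pow: "bus ((par ^^ k) x) = bus x - int k"
  by (induction k) (auto simp: bus_par)

lemma bus_lipschitz: "(E ^^ n) x y \<Longrightarrow> \<bar>bus x - bus y\<bar> \<le> int n"
proof (induction n arbitrary: y)
  case (Suc n)
  then obtain z where "(E ^^ n) x z" "E z y" by (auto elim: relpowp_Suc_E)
  with Suc.IH[of z] bus_adj[of z y] show ?case by auto
qed auto

lemma d_par_pow: "d x ((par ^^ k) x) = k"
proof (rule antisym)
  have "(E ^^ k) x ((par ^^ k) x)"
    by (induction k) (auto intro: relpowp_Suc_I adj_par)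
  then show "d x ((par ^^ k) x) \<le> k" by (rule d_le_walk)
  show "k \<le> d x ((par ^^ k) x)"
    using bus_lipschitz[OF walk_of_length_d[of x "(par ^^ k) x"]] bus_par_pow[of k x] by linarith
qed

lemma geodesic_ray_par: "geodesic_ray E (\<lambda>k. (par ^^ k) x)"
  unfolding geodesic_ray_def
proof (intro allI)
  fix i j
  have "(par ^^ (i + j)) x = (par ^^ j) ((par ^^ i) x)"
    by (simp add: funpow_add add.commute[of i j])
  then show "d ((par ^^ i) x) ((par ^^ (i + j)) x) = j"
    by (simp add: d_par_pow)
qed

lemma ray_eq_par_pow: "\<pi> (i + k) = (par ^^ k) (\<pi> i)"
proof (induction k)
  case (Suc k)
  have "E (\<pi> (i + k)) (\<pi> (i + Suc k))"
    by (rule adj_of_d) (simp add: d_ray)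
  then have "par (\<pi> (i + k)) = \<pi> (i + Suc k)"
    by (rule par_eqI) (simp add: bus_ray)
  with Suc.IH show ?case by simp
qed simp

text \<open>A shortest walk to a far point of the ray has to lower the Busemann function at every step,
  so it climbs from parent to parent.\<close>

lemma walk_down_is_par_pow: "(E ^^ n) x y \<Longrightarrow> bus y = bus x - int n \<Longrightarrow> y = (par ^^ n) x"
proof (induction n arbitrary: y)
  case (Suc n)
  then obtain z where z: "(E ^^ n) x z" "E z y" by (auto elim: relpowp_Suc_E)
  from bus_lipschitz[OF z(1)] bus_adj[OF z(2)] Suc.prems(2)
  have b: "bus z = bus x - int n" "bus y = bus z - 1" by auto
  with Suc.IH[OF z(1)] par_eqI[OF z(2)] show ?case by simp
qed auto

lemma joins_ray: "\<exists>k n. (par ^^ k) x = \<pi> n"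
proof -
  obtain n where n: "int (d x (\<pi> n)) = bus x + int n"
    using bus_eventually[of x] by (auto simp: eventually_sequentially)
  have "\<pi> n = (par ^^ d x (\<pi> n)) x"
    by (rule walk_down_is_par_pow[OF walk_of_length_d]) (use n in \<open>simp add: bus_ray\<close>)
  then show ?thesis by metis
qed

lemma common_ancestor: "\<exists>i j. (par ^^ i) x = (par ^^ j) y"
proof -
  obtain k n where kn: "(par ^^ k) x = \<pi> n" using joins_ray by blast
  obtain l m where lm: "(par ^^ l) y = \<pi> m" using joins_ray by blast
  have "(par ^^ (m + k)) x = \<pi> (n + m)" "(par ^^ (n + l)) y = \<pi> (n + m)"
    using kn lm ray_eq_par_pow[of n m] ray_eq_par_pow[of m n] add.commute[of m n]
    by (simp_all add: funpow_add)
  then show ?thesis by metis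
qed

lemma par_ray_equiv: "finite (sym_diff (range \<pi>) (range (\<lambda>k. (par ^^ k) x)))"
proof -
  obtain k n where kn: "(par ^^ k) x = \<pi> n" using joins_ray by blast
  have shift: "(par ^^ (k + i)) x = \<pi> (n + i)" for i
    using kn ray_eq_par_pow[of n i] by (simp add: funpow_add add.commute[of k i])
  have "range \<pi> \<subseteq> \<pi> ` {..<n} \<union> range (\<lambda>k. (par ^^ k) x)"
  proof
    fix v assume "v \<in> range \<pi>"
    then obtain i where "v = \<pi> i" by blast
    then show "v \<in> \<pi> ` {..<n} \<union> range (\<lambda>k. (par ^^ k) x)"
      using shift[of "i - n"] by (cases "i < n") (auto simp: image_iff, metis)
  qed
  moreover have "range (\<lambda>k. (par ^^ k) x) \<subseteq> (\<lambda>k. (par ^^ k) x) ` {..<k} \<union> range \<pi>"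
  proof
    fix v assume "v \<in> range (\<lambda>k. (par ^^ k) x)"
    then obtain i where "v = (par ^^ i) x" by blast
    then show "v \<in> (\<lambda>k. (par ^^ k) x) ` {..<k} \<union> range \<pi>"
      using shift[of "i - k"] by (cases "i < k") auto
  qed
  ultimately have "sym_diff (range \<pi>) (range (\<lambda>k. (par ^^ k) x))
      \<subseteq> \<pi> ` {..<n} \<union> (\<lambda>k. (par ^^ k) x) ` {..<k}"
    by blast
  then show ?thesis by (rule finite_subset) auto
qed

text \<open>A geodesic ray that once moves from a parent to a child cannot turn back, so its Busemann
  function stays bounded below, while it is unbounded along any ray sharing infinitely many vertices
  with \<open>\<pi>\<close>.\<close>

lemma ray_towards_end_unique:
  assumes "geodesic_ray E \<sigma>" "finite (sym_diff (range \<pi>) (range \<sigma>))"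
  shows "\<sigma> k = (par ^^ k) (\<sigma> 0)"
proof -
  have ds: "d (\<sigma> i) (\<sigma> (i + j)) = j" for i j
    using assms(1) by (auto simp: geodesic_ray_def)
  have adj: "E (\<sigma> i) (\<sigma> (Suc i))" for i
    using ds[of i 1] adj_of_d by simp
  have down: "\<sigma> (Suc i) = par (\<sigma> i)" for i
  proof (rule ccontr)
    assume up0: "\<sigma> (Suc i) \<noteq> par (\<sigma> i)"
    have up: "\<sigma> (i + j) = par (\<sigma> (Suc (i + j)))" for j
    proof (induction j)
      case 0
      then show ?case using adj[of i] up0 adj_iff_par[of "\<sigma> i" "\<sigma> (Suc i)"] by simp
    next
      case (Suc j)
      have "\<sigma> (i + j) \<noteq> \<sigma> (Suc (Suc (i + j)))"
        using ds[of "i + j" 2] d_eq_0_iff[of "\<sigma> (i + j)" "\<sigma> (i + j)"] by auto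
      then show ?case
        using adj[of "Suc (i + j)"] Suc.IH adj_iff_par[of "\<sigma> (Suc (i + j))" "\<sigma> (Suc (Suc (i + j)))"] by auto
    qed
    have busj: "bus (\<sigma> (i + j)) = bus (\<sigma> i) + int j" for j
    proof (induction j)
      case (Suc j)
      then show ?case using up[of j] bus_par[of "\<sigma> (Suc (i + j))"] by simp
    qed simp
    define B where "B = bus ` \<sigma> ` {..i}"
    have "finite B" by (simp add: B_def)
    have "B \<noteq> {}" by (auto simp: B_def)
    have low: "Min B \<le> bus (\<sigma> j)" for j
    proof (cases "j \<le> i")
      case True
      then show ?thesis using \<open>finite B\<close> by (auto simp: B_def)
    next
      case False
      have "Min B \<le> bus (\<sigma> i)" using \<open>finite B\<close> by (auto simp: B_def)
      then show ?thesis using busj[of "j - i"] False by simp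
    qed
    have "\<pi> ` {nat (1 - Min B)..} \<subseteq> sym_diff (range \<pi>) (range \<sigma>)"
    proof
      fix v assume "v \<in> \<pi> ` {nat (1 - Min B)..}"
      then obtain n where n: "v = \<pi> n" "n \<ge> nat (1 - Min B)" by auto
      have "v \<notin> range \<sigma>"
      proof
        assume "v \<in> range \<sigma>"
        then obtain j where "v = \<sigma> j" by blast
        then show False using low[of j] bus_ray[of n] n by simp
      qed
      then show "v \<in> sym_diff (range \<pi>) (range \<sigma>)" using n by auto
    qed
    moreover have "inj \<pi>"
      by (rule injI) (metis bus_ray of_nat_eq_iff neg_equal_iff_equal)
    then have "infinite (\<pi> ` {nat (1 - Min B)..})"
      by (subst finite_image_iff) (auto simp: inj_on_def infinite_Ici)
    ultimately show False
      using assms(2) finite_subset by blast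
  qed
  show ?thesis by (induction k) (auto simp: down)
qed

end

text \<open>A homogeneous tree as it looks from its reference end: a forest of descendants without a root.\<close>

locale ancestral =
  fixes par :: "'a \<Rightarrow> 'a" and lev :: "'a \<Rightarrow> int" and p :: nat
  assumes lev_par: "lev (par x) = lev x - 1"
    and card_children: "card {y. par y = x} = p"
    and p_ge_2: "p \<ge> 2"

definition pred :: "'a ended_tree \<Rightarrow> 'a \<Rightarrow> 'a" where
  "pred T x = ray_from T x 1"

text \<open>The ray that represents the end and starts at \<open>x\<close> runs through the iterated predecessors of \<open>x\<close>.
  Therefore confluents are first common ancestors, \<open>above\<close> is the ancestor relation, and the Busemann
  function differs from \<open>bus\<close> only by the constant that makes it vanish at the root.\<close>

theorem homogeneous_tree_ancestral:
  assumes T: "homogeneous_tree p T" and p: "2 \<le> p"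
  shows "ancestral (pred T) (busemann T) p"
    and "adj T x y \<longleftrightarrow> y = pred T x \<or> x = pred T y"
    and "above T z v \<longleftrightarrow> (\<exists>k. (pred T ^^ k) v = z)"
    and "busemann T (base T) = 0"
proof -
  have tr: "is_tree (adj T)" and deg: "\<And>x. card {y. adj T x y} = p + 1"
    and "ref_end T \<in> ends (adj T)"
    using T by (auto simp: homogeneous_tree_def)
  then obtain \<pi> where pi: "geodesic_ray (adj T) \<pi>"
    and ref: "ref_end T = ray_equiv (adj T) `` {\<pi>}"
    by (auto simp: ends_def elim!: quotientE)
  interpret tree_with_ray "adj T" \<pi>
    by unfold_locales (rule tr, rule pi)
  have ref_iff: "\<sigma> \<in> ref_end T \<longleftrightarrow>
      geodesic_ray (adj T) \<sigma> \<and> finite (sym_diff (range \<pi>) (range \<sigma>))" for \<sigma>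
    by (auto simp: ref ray_equiv_def pi)
  have ray_from: "ray_from T x = (\<lambda>k. (par ^^ k) x)" for x
    unfolding ray_from_def
  proof (rule the_equality)
    show "(\<lambda>k. (par ^^ k) x) \<in> ref_end T \<and> (par ^^ 0) x = x"
      using ref_iff geodesic_ray_par par_ray_equiv by auto
    show "\<sigma> = (\<lambda>k. (par ^^ k) x)" if "\<sigma> \<in> ref_end T \<and> \<sigma> 0 = x" for \<sigma>
      using ray_towards_end_unique[of \<sigma>] that ref_iff by auto
  qed
  have pred: "pred T = par"
    by (rule ext) (simp add: pred_def ray_from)
  have range_inj: "x = y" if "range (\<lambda>k. (par ^^ k) x) = range (\<lambda>k. (par ^^ k) y)" for x y
  proof -
    have "x \<in> range (\<lambda>k. (par ^^ k) y)" "y \<in> range (\<lambda>k. (par ^^ k) x)"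
      using that rangeI[of "\<lambda>k. (par ^^ k) x" 0] rangeI[of "\<lambda>k. (par ^^ k) y" 0] by auto
    then obtain i j where ij: "x = (par ^^ i) y" "y = (par ^^ j) x" by blast
    then have "i = 0"
      using bus_par_pow[of i y] bus_par_pow[of j x] by simp
    then show ?thesis using ij by simp
  qed
  have confluentI: "confluent T v z = b"
    if "range (\<lambda>k. (par ^^ k) v) \<inter> range (\<lambda>k. (par ^^ k) z) = range (\<lambda>k. (par ^^ k) b)" for v z b
    unfolding confluent_def ray_from using that range_inj by (intro the_equality) auto
  have confluent_ex: "\<exists>i j. confluent T v z = (par ^^ i) v \<and> (par ^^ i) v = (par ^^ j) z \<and>
      range (\<lambda>k. (par ^^ k) v) \<inter> range (\<lambda>k. (par ^^ k) z) = range (\<lambda>k. (par ^^ k) (confluent T v z))" for v z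
  proof -
    define i where "i = (LEAST i. \<exists>j. (par ^^ i) v = (par ^^ j) z)"
    obtain j where j: "(par ^^ i) v = (par ^^ j) z"
      using LeastI_ex[OF common_ancestor[of v z]] by (auto simp: i_def)
    have "range (\<lambda>k. (par ^^ k) v) \<inter> range (\<lambda>k. (par ^^ k) z) = range (\<lambda>k. (par ^^ k) ((par ^^ i) v))"
      (is "?L = ?R")
    proof
      show "?R \<subseteq> ?L"
      proof
        fix w assume "w \<in> ?R"
        then obtain k where "w = (par ^^ k) ((par ^^ i) v)" by blast
        then have "w = (par ^^ (k + i)) v" "w = (par ^^ (k + j)) z"
          using j by (auto simp: funpow_add)
        then show "w \<in> ?L" by blast
      qed
      show "?L \<subseteq> ?R"
      proof
        fix w assume "w \<in> ?L"
        then obtain k l where kl: "w = (par ^^ k) v" "w = (par ^^ l) z" by blast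
        then have "i \<le> k"
          unfolding i_def by (intro Least_le exI[of _ l]) metis
        then have "w = (par ^^ (k - i)) ((par ^^ i) v)"
          using kl by (metis funpow_add comp_apply le_add_diff_inverse2)
        then show "w \<in> ?R" by blast
      qed
    qed
    with confluentI[OF this] j show ?thesis by metis
  qed
  have bus_diff: "busemann T x = bus x - bus (base T)" for x
  proof -
    obtain i j where "confluent T x (base T) = (par ^^ i) x" "(par ^^ i) x = (par ^^ j) (base T)"
      using confluent_ex by blast
    then have "busemann T x = int i - int j" "bus x - int i = bus (base T) - int j"
      using bus_par_pow[of i x] bus_par_pow[of j "base T"] d_par_pow[of x i] d_par_pow[of "base T" j]
      by (auto simp: busemann_def)
    then show ?thesis by simp
  qed
  show "busemann T (base T) = 0" by (simp add: bus_diff)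
  show "adj T x y \<longleftrightarrow> y = pred T x \<or> x = pred T y"
    by (simp add: adj_iff_par pred)
  show "above T z v \<longleftrightarrow> (\<exists>k. (pred T ^^ k) v = z)"
  proof
    assume "above T z v"
    then have "confluent T z v = z" by (simp add: above_def)
    with confluent_ex[of z v] show "\<exists>k. (pred T ^^ k) v = z" by (auto simp: pred)
  next
    assume "\<exists>k. (pred T ^^ k) v = z"
    then obtain k where k: "(par ^^ k) v = z" by (auto simp: pred)
    have "range (\<lambda>k. (par ^^ k) z) \<subseteq> range (\<lambda>k. (par ^^ k) v)"
    proof
      fix w assume "w \<in> range (\<lambda>k. (par ^^ k) z)"
      then obtain l where "w = (par ^^ l) z" by blast
      then have "w = (par ^^ (l + k)) v" using k by (auto simp: funpow_add)
      then show "w \<in> range (\<lambda>k. (par ^^ k) v)" by blast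
    qed
    then show "above T z v"
      unfolding above_def by (intro confluentI) blast
  qed
  show "ancestral (pred T) (busemann T) p"
  proof
    show "busemann T (pred T x) = busemann T x - 1" for x
      by (simp add: bus_diff pred bus_par)
    show "card {y. pred T y = x} = p" for x
    proof -
      have "{y. adj T x y} = insert (par x) {y. par y = x}"
        by (auto simp: adj_iff_par)
      moreover have "par x \<notin> {y. par y = x}"
        using bus_par[of x] bus_par[of "par x"] by force
      moreover have "finite {y. adj T x y}"
        using deg[of x] by (rule_tac card_ge_0_finite) simp
      ultimately have "p + 1 = Suc (card {y. par y = x})"
        using deg[of x] by simp
      then show ?thesis by (simp add: pred)
    qed
  qed (rule p)
qed

section \<open>Haar functions on the descendants of a vertex\<close>

context ancestral
begin

definition anc :: "'a \<Rightarrow> 'a \<Rightarrow> bool" where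
  "anc z v \<longleftrightarrow> (\<exists>k. (par ^^ k) v = z)"

definition desc :: "nat \<Rightarrow> 'a \<Rightarrow> 'a set" where
  "desc m v = {x. (par ^^ m) x = v}"

lemma finite_children: "finite {y. par y = x}"
  using card_children[of x] p_ge_2 by (intro card_ge_0_finite) simp

lemma lev_par_pow: "lev ((par ^^ k) x) = lev x - int k"
  by (induction k) (auto simp: lev_par)

lemma anc_refl [simp]: "anc z z"
  unfolding anc_def by (rule exI[of _ 0]) simp

lemma anc_lev: "anc z v \<Longrightarrow> lev z \<le> lev v"
  by (auto simp: anc_def lev_par_pow)

lemma anc_same_lev: "anc z v \<Longrightarrow> lev v \<le> lev z \<Longrightarrow> z = v"
  by (auto simp: anc_def lev_par_pow)

lemma anc_par_iff: "anc z v \<longleftrightarrow> z = v \<or> anc z (par v)"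
proof
  assume "anc z v"
  then obtain k where "(par ^^ k) v = z" by (auto simp: anc_def)
  then show "z = v \<or> anc z (par v)"
    by (cases k) (auto simp: anc_def funpow_Suc_right simp del: funpow.simps)
next
  assume "z = v \<or> anc z (par v)"
  then show "anc z v"
  proof
    assume "anc z (par v)"
    then obtain k where "(par ^^ k) (par v) = z" by (auto simp: anc_def)
    then have "(par ^^ Suc k) v = z" by (simp add: funpow_Suc_right del: funpow.simps)
    then show ?thesis unfolding anc_def by blast
  qed simp
qed

lemma desc_iff_anc: "v \<in> desc m z \<longleftrightarrow> anc z v \<and> lev v = lev z + int m"
  by (auto simp: anc_def desc_def lev_par_pow)

lemma desc_0 [simp]: "desc 0 v = {v}"
  by (auto simp: desc_def)

lemma desc_Suc: "desc (Suc m) v = (\<Union>x\<in>desc m v. {y. par y = x})"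
  by (auto simp: desc_def funpow_Suc_right simp del: funpow.simps)

lemma finite_desc: "finite (desc m v)"
  by (induction m) (auto simp: desc_Suc finite_children)

lemma sum_desc_Suc: "(\<Sum>y\<in>desc (Suc m) v. f y) = (\<Sum>x\<in>desc m v. \<Sum>y | par y = x. f y)"
  unfolding desc_Suc by (rule sum.UNION_disjoint) (auto simp: finite_desc finite_children)

lemma card_desc: "card (desc m v) = p ^ m"
proof (induction m)
  case (Suc m)
  have "card (desc (Suc m) v) = (\<Sum>y\<in>desc (Suc m) v. 1)" by simp
  also have "\<dots> = (\<Sum>x\<in>desc m v. \<Sum>y | par y = x. 1)" by (rule sum_desc_Suc)
  also have "\<dots> = p ^ Suc m" using Suc by (simp add: card_children)
  finally show ?case .
qed simp

text \<open>A distinguished child of every vertex. Subtracting the indicator of the descendants of the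
  distinguished sibling turns the indicators of the descendants of the other children into a basis of
  the functions on the children with sum zero.\<close>

definition first_child :: "'a \<Rightarrow> 'a" where
  "first_child x = (SOME y. par y = x)"

lemma par_first_child: "par (first_child x) = x"
proof -
  have "{y. par y = x} \<noteq> {}"
    using card_children[of x] p_ge_2 by (intro notI) simp
  then have "\<exists>y. par y = x" by blast
  then show ?thesis
    unfolding first_child_def by (rule someI_ex)
qed

lemma lev_first_child: "lev (first_child x) = lev x + 1"
  using lev_par[of "first_child x"] by (simp add: par_first_child)

lemma inj_first_child: "inj first_child"
  by (rule injI) (metis par_first_child)

definition haar_index :: "'a \<Rightarrow> 'a set" where
  "haar_index a = {c. anc a c \<and> (c = a \<or> c \<noteq> first_child (par c))}"

definition haar :: "'a \<Rightarrow> 'a \<Rightarrow> 'a \<Rightarrow> real" where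
  "haar a c x =
     (if c = a then of_bool (anc a x) else of_bool (anc c x) - of_bool (anc (first_child (par c)) x))"

lemma lev_first_sibling: "lev (first_child (par c)) = lev c"
  by (simp add: lev_first_child lev_par)

lemma anc_par_other_lev: "lev x \<noteq> lev z \<Longrightarrow> anc z (par x) \<longleftrightarrow> anc z x"
  by (auto simp: anc_par_iff[of z x])

lemma haar_par: "lev x \<noteq> lev c \<Longrightarrow> haar a c (par x) = haar a c x"
  using anc_par_other_lev[of x c] anc_par_other_lev[of x "first_child (par c)"]
  by (auto simp: haar_def lev_first_sibling)

lemma haar_eq_0: "lev x < lev c \<Longrightarrow> haar a c x = 0"
  using anc_lev[of c x] anc_lev[of "first_child (par c)" x] by (auto simp: haar_def lev_first_sibling)

lemma haar_self: "c \<in> haar_index a \<Longrightarrow> haar a c c = 1"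
  using anc_same_lev[of "first_child (par c)" c]
  by (auto simp: haar_def haar_index_def lev_first_sibling)

lemma sum_children_indicator:
  "(\<Sum>y | par y = x. of_bool (anc v y) :: real) = real p * of_bool (anc v x) + of_bool (par v = x)"
proof -
  have "of_bool (anc v y) = (of_bool (anc v x) + of_bool (y = v) :: real)" if "par y = x" for y
  proof -
    have "\<not> anc v (par v)"
      using anc_lev[of v "par v"] by (auto simp: lev_par)
    then show ?thesis using that anc_par_iff[of v y] by auto
  qed
  then have "(\<Sum>y | par y = x. of_bool (anc v y) :: real)
      = (\<Sum>y | par y = x. of_bool (anc v x) + of_bool (y = v))"
    by (intro sum.cong) auto
  also have "\<dots> = real p * of_bool (anc v x) + (\<Sum>y | par y = x. of_bool (y = v))"
    by (simp add: sum.distrib card_children)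
  also have "(\<Sum>y | par y = x. of_bool (y = v) :: real) = of_bool (par v = x)"
    using sum.delta[OF finite_children[of x], of v "\<lambda>_. 1 :: real"] by (simp add: of_bool_def)
  finally show ?thesis .
qed

text \<open>At the common parent the contributions of the two siblings cancel; everywhere else a Haar function is
  constant on the children of a vertex and takes the same value at the vertex itself.\<close>

lemma sum_children_haar:
  assumes "anc a x"
  shows "(\<Sum>y | par y = x. haar a c y) = real p * haar a c x"
proof -
  have "par a \<noteq> x"
    using anc_lev[OF assms] by (auto simp: lev_par)
  then show ?thesis
    using assms by (auto simp: haar_def sum_subtractf sum_children_indicator par_first_child right_diff_distrib)
qed

lemma sum_desc_haar: "anc a v \<Longrightarrow> (\<Sum>x\<in>desc m v. haar a c x) = real p ^ m * haar a c v"
proof (induction m)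
  case (Suc m)
  have "anc a x" if "x \<in> desc m v" for x
  proof -
    obtain k where "(par ^^ k) v = a" using Suc.prems by (auto simp: anc_def)
    then have "(par ^^ (k + m)) x = a" using that by (auto simp: desc_def funpow_add)
    then show ?thesis unfolding anc_def by blast
  qed
  then show ?case
    using Suc by (simp add: sum_desc_Suc sum_children_haar flip: sum_distrib_left)
qed simp

text \<open>Among the descendants of \<open>a\<close>, a Haar function vanishes above the level of its index, and at that level
  it lives on the index and its first sibling only, the latter not being an index. This triangularity is
  behind the linear independence of the Haar functions.\<close>

lemma haar_triangular:
  assumes c: "c \<in> haar_index a" "c' \<in> haar_index a" and "lev c \<le> lev c'" "haar a c' c \<noteq> 0"
  shows "c' = c"
proof -
  have lev: "lev c = lev c'"
    using haar_eq_0[of c c' a] assms by force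
  consider (root) "c' = a" "anc a c" | (child) "c' \<noteq> a" "anc c' c"
    | (sibling) "c' \<noteq> a" "anc (first_child (par c')) c"
    using assms(4) by (cases "c' = a"; cases "anc c' c"; cases "anc (first_child (par c')) c") (auto simp: haar_def)
  then show ?thesis
  proof cases
    case root
    then show ?thesis using anc_same_lev lev by auto
  next
    case child
    then show ?thesis using anc_same_lev lev by auto
  next
    case sibling
    then have "first_child (par c') = c"
      using anc_same_lev lev by (auto simp: lev_first_sibling)
    then have "first_child (par c) = c"
      using par_first_child by metis
    then have "c = a" using c by (auto simp: haar_index_def)
    then show ?thesis using anc_same_lev[of a c'] lev c by (auto simp: haar_index_def)
  qed
qed

text \<open>The indices at depth \<open>d > 0\<close> are the vertices that are not first children, and there are as many first
  children at this depth as vertices at depth \<open>d - 1\<close>.\<close>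

lemma card_haar_index:
  "finite {c \<in> haar_index a. lev c = lev a + int d}"
  "card {c \<in> haar_index a. lev c = lev a + int d} = (if d = 0 then 1 else (p - 1) * p ^ (d - 1))"
proof -
  have sub: "{c \<in> haar_index a. lev c = lev a + int d} \<subseteq> desc d a"
    by (auto simp: haar_index_def desc_iff_anc)
  then show "finite {c \<in> haar_index a. lev c = lev a + int d}"
    using finite_desc finite_subset by blast
  show "card {c \<in> haar_index a. lev c = lev a + int d} = (if d = 0 then 1 else (p - 1) * p ^ (d - 1))"
  proof (cases d)
    case 0
    have "{c \<in> haar_index a. lev c = lev a + int d} = {a}"
      using 0 anc_same_lev[of a] by (auto simp: haar_index_def dest!: anc_same_lev[of a])
    then show ?thesis using 0 by simp
  next
    case (Suc m)
    have "{c \<in> haar_index a. lev c = lev a + int d} = desc d a - first_child ` desc m a" (is "?L = ?R")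
    proof
      show "?L \<subseteq> ?R"
      proof
        fix c assume c: "c \<in> ?L"
        then have "c \<noteq> a" using Suc by auto
        then show "c \<in> ?R"
          using c sub par_first_child by (auto simp: haar_index_def)
      qed
      show "?R \<subseteq> ?L"
      proof
        fix c assume c: "c \<in> ?R"
        then have "par c \<in> desc m a" using Suc by (auto simp: desc_Suc)
        then have "c \<noteq> first_child (par c)" using c by auto
        then show "c \<in> ?L" using c by (auto simp: haar_index_def desc_iff_anc)
      qed
    qed
    moreover have "first_child ` desc m a \<subseteq> desc d a"
      using Suc by (auto simp: desc_Suc par_first_child)
    moreover have "card (first_child ` desc m a) = p ^ m"
      using inj_first_child by (subst card_image) (auto intro: inj_on_subset simp: card_desc)
    ultimately show ?thesis
      using Suc by (simp add: card_Diff_subset finite_desc card_desc diff_mult_distrib)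
  qed
qed

end

section \<open>Multiplicities of eigenvalues on a finite graph\<close>

context
begin

interpretation fun_space: vector_space "\<lambda>(c::real) (f::'v \<Rightarrow> real) x. c * f x"
  by (rule vector_space_real_fun)

lemma sum_fun_at: "(\<Sum>i\<in>I. f i) x = (\<Sum>i\<in>I. f i x)" for f :: "'i \<Rightarrow> 'v \<Rightarrow> real"
  by (induction I rule: infinite_finite_induct) auto

lemma srw_op_add: "srw_op E S (f + g) = srw_op E S f + srw_op E S g"
  by (rule ext) (simp add: srw_op_def distrib_left sum.distrib)

lemma srw_op_scale: "srw_op E S (\<lambda>x. c * f x) = (\<lambda>x. c * srw_op E S f x)"
  by (rule ext) (simp add: srw_op_def sum_distrib_left mult_ac)

lemma eigenspaceD: "f \<in> eigenspace E S l \<Longrightarrow> srw_op E S f = (\<lambda>x. l * f x)"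
  by (rule ext) (auto simp: eigenspace_def srw_op_def)

lemma subspace_eigenspace: "fun_space.subspace (eigenspace E S l)"
  unfolding fun_space.subspace_def
proof (intro conjI ballI allI)
  show "0 \<in> eigenspace E S l"
    by (auto simp: eigenspace_def srw_op_def)
  show "f + g \<in> eigenspace E S l" if "f \<in> eigenspace E S l" "g \<in> eigenspace E S l" for f g
    using that by (auto simp: eigenspace_def srw_op_add distrib_left)
  show "(\<lambda>x. c * f x) \<in> eigenspace E S l" if "f \<in> eigenspace E S l" for c f
    using that by (auto simp: eigenspace_def srw_op_scale)
qed

definition deltas :: "'v set \<Rightarrow> ('v \<Rightarrow> real) set" where
  "deltas S = (\<lambda>y. indicator {y}) ` S"

lemma in_span_deltas:
  assumes "finite S" "\<And>x. x \<notin> S \<Longrightarrow> f x = 0"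
  shows "f \<in> fun_space.span (deltas S)"
proof -
  have "f = (\<Sum>y\<in>S. (\<lambda>x. f y * indicator {y} x))"
  proof
    fix x
    have "(\<Sum>y\<in>S. f y * indicator {y} x) = (\<Sum>y\<in>S. if x = y then f y else 0)"
      by (intro sum.cong) auto
    then show "f x = (\<Sum>y\<in>S. (\<lambda>x. f y * indicator {y} x)) x"
      using assms by (simp add: sum_fun_at)
  qed
  also have "\<dots> \<in> fun_space.span (deltas S)"
    by (intro fun_space.span_sum fun_space.span_scale fun_space.span_base) (auto simp: deltas_def)
  finally show ?thesis .
qed

lemma independent_functions_bound:
  assumes "finite S" "fun_space.independent B" "\<And>f x. f \<in> B \<Longrightarrow> x \<notin> S \<Longrightarrow> f x = 0"
  shows "finite B" "card B \<le> card S"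
proof -
  have "finite (deltas S)" "card (deltas S) \<le> card S"
    using assms(1) by (auto simp: deltas_def card_image_le)
  moreover have "B \<subseteq> fun_space.span (deltas S)"
    using assms in_span_deltas by blast
  ultimately show "finite B" "card B \<le> card S"
    using fun_space.independent_span_bound[of "deltas S" B] assms(2) by auto
qed

lemma eigenspace_basis:
  assumes "finite S"
  obtains B where "B \<subseteq> eigenspace E S l" "fun_space.independent B"
    "eigenspace E S l \<subseteq> fun_space.span B" "finite B" "card B = mult E S l"
proof -
  obtain B where B: "B \<subseteq> eigenspace E S l" "fun_space.independent B"
    "eigenspace E S l \<subseteq> fun_space.span B" "card B = fun_space.dim (eigenspace E S l)"
    using fun_space.basis_exists by blast
  moreover have "finite B"
    using B by (intro independent_functions_bound(1)[OF assms]) (auto simp: eigenspace_def)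
  ultimately show ?thesis using that by (simp add: mult_def)
qed

lemma card_le_mult:
  assumes S: "finite S" and J: "finite J" and F: "\<And>j. j \<in> J \<Longrightarrow> F j \<in> eigenspace E S l"
    and indep: "\<And>a. (\<And>x. x \<in> S \<Longrightarrow> (\<Sum>j\<in>J. a j * F j x) = 0) \<Longrightarrow> \<forall>j\<in>J. a j = 0"
  shows "card J \<le> mult E S l"
proof -
  obtain B where B: "B \<subseteq> eigenspace E S l" "fun_space.independent B"
    "eigenspace E S l \<subseteq> fun_space.span B" "finite B" "card B = mult E S l"
    using eigenspace_basis[OF S] by metis
  have inj: "inj_on F J"
  proof (rule inj_onI, rule ccontr)
    fix i j assume ij: "i \<in> J" "j \<in> J" "F i = F j" "i \<noteq> j"
    define a where "a k = (of_bool (k = i) - of_bool (k = j) :: real)" for k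
    have "(\<Sum>k\<in>J. a k * F k x) = 0" for x
      using ij J by (simp add: a_def left_diff_distrib sum_subtractf of_bool_def if_distrib[of "\<lambda>u. u * _"] cong: if_cong)
    then have "\<forall>k\<in>J. a k = 0" using indep by blast
    then show False using ij by (auto simp: a_def)
  qed
  have "fun_space.independent (F ` J)"
  proof
    assume "fun_space.dependent (F ` J)"
    then obtain u where u: "\<exists>v\<in>F ` J. u v \<noteq> 0" "(\<Sum>v\<in>F ` J. (\<lambda>x. u v * v x)) = 0"
      using J by (auto simp: fun_space.dependent_finite)
    have "(\<Sum>j\<in>J. u (F j) * F j x) = 0" for x
      using fun_cong[OF u(2), of x] inj by (simp add: sum_fun_at sum.reindex)
    then have "\<forall>j\<in>J. u (F j) = 0" by (intro indep)
    with u(1) show False by auto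
  qed
  moreover have "F ` J \<subseteq> fun_space.span B"
    using F B by auto
  ultimately have "card (F ` J) \<le> card B"
    using fun_space.independent_span_bound[OF B(4)] by blast
  then show ?thesis using B inj by (simp add: card_image)
qed

text \<open>Applying \<open>P - \<mu>\<close> to a vanishing sum of eigenfunctions removes the one with eigenvalue \<open>\<mu>\<close> and
  multiplies the others by nonzero factors.\<close>

lemma eigenspaces_independent:
  assumes "finite L" "\<And>l. l \<in> L \<Longrightarrow> f l \<in> eigenspace E S l" "(\<Sum>l\<in>L. f l) = 0" "l \<in> L"
  shows "f l = 0"
  using assms
proof (induction L arbitrary: f l rule: finite_induct)
  case (insert m L)
  define g where "g l = (\<lambda>x. (l - m) * f l x)" for l
  have mem: "g l \<in> eigenspace E S l" if "l \<in> L" for l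
    using fun_space.subspace_scale[OF subspace_eigenspace, of "f l" E S l "l - m"] insert.prems(1) that
    by (auto simp: g_def)
  have op_sum: "srw_op E S (\<Sum>l\<in>A. f l) x = (\<Sum>l\<in>A. l * f l x)" if "finite A" "A \<subseteq> insert m L" for A x
    using that
  proof (induction A rule: finite_induct)
    case empty
    then show ?case by (simp add: srw_op_def)
  next
    case (insert k A)
    then have "srw_op E S (f k) = (\<lambda>x. k * f k x)"
      using insert.prems \<open>\<And>l. l \<in> _ \<Longrightarrow> f l \<in> eigenspace E S l\<close> by (intro eigenspaceD) auto
    then have "srw_op E S (f k + sum f A) x = k * f k x + (\<Sum>l\<in>A. l * f l x)"
      using insert.IH insert.prems by (simp add: srw_op_add plus_fun_apply)
    then show ?case by (simp only: sum.insert[OF insert.hyps])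
  qed
  have "(\<Sum>l\<in>L. g l) = 0"
  proof
    fix x
    have "(\<Sum>l\<in>insert m L. l * f l x) = 0"
      using op_sum[of "insert m L" x] insert.hyps(1) unfolding insert.prems(2)
      by (simp add: srw_op_def zero_fun_apply split: if_splits)
    moreover have "(\<Sum>l\<in>insert m L. f l x) = 0"
      using fun_cong[OF insert.prems(2), of x] by (simp add: sum_fun_at)
    ultimately have "(\<Sum>l\<in>insert m L. l * f l x) - m * (\<Sum>l\<in>insert m L. f l x) = 0" by simp
    then have "(\<Sum>l\<in>insert m L. (l - m) * f l x) = 0"
      by (simp only: sum_distrib_left left_diff_distrib sum_subtractf)
    then show "(\<Sum>l\<in>L. g l) x = 0 x"
      using insert.hyps by (simp add: g_def sum_fun_at)
  qed
  then have "g l = 0" if "l \<in> L" for l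
    using insert.IH[of g] mem that by blast
  then have zero: "f l = 0" if "l \<in> L" for l
    using that insert.hyps by (force simp: g_def fun_eq_iff)
  then have "f m = 0"
    using insert.prems(2) insert.hyps sum.neutral[of L f] by (metis add_0_right sum.insert)
  then show ?case using zero insert.prems(3) by auto
qed auto

text \<open>The union of bases of the eigenspaces is independent, hence no larger than the space of functions on
  \<open>S\<close>.\<close>

lemma sum_mult_le_card:
  assumes S: "finite S" and L: "finite L"
  shows "(\<Sum>l\<in>L. mult E S l) \<le> card S"
proof -
  define good where "good l B \<longleftrightarrow> B \<subseteq> eigenspace E S l \<and> fun_space.independent B \<and> finite B \<and>
    card B = mult E S l" for l B
  have "\<forall>l. \<exists>B. good l B"
    unfolding good_def using eigenspace_basis[OF S] by metis
  then obtain B where "\<And>l. good l (B l)" by metis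
  then have B: "B l \<subseteq> eigenspace E S l" "fun_space.independent (B l)" "finite (B l)" "card (B l) = mult E S l" for l
    by (auto simp: good_def)
  have disj: "B l \<inter> B m = {}" if "l \<noteq> m" for l m
  proof (rule ccontr)
    assume "B l \<inter> B m \<noteq> {}"
    then obtain f where f: "f \<in> B l" "f \<in> B m" by blast
    then have "srw_op E S f = (\<lambda>x. l * f x)" "srw_op E S f = (\<lambda>x. m * f x)"
      using B eigenspaceD by (metis subsetD)+
    then have "l * f x = m * f x" for x by metis
    then have "f = 0" using that by (auto simp: fun_eq_iff)
    then show False using f B(2) fun_space.dependent_zero by blast
  qed
  have "fun_space.independent (\<Union>l\<in>L. B l)"
  proof
    assume "fun_space.dependent (\<Union>l\<in>L. B l)"
    then obtain u where u: "\<exists>v\<in>(\<Union>l\<in>L. B l). u v \<noteq> 0" "(\<Sum>v\<in>(\<Union>l\<in>L. B l). (\<lambda>x. u v * v x)) = 0"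
      using L B(3) by (auto simp: fun_space.dependent_finite)
    define f where "f l = (\<Sum>v\<in>B l. (\<lambda>x. u v * v x))" for l
    have "(\<Sum>l\<in>L. f l) = (\<Sum>v\<in>(\<Union>l\<in>L. B l). (\<lambda>x. u v * v x))"
      unfolding f_def using L B(3) disj by (subst sum.UNION_disjoint) auto
    then have "(\<Sum>l\<in>L. f l) = 0" using u(2) by simp
    moreover have "f l \<in> eigenspace E S l" for l
      unfolding f_def using B(1) subspace_eigenspace
      by (intro fun_space.subspace_sum fun_space.subspace_scale) auto
    ultimately have "f l = 0" if "l \<in> L" for l
      using eigenspaces_independent[OF L] that by blast
    then have "\<forall>v\<in>B l. u v = 0" if "l \<in> L" for l
      using B(2,3)[of l] that by (auto simp: fun_space.dependent_finite f_def)
    then show False using u(1) by blast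
  qed
  then have "card (\<Union>l\<in>L. B l) \<le> card S"
    using B(1) by (intro independent_functions_bound(2)[OF S]) (auto simp: eigenspace_def)
  moreover have "card (\<Union>l\<in>L. B l) = (\<Sum>l\<in>L. card (B l))"
    using L B(3) disj by (intro card_UN_disjoint) auto
  ultimately show ?thesis by (simp add: B(4))
qed

lemma mult_pos_of_spec:
  assumes "finite S" "l \<in> spec E S"
  shows "mult E S l > 0"
proof -
  obtain f x where f: "f \<in> eigenspace E S l" "f x \<noteq> 0"
    using assms(2) by (auto simp: spec_def)
  then have "card {()} \<le> mult E S l"
  proof (intro card_le_mult[where F = "\<lambda>_. f"] assms)
    fix a :: "unit \<Rightarrow> real"
    assume "\<And>x. x \<in> S \<Longrightarrow> (\<Sum>j\<in>{()}. a j * f x) = 0"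
    moreover have "x \<in> S" using f by (auto simp: eigenspace_def)
    ultimately show "\<forall>j\<in>{()}. a j = 0" using f by force
  qed auto
  then show ?thesis by simp
qed

lemma mult_eq_0_off_spec:
  assumes "finite S" "l \<notin> spec E S"
  shows "mult E S l = 0"
proof -
  obtain B where B: "B \<subseteq> eigenspace E S l" "fun_space.independent B" "card B = mult E S l"
    using eigenspace_basis[OF assms(1)] by metis
  have "eigenspace E S l \<subseteq> {0}"
    using assms(2) by (auto simp: spec_def fun_eq_iff)
  then have "B \<subseteq> {}" using B fun_space.dependent_zero by blast
  then show ?thesis using B by simp
qed

lemma finite_spec:
  assumes "finite S"
  shows "finite (spec E S)"
proof (rule ccontr)
  assume "infinite (spec E S)"
  then obtain L where L: "L \<subseteq> spec E S" "finite L" "card L = Suc (card S)"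
    using infinite_arbitrarily_large by blast
  have "card L = (\<Sum>l\<in>L. 1)" by simp
  also have "\<dots> \<le> (\<Sum>l\<in>L. mult E S l)"
    using mult_pos_of_spec[OF assms] L by (intro sum_mono) (auto simp: Suc_le_eq)
  also have "\<dots> \<le> card S" by (rule sum_mult_le_card[OF assms L(2)])
  finally show False using L by simp
qed

end

section \<open>Chebyshev polynomials and the boundary condition\<close>

text \<open>These are the Chebyshev polynomials of the second kind with the index shifted by one.\<close>

fun cheb :: "nat \<Rightarrow> real poly" where
  "cheb 0 = 0"
| "cheb (Suc 0) = 1"
| "cheb (Suc (Suc n)) = [:0, 2:] * cheb (Suc n) - cheb n"

lemma cheb_cos: "poly (cheb n) (cos a) * sin a = sin (real n * a)"
proof (induction n rule: cheb.induct)
  case (3 n)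
  have "sin (real (Suc (Suc n)) * a) = 2 * cos a * sin (real (Suc n) * a) - sin (real n * a)"
  proof -
    have "real (Suc (Suc n)) * a = real (Suc n) * a + a" "real n * a = real (Suc n) * a - a"
      by (simp_all add: algebra_simps)
    then show ?thesis by (simp only: sin_add sin_diff) simp
  qed
  with 3 show ?case by (simp add: algebra_simps)
qed auto

lemma cheb_cosh: "poly (cheb n) (cosh a) * sinh a = sinh (real n * a)"
proof (induction n rule: cheb.induct)
  case (3 n)
  have "sinh (real (Suc (Suc n)) * a) = 2 * cosh a * sinh (real (Suc n) * a) - sinh (real n * a)"
  proof -
    have "real (Suc (Suc n)) * a = real (Suc n) * a + a" "real n * a = real (Suc n) * a - a"
      by (simp_all add: algebra_simps)
    then show ?thesis by (simp only: sinh_add sinh_diff) simp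
  qed
  with 3 show ?case by (simp add: algebra_simps)
qed auto

lemma cheb_at_1: "poly (cheb n) 1 = real n"
  by (induction n rule: cheb.induct) auto

lemma cheb_minus: "poly (cheb n) (- x) = (-1) ^ Suc n * poly (cheb n) x"
  by (induction n rule: cheb.induct) (auto simp: algebra_simps)

lemma degree_cheb: "degree (cheb n) \<le> n - 1"
proof (induction n rule: cheb.induct)
  case (3 n)
  have "degree ([:0, 2:] * cheb (Suc n)) \<le> Suc n"
    by (rule order.trans[OF degree_mult_le]) (use 3 in simp)
  moreover have "degree (cheb n) \<le> Suc n" using 3 by simp
  ultimately show ?case by (auto intro: degree_diff_le)
qed auto

locale degrees =
  fixes q r :: nat
  assumes q_ge_2: "2 \<le> q" and q_less_r: "q < r"
begin

text \<open>The reciprocal of the threshold. Since \<open>\<rho>\<^sup>2 = 1 - \<kappa>\<^sup>2\<close>, the equation \<open>tanh a = \<kappa>\<close> says that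
  \<open>\<rho> cosh a = 1\<close>.\<close>

definition \<kappa> :: real where "\<kappa> = (real r - real q) / (real r + real q)"

text \<open>The zeros express the boundary condition at the level where the degree is only \<open>q\<close>, see
  \<open>radial_boundary\<close> below.\<close>

definition bdry_poly :: "nat \<Rightarrow> real poly" where
  "bdry_poly N = smult (real r) (cheb (N - 1)) - smult (real q) (cheb (N + 1))"

abbreviation roots :: "nat \<Rightarrow> real set" where
  "roots N \<equiv> {x. poly (bdry_poly N) x = 0}"

abbreviation eigvals :: "nat \<Rightarrow> real set" where
  "eigvals N \<equiv> (*) (rho q r) ` roots N"

lemma \<kappa>_bounds: "0 < \<kappa>" "\<kappa> < 1"
  using q_ge_2 q_less_r by (auto simp: \<kappa>_def field_simps)

lemma tanh_artanh_\<kappa>: "tanh (artanh \<kappa>) = \<kappa>" "artanh \<kappa> > 0"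
proof -
  have pos: "(1 + \<kappa>) / (1 - \<kappa>) > 1" using \<kappa>_bounds by (simp add: field_simps)
  then show "artanh \<kappa> > 0" by (simp add: artanh_def)
  have "exp (- 2 * artanh \<kappa>) = (1 - \<kappa>) / (1 + \<kappa>)"
    using pos \<kappa>_bounds by (simp add: artanh_def exp_minus)
  moreover have "(1 - (1 - \<kappa>) / (1 + \<kappa>)) / (1 + (1 - \<kappa>) / (1 + \<kappa>)) = \<kappa>"
    using \<kappa>_bounds by (simp add: field_simps)
  ultimately show "tanh (artanh \<kappa>) = \<kappa>"
    by (simp only: tanh_real_altdef)
qed

lemma threshold_eq: "threshold q r = 1 / \<kappa>"
  by (simp add: threshold_def \<kappa>_def)

lemma threshold_gt_1: "threshold q r > 1"
  using \<kappa>_bounds by (simp add: threshold_eq)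

lemma rho_pos: "rho q r > 0"
  using q_ge_2 q_less_r by (auto simp: rho_def)

lemma rho_square: "(rho q r)\<^sup>2 = 1 - \<kappa>\<^sup>2"
proof -
  have pos: "real q + real r > 0" using q_ge_2 by linarith
  have "(rho q r)\<^sup>2 = 4 * (real q * real r) / (real q + real r)\<^sup>2"
    by (simp add: rho_def power_divide power_mult_distrib)
  also have "\<dots> = 1 - (real r - real q)\<^sup>2 / (real q + real r)\<^sup>2"
  proof -
    have "(real q + real r)\<^sup>2 - (real r - real q)\<^sup>2 = 4 * (real q * real r)"
      by (simp add: power2_eq_square algebra_simps)
    moreover have "(real q + real r)\<^sup>2 / (real q + real r)\<^sup>2 = 1" using pos by simp
    ultimately show ?thesis by (metis diff_divide_distrib)
  qed
  also have "\<dots> = 1 - \<kappa>\<^sup>2"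
    by (simp add: \<kappa>_def power_divide add.commute)
  finally show ?thesis .
qed

lemma degree_bdry_poly: "degree (bdry_poly N) \<le> N"
  unfolding bdry_poly_def
  by (intro degree_diff_le order.trans[OF degree_smult_le] order.trans[OF degree_cheb]) auto

lemma bdry_poly_cos:
  assumes "N \<ge> 1"
  shows "poly (bdry_poly N) (cos a) * sin a =
    (real r - real q) * sin (real N * a) * cos a - (real r + real q) * cos (real N * a) * sin a"
proof -
  have "real (N - 1) * a = real N * a - a" "real (N + 1) * a = real N * a + a"
    using assms by (simp_all add: algebra_simps)
  then have "poly (bdry_poly N) (cos a) * sin a =
      real r * sin (real N * a - a) - real q * sin (real N * a + a)"
    by (simp only: bdry_poly_def poly_diff poly_smult left_diff_distrib mult.assoc cheb_cos)
  then show ?thesis by (simp add: sin_add sin_diff algebra_simps)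
qed

lemma bdry_poly_cosh:
  assumes "N \<ge> 1"
  shows "poly (bdry_poly N) (cosh a) * sinh a =
    (real r - real q) * sinh (real N * a) * cosh a - (real r + real q) * cosh (real N * a) * sinh a"
proof -
  have "real (N - 1) * a = real N * a - a" "real (N + 1) * a = real N * a + a"
    using assms by (simp_all add: algebra_simps)
  then have "poly (bdry_poly N) (cosh a) * sinh a =
      real r * sinh (real N * a - a) - real q * sinh (real N * a + a)"
    by (simp only: bdry_poly_def poly_diff poly_smult left_diff_distrib mult.assoc cheb_cosh)
  then show ?thesis by (simp add: sinh_add sinh_diff algebra_simps)
qed

lemma bdry_poly_cosh_tanh:
  assumes "N \<ge> 1"
  shows "poly (bdry_poly N) (cosh a) * sinh a =
    (real r + real q) * cosh (real N * a) * cosh a * (\<kappa> * tanh (real N * a) - tanh a)"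
proof -
  note bdry_poly_cosh[OF assms]
  also have "real r - real q = (real r + real q) * \<kappa>"
    using q_ge_2 by (simp add: \<kappa>_def)
  also have "(real r + real q) * \<kappa> * sinh (real N * a) * cosh a - (real r + real q) * cosh (real N * a) * sinh a
      = (real r + real q) * cosh (real N * a) * cosh a * (\<kappa> * tanh (real N * a) - tanh a)"
  proof -
    have "sinh b = tanh b * cosh b" for b :: real by (simp add: tanh_def)
    from this[of a] this[of "real N * a"] show ?thesis by (simp add: algebra_simps)
  qed
  finally show ?thesis .
qed

lemma bdry_poly_cosh_sgn:
  assumes "N \<ge> 1" "a > 0"
  shows "sgn (poly (bdry_poly N) (cosh a)) = sgn (\<kappa> * tanh (real N * a) - tanh a)"
proof -
  have "real r + real q > 0" using q_ge_2 by linarith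
  then have "sgn ((real r + real q) * cosh (real N * a) * cosh a) = 1"
    by simp
  moreover have "sgn (sinh a) = 1" using assms by simp
  ultimately show ?thesis
    using arg_cong[OF bdry_poly_cosh_tanh[OF assms(1), of a], of sgn] by (simp only: sgn_mult mult_1_left mult_1_right)
qed

text \<open>At the zeros of \<open>cheb N\<close> the values of the two neighbouring polynomials are opposite and alternate in
  sign.\<close>

lemma bdry_poly_node:
  assumes "0 < j" "j < N"
  shows "poly (bdry_poly N) (cos (real j * pi / real N)) = - ((-1) ^ j * (real q + real r))"
proof -
  let ?a = "real j * pi / real N"
  have "0 < ?a" "?a < pi" using assms by (auto simp: field_simps)
  then have s: "sin ?a \<noteq> 0" using sin_gt_zero by force
  have N: "real N * ?a = real j * pi" using assms by simp
  have "poly (bdry_poly N) (cos ?a) * sin ?a = - ((-1) ^ j * (real q + real r)) * sin ?a"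
    using bdry_poly_cos[of N ?a] assms unfolding N by (simp add: algebra_simps)
  then show ?thesis using s by (simp only: mult_cancel_right) simp
qed

lemma bdry_poly_minus:
  assumes "N \<ge> 1"
  shows "poly (bdry_poly N) (- x) = (-1) ^ N * poly (bdry_poly N) x"
proof -
  have "(-1 :: real) ^ Suc (N - 1) = (-1) ^ N" "(-1 :: real) ^ Suc (N + 1) = (-1) ^ N"
    using assms by auto
  then show ?thesis
    by (simp only: bdry_poly_def poly_diff poly_smult cheb_minus) (simp add: algebra_simps)
qed

lemma bdry_poly_1:
  assumes "N \<ge> 1"
  shows "poly (bdry_poly N) 1 = (real r + real q) * (\<kappa> * real N - 1)"
proof -
  have "poly (bdry_poly N) 1 = real r * (real N - 1) - real q * (real N + 1)"
    using assms by (simp add: bdry_poly_def cheb_at_1 of_nat_diff)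
  also have "\<dots> = (real r - real q) * real N - (real r + real q)"
    by (simp add: algebra_simps)
  also have "real r - real q = (real r + real q) * \<kappa>"
    using q_ge_2 by (simp add: \<kappa>_def)
  finally show ?thesis by (simp add: algebra_simps)
qed

lemma bdry_poly_1_sgn:
  assumes "N \<ge> 1"
  shows "sgn (poly (bdry_poly N) 1) = sgn (real N - threshold q r)"
proof -
  have "real r + real q > 0" using q_ge_2 by linarith
  then have "sgn (real r + real q) = 1" by (rule sgn_pos)
  moreover have "\<kappa> * real N - 1 = \<kappa> * (real N - threshold q r)"
    using \<kappa>_bounds by (simp add: threshold_eq algebra_simps)
  ultimately have "sgn (poly (bdry_poly N) 1) = sgn (\<kappa> * (real N - threshold q r))"
    using bdry_poly_1[OF assms] by (simp only: sgn_mult)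
  then show ?thesis using \<kappa>_bounds by (simp add: sgn_mult)
qed

lemma bdry_poly_nonzero:
  assumes "N \<ge> 1"
  shows "bdry_poly N \<noteq> 0"
proof
  assume zero: "bdry_poly N = 0"
  have "poly (bdry_poly N) (cosh a) < 0" if "a > 0" "tanh a = \<kappa>" for a
  proof -
    have "\<kappa> * tanh (real N * a) - tanh a < 0"
      using that \<kappa>_bounds tanh_real_lt_1[of "real N * a"] by simp
    then have "sgn (poly (bdry_poly N) (cosh a)) = -1"
      using bdry_poly_cosh_sgn[OF assms that(1)] by simp
    then show ?thesis by (simp add: sgn_if split: if_splits)
  qed
  moreover have "tanh (artanh \<kappa>) = \<kappa>" "artanh \<kappa> > 0"
    using tanh_artanh_\<kappa> .
  ultimately show False using zero by fastforce
qed

lemma finite_roots: "N \<ge> 1 \<Longrightarrow> finite (roots N)"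
  by (rule poly_roots_finite) (rule bdry_poly_nonzero)

lemma card_roots_le: "N \<ge> 1 \<Longrightarrow> card (roots N) \<le> N"
  using card_poly_roots_bound[OF bdry_poly_nonzero] degree_bdry_poly order.trans by blast

end

text \<open>Each sign change between consecutive points yields a zero, and the intervals are disjoint.\<close>

lemma card_roots_ge_sign_changes:
  fixes P :: "real poly" and x :: "nat \<Rightarrow> real"
  assumes "P \<noteq> 0"
    and "\<And>j. a \<le> j \<Longrightarrow> j \<le> a + m \<Longrightarrow> (-1) ^ j * poly P (x j) < 0"
    and "\<And>j. a \<le> j \<Longrightarrow> j < a + m \<Longrightarrow> x (Suc j) < x j"
  shows "m \<le> card {z. poly P z = 0 \<and> x (a + m) < z \<and> z < x a}"
  using assms(2,3)
proof (induction m)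
  case (Suc m)
  let ?R = "\<lambda>m. {z. poly P z = 0 \<and> x (a + m) < z \<and> z < x a}"
  have fin: "finite (?R k)" for k
    by (rule finite_subset[OF _ poly_roots_finite[OF assms(1)]]) auto
  have lt: "x (Suc (a + m)) < x (a + m)" using Suc.prems(2)[of "a + m"] by simp
  have "(-1) ^ Suc (a + m) * poly P (x (Suc (a + m))) < 0" "(-1) ^ (a + m) * poly P (x (a + m)) < 0"
    using Suc.prems(1)[of "a + m"] Suc.prems(1)[of "Suc (a + m)"] by simp_all
  then have "poly P (x (Suc (a + m))) * poly P (x (a + m)) < 0"
    by (cases "even (a + m)") (auto simp: mult_less_0_iff)
  then obtain z where z: "x (Suc (a + m)) < z" "z < x (a + m)" "poly P z = 0"
    using poly_IVT[OF lt] by blast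
  have le: "x (a + m) \<le> x a"
    using Suc.prems(2)
  proof (induction m)
    case (Suc m)
    have "x (a + m) \<le> x a" using Suc.prems by (intro Suc.IH) auto
    moreover have "x (Suc (a + m)) < x (a + m)" using Suc.prems[of "a + m"] by simp
    ultimately show ?case by simp
  qed simp
  have "insert z (?R m) \<subseteq> ?R (Suc m)" using z lt le by auto
  then have "card (insert z (?R m)) \<le> card (?R (Suc m))" by (rule card_mono[OF fin])
  moreover have "z \<notin> ?R m" using z by auto
  then have "card (insert z (?R m)) = Suc (card (?R m))" by (simp add: fin)
  moreover have "m \<le> card (?R m)" using Suc.prems by (intro Suc.IH) auto
  ultimately show ?case by simp
qed simp

context degrees
begin

abbreviation inner_roots :: "nat \<Rightarrow> real set" where
  "inner_roots N \<equiv> {x. poly (bdry_poly N) x = 0 \<and> - 1 < x \<and> x < 1}"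

abbreviation inner_eigvals :: "nat \<Rightarrow> real set" where
  "inner_eigvals N \<equiv> (*) (rho q r) ` inner_roots N"

lemma cos_node_less: "j < N \<Longrightarrow> cos (real (Suc j) * pi / real N) < cos (real j * pi / real N)"
  by (rule cos_monotone_0_pi) (auto simp: divide_simps mult_right_mono simp del: of_nat_Suc)

lemma finite_inner_roots: "N \<ge> 1 \<Longrightarrow> finite (inner_roots N)"
  by (rule finite_subset[OF _ finite_roots]) auto

text \<open>Below the threshold the boundary polynomial is negative at \<open>1\<close>, and by parity its sign at \<open>-1\<close> fits the
  same pattern. So the signs alternate at all \<open>N + 1\<close> points \<open>cos (j \<pi> / N)\<close>, the end points included.\<close>

lemma roots_below_threshold:
  assumes "N \<ge> 1" "real N < threshold q r"
  shows "roots N = inner_roots N" "card (roots N) = N"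
proof -
  let ?x = "\<lambda>j. cos (real j * pi / real N)"
  have qr: "real q + real r > 0" using q_ge_2 by linarith
  have neg: "poly (bdry_poly N) 1 < 0"
    using bdry_poly_1_sgn[OF assms(1)] assms(2) by (simp add: sgn_if split: if_splits)
  have "N \<le> card {z. poly (bdry_poly N) z = 0 \<and> ?x (0 + N) < z \<and> z < ?x 0}"
  proof (rule card_roots_ge_sign_changes)
    show "bdry_poly N \<noteq> 0" using assms by (simp add: bdry_poly_nonzero)
    show "(-1) ^ j * poly (bdry_poly N) (?x j) < 0" if "0 \<le> j" "j \<le> 0 + N" for j
    proof -
      consider "j = 0" | "j = N" | "0 < j" "j < N" using \<open>j \<le> 0 + N\<close> by linarith
      then show ?thesis
      proof cases
        case 2
        have "(-1 :: real) ^ N * (-1) ^ N = 1" by (simp flip: power_add mult_2)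
        then show ?thesis using 2 assms(1) neg bdry_poly_minus[OF assms(1), of 1]
          by (simp add: mult.assoc[symmetric])
      next
        case 3
        have "(-1 :: real) ^ j * (-1) ^ j = 1" by (simp flip: power_add mult_2)
        then show ?thesis using bdry_poly_node[OF 3] qr by (simp add: mult.assoc[symmetric])
      qed (use neg in simp)
    qed
    show "?x (Suc j) < ?x j" if "0 \<le> j" "j < 0 + N" for j
      using that cos_node_less by simp
  qed
  then have "N \<le> card (inner_roots N)" using assms(1) by (simp add: conj_commute)
  moreover have "inner_roots N \<subseteq> roots N" by auto
  ultimately show "roots N = inner_roots N" "card (roots N) = N"
    using card_roots_le[OF assms(1)] finite_roots[OF assms(1)] card_mono[of "roots N" "inner_roots N"]
      card_seteq[of "roots N" "inner_roots N"] by auto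
qed

lemma card_inner_roots_ge:
  assumes "N \<ge> 2"
  shows "N - 2 \<le> card (inner_roots N)"
proof -
  let ?x = "\<lambda>j. cos (real j * pi / real N)"
  have qr: "real q + real r > 0" using q_ge_2 by linarith
  have "N - 2 \<le> card {z. poly (bdry_poly N) z = 0 \<and> ?x (1 + (N - 2)) < z \<and> z < ?x 1}"
  proof (rule card_roots_ge_sign_changes)
    show "bdry_poly N \<noteq> 0" using assms by (simp add: bdry_poly_nonzero)
    show "(-1) ^ j * poly (bdry_poly N) (?x j) < 0" if "1 \<le> j" "j \<le> 1 + (N - 2)" for j
    proof -
      have "(-1 :: real) ^ j * (-1) ^ j = 1" by (simp flip: power_add mult_2)
      then show ?thesis using bdry_poly_node[of j N] that assms qr by (simp add: mult.assoc[symmetric])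
    qed
    show "?x (Suc j) < ?x j" if "1 \<le> j" "j < 1 + (N - 2)" for j
      using that by (intro cos_node_less) auto
  qed
  also have "\<dots> \<le> card (inner_roots N)"
  proof (rule card_mono)
    show "finite (inner_roots N)" using assms by (simp add: finite_inner_roots)
    show "{z. poly (bdry_poly N) z = 0 \<and> ?x (1 + (N - 2)) < z \<and> z < ?x 1} \<subseteq> inner_roots N"
      using cos_ge_minus_one[of "real (1 + (N - 2)) * pi / real N"] cos_le_one[of "real 1 * pi / real N"]
      by (auto simp del: of_nat_add cos_le_one cos_ge_minus_one)
  qed
  finally show ?thesis .
qed

text \<open>One zero outside \<open>(-1, 1)\<close> comes with its mirror image. Together with the \<open>N - 2\<close> zeros found by sign
  changes this reaches the degree, so there are no others.\<close>

lemma roots_from_threshold: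
  assumes N: "N \<ge> 2" and y: "poly (bdry_poly N) y = 0" "y \<ge> 1"
  shows "roots N = inner_roots N \<union> {y, - y}" "card (inner_roots N) = N - 2" "card (roots N) = N"
proof -
  have N1: "N \<ge> 1" using N by simp
  have fin: "finite (inner_roots N)" using finite_inner_roots[OF N1] .
  have sub: "inner_roots N \<union> {y, - y} \<subseteq> roots N"
    using y bdry_poly_minus[OF N1, of y] by auto
  have "inner_roots N \<inter> {y, - y} = {}" using y by auto
  then have eq: "card (inner_roots N \<union> {y, - y}) = card (inner_roots N) + 2"
    using fin y by (subst card_Un_disjoint) auto
  have le: "card (inner_roots N \<union> {y, - y}) \<le> card (roots N)"
    by (rule card_mono[OF finite_roots[OF N1] sub])
  have ge: "card (roots N) \<le> N" "N - 2 \<le> card (inner_roots N)"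
    using card_roots_le[OF N1] card_inner_roots_ge[OF N] .
  show "card (inner_roots N) = N - 2" "card (roots N) = N" using eq le ge N by linarith+
  then have "card (roots N) \<le> card (inner_roots N \<union> {y, - y})" using eq N by linarith
  then show "roots N = inner_roots N \<union> {y, - y}"
    using card_seteq[OF finite_roots[OF N1] sub] by blast
qed

lemma threshold_le_imp_ge_2: "threshold q r \<le> real N \<Longrightarrow> N \<ge> 2"
  using threshold_gt_1 by linarith

lemma roots_at_threshold:
  assumes "real N = threshold q r"
  shows "roots N = inner_roots N \<union> {1, - 1}" "card (inner_roots N) = N - 2" "card (roots N) = N"
proof -
  have N: "N \<ge> 2" using assms threshold_le_imp_ge_2 by simp
  have "poly (bdry_poly N) 1 = 0"
    using bdry_poly_1_sgn[of N] N assms by (simp add: sgn_if split: if_splits)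
  from roots_from_threshold[OF N this]
  show "roots N = inner_roots N \<union> {1, - 1}" "card (inner_roots N) = N - 2" "card (roots N) = N" by auto
qed

text \<open>The boundary polynomial is negative at \<open>cosh a\<close> if \<open>tanh a = \<kappa>\<close>, and positive at \<open>cosh c\<close> under the
  given conditions; for \<open>c = 0\<close> this is where the threshold comes in.\<close>

lemma outer_root_exists:
  assumes "real N > threshold q r" "c \<ge> 0" "c = 0 \<or> tanh c < \<kappa> * tanh (real N * c)"
  shows "\<exists>a. a > c \<and> poly (bdry_poly N) (cosh a) = 0"
proof -
  have N: "N \<ge> 1" using assms(1) threshold_gt_1 by linarith
  define b where "b = artanh \<kappa>"
  have b: "tanh b = \<kappa>" "b > 0"
    unfolding b_def using tanh_artanh_\<kappa> .
  have "\<kappa> * tanh (real N * b) - tanh b < 0"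
    using b \<kappa>_bounds tanh_real_lt_1[of "real N * b"] by simp
  then have neg: "poly (bdry_poly N) (cosh b) < 0"
    using bdry_poly_cosh_sgn[OF N b(2)] by (simp add: sgn_if split: if_splits)
  have pos: "poly (bdry_poly N) (cosh c) > 0"
  proof (cases "c = 0")
    case True
    then show ?thesis using bdry_poly_1_sgn[OF N] assms(1) by (simp add: sgn_if split: if_splits)
  next
    case False
    then have "sgn (poly (bdry_poly N) (cosh c)) = 1"
      using bdry_poly_cosh_sgn[OF N, of c] assms by simp
    then show ?thesis by (simp add: sgn_if split: if_splits)
  qed
  have "tanh c < tanh b"
  proof (cases "c = 0")
    case False
    then have "\<kappa> * tanh (real N * c) < \<kappa> * 1"
      using \<kappa>_bounds by (intro mult_strict_left_mono) (auto simp: tanh_real_lt_1)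
    then show ?thesis using False assms b by simp
  qed (use b \<kappa>_bounds in simp)
  then have "c < b" by simp
  then have "cosh c < cosh b" using assms(2) by (simp add: cosh_real_strict_mono)
  then obtain z where z: "cosh c < z" "poly (bdry_poly N) z = 0"
    using poly_IVT_neg[OF _ pos neg] by blast
  then have "z \<ge> 1" using cosh_real_ge_1[of c] by simp
  define a where "a = arcosh z"
  have a: "cosh a = z" "a \<ge> 0" using \<open>z \<ge> 1\<close> by (auto simp: a_def)
  then have "a > c" using z(1) assms(2) cosh_real_nonneg_less_iff[of c a] by simp
  then show ?thesis using a z by blast
qed

end

section \<open>The numbers \<open>\<lambda>'\<close> as zeros of the boundary polynomial\<close>

context degrees
begin

lemma cot_solutions_iff:
  assumes N: "N \<ge> 1"
  shows "\<alpha> \<in> cot_solutions q r N \<longleftrightarrow> 0 < \<alpha> \<and> \<alpha> < pi \<and> poly (bdry_poly N) (cos \<alpha>) = 0"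
proof (cases "0 < \<alpha> \<and> \<alpha> < pi")
  case True
  then have s: "sin \<alpha> > 0" by (simp add: sin_gt_zero)
  let ?s = "sin (real N * \<alpha>)" and ?c = "cos (real N * \<alpha>)"
  have qr: "real r + real q > 0" using q_ge_2 by linarith
  have bp: "poly (bdry_poly N) (cos \<alpha>) = 0 \<longleftrightarrow>
      (real r - real q) * ?s * cos \<alpha> = (real r + real q) * ?c * sin \<alpha>"
    using bdry_poly_cos[OF N, of \<alpha>] s by auto
  show ?thesis
  proof (cases "?s = 0")
    case True
    then have "?c \<noteq> 0" using sin_cos_squared_add[of "real N * \<alpha>"] by auto
    then show ?thesis using True bp s qr by (auto simp: cot_solutions_def)
  next
    case False
    have "cot (real N * \<alpha>) = (real r - real q) / (real r + real q) * cot \<alpha> \<longleftrightarrow>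
        ?c / ?s = ((real r - real q) * cos \<alpha>) / ((real r + real q) * sin \<alpha>)"
      by (simp add: cot_def)
    also have "\<dots> \<longleftrightarrow> poly (bdry_poly N) (cos \<alpha>) = 0"
      unfolding bp using False s qr by (subst frac_eq_eq) (auto simp: mult_ac)
    finally show ?thesis
      using \<open>0 < \<alpha> \<and> \<alpha> < pi\<close> False by (simp add: cot_solutions_def)
  qed
qed (auto simp: cot_solutions_def)

text \<open>Substitution of \<open>cos \<alpha>\<close> turns the trigonometric equation into a polynomial one of degree \<open>N\<close>.\<close>

lemma bij_betw_cos_cot_solutions:
  assumes "N \<ge> 1"
  shows "bij_betw cos (cot_solutions q r N) (inner_roots N)"
proof (rule bij_betw_imageI)
  show "inj_on cos (cot_solutions q r N)"
    by (rule inj_onI) (auto simp: cot_solutions_iff[OF assms] intro: cos_inj_pi)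
  show "cos ` cot_solutions q r N = inner_roots N"
  proof
    show "cos ` cot_solutions q r N \<subseteq> inner_roots N"
    proof
      fix x assume "x \<in> cos ` cot_solutions q r N"
      then obtain a where a: "x = cos a" "0 < a" "a < pi" "poly (bdry_poly N) (cos a) = 0"
        by (auto simp: cot_solutions_iff[OF assms])
      then show "x \<in> inner_roots N"
        using cos_monotone_0_pi[of 0 a] cos_monotone_0_pi[of a pi] by auto
    qed
    show "inner_roots N \<subseteq> cos ` cot_solutions q r N"
    proof
      fix x assume x: "x \<in> inner_roots N"
      then have "arccos x \<in> cot_solutions q r N"
        using arccos_lt_bounded[of x] by (simp add: cot_solutions_iff[OF assms])
      then show "x \<in> cos ` cot_solutions q r N"
        using x by (intro image_eqI[of _ _ "arccos x"]) auto
    qed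
  qed
qed

lemma cot_solutions_card:
  assumes "N \<ge> 1"
  shows "finite (cot_solutions q r N)" "card (cot_solutions q r N) = card (inner_roots N)"
  using bij_betw_cos_cot_solutions[OF assms] finite_inner_roots[OF assms]
  by (auto simp: bij_betw_finite bij_betw_same_card)

text \<open>In terms of \<open>X = exp \<alpha>\<close> and \<open>Y = exp (N \<alpha>)\<close> both equations read
  \<open>Y\<^sup>2 (q X\<^sup>2 - r) = q - r X\<^sup>2\<close>. The denominator \<open>q X\<^sup>2 - r\<close> cannot vanish at a solution since the
  right-hand side is negative.\<close>

lemma is_exp_solution_iff:
  assumes N: "N \<ge> 1"
  shows "is_exp_solution q r N \<alpha> \<longleftrightarrow> \<alpha> > 0 \<and> poly (bdry_poly N) (cosh \<alpha>) = 0"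
proof (cases "\<alpha> > 0")
  case True
  define X where "X = exp \<alpha>"
  define Y where "Y = exp (real N * \<alpha>)"
  have XY: "X > 1" "Y > 1" using True N by (auto simp: X_def Y_def)
  have "exp (2 * \<alpha>) = X\<^sup>2" "exp (2 * real N * \<alpha>) = Y\<^sup>2"
    by (simp_all add: X_def Y_def power2_eq_square flip: exp_add)
  then have exp_iff: "is_exp_solution q r N \<alpha> \<longleftrightarrow> Y\<^sup>2 = (real q - real r * X\<^sup>2) / (real q * X\<^sup>2 - real r)"
    using True by (simp add: is_exp_solution_def)
  have e: "exp (- \<alpha>) = 1 / X" "exp (- (real N * \<alpha>)) = 1 / Y"
    by (simp_all add: X_def Y_def exp_minus field_simps)
  have hyp: "sinh \<alpha> = (X - 1 / X) / 2" "cosh \<alpha> = (X + 1 / X) / 2"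
    "sinh (real N * \<alpha>) = (Y - 1 / Y) / 2" "cosh (real N * \<alpha>) = (Y + 1 / Y) / 2"
    by (simp_all add: sinh_def cosh_def e) (simp_all add: X_def Y_def)
  have "((real r - real q) * sinh (real N * \<alpha>) * cosh \<alpha> - (real r + real q) * cosh (real N * \<alpha>) * sinh \<alpha>)
      * (2 * X * Y) = real r * (Y\<^sup>2 - X\<^sup>2) - real q * (X\<^sup>2 * Y\<^sup>2 - 1)"
    using XY unfolding hyp by (simp add: field_simps power2_eq_square)
  then have "poly (bdry_poly N) (cosh \<alpha>) * sinh \<alpha> * (2 * X * Y) =
      real r * (Y\<^sup>2 - X\<^sup>2) - real q * (X\<^sup>2 * Y\<^sup>2 - 1)"
    by (simp only: bdry_poly_cosh[OF N])
  moreover have "sinh \<alpha> * (2 * X * Y) \<noteq> 0" using XY True by simp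
  ultimately have root_iff: "poly (bdry_poly N) (cosh \<alpha>) = 0 \<longleftrightarrow>
      real r * (Y\<^sup>2 - X\<^sup>2) - real q * (X\<^sup>2 * Y\<^sup>2 - 1) = 0"
    by (metis mult.assoc mult_eq_0_iff)
  also have "\<dots> \<longleftrightarrow> Y\<^sup>2 * (real q * X\<^sup>2 - real r) = real q - real r * X\<^sup>2"
    by (auto simp: algebra_simps)
  also have "\<dots> \<longleftrightarrow> Y\<^sup>2 = (real q - real r * X\<^sup>2) / (real q * X\<^sup>2 - real r)"
  proof (cases "real q * X\<^sup>2 - real r = 0")
    case True
    have "real q - real r * X\<^sup>2 < 0"
    proof -
      have "1 < X\<^sup>2" using XY by (simp add: one_less_power)
      then have "real r * 1 < real r * X\<^sup>2" using q_less_r by (intro mult_strict_left_mono) auto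
      then show ?thesis using q_less_r by linarith
    qed
    then show ?thesis using True XY by simp
  qed (simp add: field_simps)
  finally show ?thesis using exp_iff True by simp
qed (simp add: is_exp_solution_def)

definition \<theta> :: "nat \<Rightarrow> real" where
  "\<theta> N = (THE \<alpha>. is_exp_solution q r N \<alpha>)"

lemma exp_solution_unique:
  assumes "real N > threshold q r"
  shows "\<exists>!\<alpha>. is_exp_solution q r N \<alpha>"
proof -
  have N: "N \<ge> 2" using assms threshold_le_imp_ge_2[of N] by simp
  then have N1: "N \<ge> 1" by simp
  obtain a where a: "a > 0" "poly (bdry_poly N) (cosh a) = 0"
    using outer_root_exists[OF assms, of 0] by auto
  have "b = a" if "b > 0" "poly (bdry_poly N) (cosh b) = 0" for b
  proof -
    have "cosh b \<in> inner_roots N \<union> {cosh a, - cosh a}"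
      using that roots_from_threshold(1)[OF N a(2) cosh_real_ge_1] by blast
    moreover have "cosh b > 0" "cosh a > 0" "\<not> cosh b < 1"
      using cosh_real_ge_1[of b] by simp_all
    ultimately have "cosh b = cosh a" by auto
    then show ?thesis
      using cosh_real_nonneg_less_iff[of a b] cosh_real_nonneg_less_iff[of b a] that(1) a(1) by force
  qed
  then show ?thesis using a by (auto simp: is_exp_solution_iff[OF N1])
qed

lemma \<theta>:
  assumes "real N > threshold q r"
  shows "\<theta> N > 0" "poly (bdry_poly N) (cosh (\<theta> N)) = 0"
    and "\<And>a. a > 0 \<Longrightarrow> poly (bdry_poly N) (cosh a) = 0 \<Longrightarrow> \<theta> N = a"
proof -
  have N1: "N \<ge> 1" using assms threshold_le_imp_ge_2[of N] by simp
  show "\<theta> N > 0" "poly (bdry_poly N) (cosh (\<theta> N)) = 0"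
    using theI'[OF exp_solution_unique[OF assms]] unfolding \<theta>_def is_exp_solution_iff[OF N1] by auto
  show "\<theta> N = a" if "a > 0" "poly (bdry_poly N) (cosh a) = 0" for a
    unfolding \<theta>_def using that is_exp_solution_iff[OF N1] exp_solution_unique[OF assms]
    by (intro the1_equality) auto
qed

lemma lambda'_0:
  assumes "real N > threshold q r"
  shows "lambda' q r 0 N = rho q r * cosh (\<theta> N)"
  using assms by (simp add: lambda'_def alpha_def \<theta>_def)

lemma tanh_\<theta>:
  assumes "real N > threshold q r"
  shows "tanh (\<theta> N) = \<kappa> * tanh (real N * \<theta> N)"
proof -
  have "N \<ge> 1" using assms threshold_le_imp_ge_2[of N] by simp
  from bdry_poly_cosh_sgn[OF this \<theta>(1)[OF assms]] \<theta>(2)[OF assms]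
  show ?thesis by (simp add: sgn_if split: if_splits)
qed

text \<open>At the solution for \<open>N\<close> one has \<open>tanh \<theta> = \<kappa> tanh (N \<theta>) < \<kappa> tanh (M \<theta>)\<close>, so the boundary polynomial
  for \<open>M\<close> is still positive there and its zero lies farther out.\<close>

lemma \<theta>_strict_mono:
  assumes "real N > threshold q r" "N < M"
  shows "\<theta> N < \<theta> M"
proof -
  have M: "real M > threshold q r" using assms by linarith
  have "tanh (real N * \<theta> N) < tanh (real M * \<theta> N)"
    using assms \<theta>(1)[OF assms(1)] by simp
  then have "\<kappa> * tanh (real N * \<theta> N) < \<kappa> * tanh (real M * \<theta> N)"
    using \<kappa>_bounds by simp
  then have "tanh (\<theta> N) < \<kappa> * tanh (real M * \<theta> N)"
    using tanh_\<theta>[OF assms(1)] by simp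
  then obtain a where "a > \<theta> N" "poly (bdry_poly M) (cosh a) = 0"
    using outer_root_exists[OF M, of "\<theta> N"] \<theta>(1)[OF assms(1)] by auto
  then show ?thesis using \<theta>(1)[OF assms(1)] \<theta>(3)[OF M, of a] by simp
qed

lemma lambda'_0_strict_mono: "strict_mono_on {N. real N > threshold q r} (\<lambda>N. lambda' q r 0 N)"
proof (rule strict_mono_onI)
  fix N M assume NM: "N \<in> {N. real N > threshold q r}" "M \<in> {N. real N > threshold q r}" "N < M"
  then have "cosh (\<theta> N) < cosh (\<theta> M)"
    using \<theta>_strict_mono[of N M] \<theta>(1)[of N] by (intro cosh_real_strict_mono) auto
  then show "lambda' q r 0 N < lambda' q r 0 M" using NM rho_pos by (simp add: lambda'_0)
qed

lemma cosh_eq_of_tanh: "cosh x = 1 / sqrt (1 - (tanh x)\<^sup>2)" for x :: real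
proof -
  have "1 - (tanh x)\<^sup>2 = (1 / cosh x)\<^sup>2"
    using hyperbolic_pythagoras[of x] by (simp add: tanh_def power_divide divide_simps)
  then have "sqrt (1 - (tanh x)\<^sup>2) = 1 / cosh x"
    by (simp only: real_sqrt_abs) simp
  then show ?thesis by simp
qed

lemma rho_eq_sqrt: "rho q r = sqrt (1 - \<kappa>\<^sup>2)"
  using rho_square rho_pos by (metis abs_of_pos real_sqrt_abs)

lemma lambda'_0_bounds:
  assumes "real N > threshold q r"
  shows "rho q r < lambda' q r 0 N" "lambda' q r 0 N < 1"
proof -
  have t: "0 < tanh (\<theta> N)" "tanh (\<theta> N) < \<kappa>"
    using \<theta>(1)[OF assms] \<kappa>_bounds tanh_real_lt_1[of "real N * \<theta> N"]
    by (simp, simp add: tanh_\<theta>[OF assms])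
  have "1 < cosh (\<theta> N)" using cosh_real_strict_mono[of 0 "\<theta> N"] \<theta>(1)[OF assms] by simp
  then show "rho q r < lambda' q r 0 N" using rho_pos by (simp add: lambda'_0[OF assms])
  have "(tanh (\<theta> N))\<^sup>2 < \<kappa>\<^sup>2" using t by (intro power_strict_mono) auto
  moreover have "\<kappa>\<^sup>2 < 1" using \<kappa>_bounds by (simp add: power_less_one_iff)
  ultimately have "sqrt (1 - \<kappa>\<^sup>2) < sqrt (1 - (tanh (\<theta> N))\<^sup>2)" "0 < sqrt (1 - (tanh (\<theta> N))\<^sup>2)"
    by auto
  then show "lambda' q r 0 N < 1"
    by (simp add: lambda'_0[OF assms] rho_eq_sqrt cosh_eq_of_tanh)
qed

text \<open>Since \<open>\<theta> N\<close> stays away from zero, \<open>tanh (N \<theta> N)\<close> tends to one and \<open>tanh (\<theta> N) = \<kappa> tanh (N \<theta> N)\<close> to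
  \<open>\<kappa>\<close>, where \<open>\<rho> cosh\<close> takes the value one.\<close>

lemma lambda'_0_tendsto: "(\<lambda>N. lambda' q r 0 N) \<longlonglongrightarrow> 1"
proof -
  obtain K where K: "real K > threshold q r"
    using reals_Archimedean2 by blast
  let ?c = "\<theta> K"
  have c: "?c > 0" by (rule \<theta>(1)[OF K])
  have "filterlim (\<lambda>N. real N * ?c) at_top sequentially"
    using filterlim_tendsto_pos_mult_at_top[OF tendsto_const c filterlim_real_sequentially]
    by (simp add: mult.commute)
  then have "(\<lambda>N. tanh (real N * ?c)) \<longlonglongrightarrow> 1"
    by (rule filterlim_compose[OF tanh_real_at_top])
  then have lim: "(\<lambda>N. \<kappa> * tanh (real N * ?c)) \<longlonglongrightarrow> \<kappa>"
    using tendsto_mult_left[of _ 1 _ \<kappa>] by simp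
  have "(\<lambda>N. tanh (\<theta> N)) \<longlonglongrightarrow> \<kappa>"
  proof (rule tendsto_sandwich[OF _ _ lim tendsto_const])
    show "\<forall>\<^sub>F N in sequentially. \<kappa> * tanh (real N * ?c) \<le> tanh (\<theta> N)"
      using eventually_gt_at_top[of K]
    proof eventually_elim
      case (elim N)
      then have N: "real N > threshold q r" using K by linarith
      have "?c \<le> \<theta> N" using \<theta>_strict_mono[OF K elim] by simp
      then have "tanh (real N * ?c) \<le> tanh (real N * \<theta> N)" by (simp add: mult_left_mono)
      then show ?case using \<kappa>_bounds by (simp add: tanh_\<theta>[OF N])
    qed
    show "\<forall>\<^sub>F N in sequentially. tanh (\<theta> N) \<le> \<kappa>"
      using eventually_gt_at_top[of K]
    proof eventually_elim
      case (elim N)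
      then have N: "real N > threshold q r" using K by linarith
      show ?case
        using \<kappa>_bounds tanh_real_lt_1[of "real N * \<theta> N"] by (simp add: tanh_\<theta>[OF N])
    qed
  qed
  then have "(\<lambda>N. rho q r * (1 / sqrt (1 - (tanh (\<theta> N))\<^sup>2))) \<longlonglongrightarrow> rho q r * (1 / sqrt (1 - \<kappa>\<^sup>2))"
    using rho_eq_sqrt rho_pos by (intro tendsto_intros) auto
  then have "(\<lambda>N. rho q r * cosh (\<theta> N)) \<longlonglongrightarrow> 1"
    using rho_pos by (simp add: cosh_eq_of_tanh flip: rho_eq_sqrt)
  then show ?thesis
  proof (rule Lim_transform_eventually)
    show "\<forall>\<^sub>F N in sequentially. rho q r * cosh (\<theta> N) = lambda' q r 0 N"
      using eventually_gt_at_top[of K]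
    proof eventually_elim
      case (elim N)
      then have "real N > threshold q r" using K by linarith
      then show ?case by (simp add: lambda'_0)
    qed
  qed
qed

lemma bij_betw_nth_sorted_list_of_set:
  "finite X \<Longrightarrow> bij_betw (\<lambda>i. sorted_list_of_set X ! i) {..<card X} X"
  by (rule bij_betw_nth) auto

lemma bij_betw_cos_scaled:
  assumes "N \<ge> 1"
  shows "bij_betw (\<lambda>i. rho q r * cos (sorted_list_of_set (cot_solutions q r N) ! i))
    {..<card (inner_roots N)} (inner_eigvals N)"
proof -
  have "bij_betw ((*) (rho q r)) (inner_roots N) (inner_eigvals N)"
    using rho_pos by (intro bij_betw_imageI inj_onI) auto
  from bij_betw_trans[OF bij_betw_trans[OF bij_betw_nth_sorted_list_of_set[OF cot_solutions_card(1)[OF assms]]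
    bij_betw_cos_cot_solutions[OF assms]] this]
  show ?thesis by (simp add: comp_def cot_solutions_card(2)[OF assms])
qed

lemma bij_betw_lambda'_below:
  assumes "N \<ge> 1" "real N < threshold q r"
  shows "bij_betw (\<lambda>m. lambda' q r m N) {0..N - 1} (eigvals N)"
proof -
  have "{0..N - 1} = {..<card (inner_roots N)}"
  proof -
    have "card (inner_roots N) = N" using roots_below_threshold[OF assms] by simp
    then show ?thesis using assms(1) by auto
  qed
  then show ?thesis
    using bij_betw_cos_scaled[OF assms(1)] assms(2) unfolding roots_below_threshold(1)[OF assms]
    by (simp add: lambda'_def alpha_def)
qed

text \<open>From the threshold on, the cotangent solutions carry the indices from \<open>1\<close> to \<open>N - 2\<close>, while the
  positions in the sorted list start at zero.\<close>

lemma bij_betw_lambda'_inner: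
  assumes "real N \<ge> threshold q r"
  shows "bij_betw (\<lambda>m. lambda' q r m N) {1..N - 2} (inner_eigvals N)"
proof -
  have N: "N \<ge> 2" "N \<ge> 1" using threshold_le_imp_ge_2[OF assms] by auto
  have card: "card (inner_roots N) = N - 2"
  proof (cases "real N = threshold q r")
    case False
    then have "real N > threshold q r" using assms by simp
    from roots_from_threshold(2)[OF N(1) \<theta>(2)[OF this] cosh_real_ge_1] show ?thesis .
  qed (rule roots_at_threshold)
  have "bij_betw (\<lambda>m. m - 1) {1..N - 2} {..<N - 2}"
    by (rule bij_betw_byWitness[where f' = Suc]) auto
  from bij_betw_trans[OF this bij_betw_cos_scaled[OF N(2), unfolded card]]
  have "bij_betw (\<lambda>m. rho q r * cos (sorted_list_of_set (cot_solutions q r N) ! (m - 1)))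
      {1..N - 2} (inner_eigvals N)"
    by (simp add: comp_def)
  then show ?thesis
    by (rule bij_betw_cong[THEN iffD1, rotated]) (use assms N in \<open>auto simp: lambda'_def alpha_def\<close>)
qed

lemma bij_betw_lambda'_at:
  assumes "real N = threshold q r"
  shows "bij_betw (\<lambda>m. lambda' q r m N) {0..N - 1} (eigvals N)"
proof -
  have N: "N \<ge> 2" using threshold_le_imp_ge_2[of N] assms by simp
  have ends: "lambda' q r 0 N = rho q r" "lambda' q r (N - 1) N = - rho q r"
    using assms N by (auto simp: lambda'_def alpha_def)
  have eq: "{0..N - 1} = {1..N - 2} \<union> {0, N - 1}" using N by auto
  have "bij_betw (\<lambda>m. lambda' q r m N) {0, N - 1} {rho q r, - rho q r}"
    using N rho_pos ends by (auto simp: bij_betw_def inj_on_def)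
  moreover have disj: "inner_eigvals N \<inter> {rho q r, - rho q r} = {}"
  proof -
    have "\<bar>rho q r * x\<bar> \<noteq> rho q r" if "x \<in> inner_roots N" for x
      using that rho_pos by (auto simp: abs_mult)
    then show ?thesis using rho_pos by force
  qed
  ultimately have "bij_betw (\<lambda>m. lambda' q r m N) ({1..N - 2} \<union> {0, N - 1})
      (inner_eigvals N \<union> {rho q r, - rho q r})"
    using bij_betw_lambda'_inner[of N] assms disj
    by (intro bij_betw_combine) auto
  then show ?thesis
    unfolding eq roots_at_threshold(1)[OF assms] by (simp add: image_Un insert_commute)
qed

abbreviation outer_pair :: "nat \<Rightarrow> real set" where
  "outer_pair N \<equiv> {lambda' q r 0 N, - lambda' q r 0 N}"

lemma roots_above_threshold:
  assumes "real N > threshold q r"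
  shows "eigvals N = inner_eigvals N \<union> outer_pair N"
    and "inner_eigvals N \<inter> outer_pair N = {}"
    and "card (inner_roots N) = N - 2" "card (roots N) = N"
proof -
  have N: "N \<ge> 2" using assms threshold_le_imp_ge_2[of N] by simp
  note R = roots_from_threshold[OF N \<theta>(2)[OF assms] cosh_real_ge_1]
  show "eigvals N = inner_eigvals N \<union> outer_pair N"
    unfolding R(1) by (simp add: lambda'_0[OF assms] image_Un)
  show "card (inner_roots N) = N - 2" "card (roots N) = N" by (rule R)+
  show "inner_eigvals N \<inter> outer_pair N = {}"
  proof -
    have "\<bar>rho q r * x\<bar> < lambda' q r 0 N" if "x \<in> inner_roots N" for x
    proof -
      have "rho q r * \<bar>x\<bar> \<le> rho q r * 1" using that rho_pos by (intro mult_left_mono) auto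
      then have "\<bar>rho q r * x\<bar> \<le> rho q r" using rho_pos by (simp add: abs_mult)
      then show ?thesis using lambda'_0_bounds(1)[OF assms] by linarith
    qed
    then show ?thesis by force
  qed
qed

lemma card_roots: "N \<ge> 1 \<Longrightarrow> card (roots N) = N"
  using roots_below_threshold(2) roots_at_threshold(3) roots_above_threshold(4)
  by (metis linorder_cases)

end

section \<open>Random walk on Diestel-Leader graphs and the radial recurrence\<close>

context ancestral
begin

lemma anc_trans: "anc x y \<Longrightarrow> anc y z \<Longrightarrow> anc x z"
  unfolding anc_def by (metis comp_apply funpow_add)

lemma not_anc_par: "\<not> anc a (par a)"
  using anc_lev[of a "par a"] by (auto simp: lev_par)

lemma par_not_child: "par (par x) \<noteq> x"
proof
  assume "par (par x) = x"
  then have "lev (par (par x)) = lev x" by simp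
  then show False by (simp add: lev_par)
qed

end

context degrees
begin

abbreviation cheb_count :: "real set \<Rightarrow> nat \<Rightarrow> nat" where
  "cheb_count A N \<equiv> card {x. poly (cheb N) x = 0 \<and> rho q r * x \<in> A}"

abbreviation bdry_count :: "real set \<Rightarrow> nat \<Rightarrow> nat" where
  "bdry_count A N \<equiv> card {x \<in> roots N. rho q r * x \<in> A}"

end

locale dl_trees = degrees +
  fixes T1 :: "'a ended_tree" and T2 :: "'b ended_tree"
  assumes T1: "homogeneous_tree q T1" and T2: "homogeneous_tree r T2"
begin

lemma r_ge_2: "2 \<le> r"
  using q_ge_2 q_less_r by simp

sublocale X: ancestral "pred T1" "busemann T1" q
  by (rule homogeneous_tree_ancestral(1)[OF T1 q_ge_2])

sublocale Y: ancestral "pred T2" "busemann T2" r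
  by (rule homogeneous_tree_ancestral(1)[OF T2 r_ge_2])

abbreviation h1 :: "'a \<Rightarrow> int" where "h1 \<equiv> busemann T1"
abbreviation h2 :: "'b \<Rightarrow> int" where "h2 \<equiv> busemann T2"
abbreviation par1 :: "'a \<Rightarrow> 'a" where "par1 \<equiv> pred T1"
abbreviation par2 :: "'b \<Rightarrow> 'b" where "par2 \<equiv> pred T2"
abbreviation E :: "'a \<times> 'b \<Rightarrow> 'a \<times> 'b \<Rightarrow> bool" where "E \<equiv> dl_adj T1 T2"
abbreviation V :: "('a \<times> 'b) set" where "V \<equiv> dl_verts T1 T2"

lemma mem_V: "(x, y) \<in> V \<longleftrightarrow> h1 x + h2 y = 0"
  by (simp add: dl_verts_def)

lemma nbrs_V:
  assumes "(x, y) \<in> V"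
  shows "nbrs E V (x, y) = {x'. par1 x' = x} \<times> {par2 y} \<union> {par1 x} \<times> {y'. par2 y' = y}"
proof -
  have adj: "adj T1 u v \<longleftrightarrow> v = par1 u \<or> u = par1 v" "adj T2 s t \<longleftrightarrow> t = par2 s \<or> s = par2 t" for u v s t
    using homogeneous_tree_ancestral(2)[OF T1 q_ge_2] homogeneous_tree_ancestral(2)[OF T2 r_ge_2] by auto
  show ?thesis
    using assms X.lev_par Y.lev_par by (fastforce simp: nbrs_def dl_adj_def adj mem_V)
qed

text \<open>The walk operator splits into the contributions of the two directions; near the boundary of a
  tetrahedron one of them is missing.\<close>

lemma srw_op_two_directions:
  assumes x: "x \<in> S" and N: "nbrs E S x = (if b1 then A \<times> {v} else {}) \<union> (if b2 then {u} \<times> B else {})"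
    and fin: "finite A" "finite B" and "u \<notin> A"
  shows "srw_op E S f x =
    ((if b1 then \<Sum>a\<in>A. f (a, v) else 0) + (if b2 then \<Sum>b\<in>B. f (u, b) else 0)) /
    real ((if b1 then card A else 0) + (if b2 then card B else 0))"
proof -
  have disj: "(if b1 then A \<times> {v} else {}) \<inter> (if b2 then {u} \<times> B else {}) = {}"
    using \<open>u \<notin> A\<close> by auto
  have fin': "finite (if b1 then A \<times> {v} else {})" "finite (if b2 then {u} \<times> B else {})"
    using fin by auto
  have c: "card (nbrs E S x) = (if b1 then card A else 0) + (if b2 then card B else 0)"
    unfolding N using card_Un_disjoint[OF fin' disj] by (auto simp: card_cartesian_product)
  have s: "(\<Sum>y\<in>nbrs E S x. f y) =
      (if b1 then \<Sum>a\<in>A. f (a, v) else 0) + (if b2 then \<Sum>b\<in>B. f (u, b) else 0)"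
    unfolding N using sum.union_disjoint[OF fin' disj, of f]
    by (auto simp: sum.cartesian_product')
  show ?thesis
    using x by (simp add: srw_op_def c s flip: sum_divide_distrib)
qed

lemma srw_op_V:
  assumes "(x, y) \<in> V"
  shows "srw_op E V f (x, y) =
    ((\<Sum>x' | par1 x' = x. f (x', par2 y)) + (\<Sum>y' | par2 y' = y. f (par1 x, y'))) / (real q + real r)"
proof -
  have N: "nbrs E V (x, y) = (if True then {x'. par1 x' = x} \<times> {par2 y} else {}) \<union>
      (if True then {par1 x} \<times> {y'. par2 y' = y} else {})"
    using nbrs_V[OF assms] by simp
  have "par1 x \<notin> {x'. par1 x' = x}" by (simp add: X.par_not_child)
  from srw_op_two_directions[OF assms N X.finite_children Y.finite_children this, of f]
  show ?thesis by (simp only: if_True X.card_children Y.card_children of_nat_add)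
qed

definition t :: real where "t = sqrt (real r / real q)"

lemma t_pos: "t > 0" and t_square: "real q * t\<^sup>2 = real r" and rho_t: "rho q r * (real q + real r) = 2 * real q * t"
proof -
  have q: "real q > 0" using q_ge_2 by simp
  show "t > 0" "real q * t\<^sup>2 = real r"
    using q q_less_r by (auto simp: t_def)
  have "(real q * t)\<^sup>2 = real q * real r"
    using \<open>real q * t\<^sup>2 = real r\<close> by (simp add: power2_eq_square mult_ac)
  then have "sqrt (real q * real r) = real q * t"
    using \<open>t > 0\<close> q by (intro real_sqrt_unique) auto
  then show "rho q r * (real q + real r) = 2 * real q * t"
    using q by (simp add: rho_def)
qed

text \<open>After conjugation by \<open>t\<^sup>k\<close> the radial recurrence becomes that of the Chebyshev polynomials.\<close>

lemma radial_interior: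
  assumes "k > 0" "m > 0"
  shows "real q * (t ^ Suc k * poly (cheb (m - 1)) x) + real r * (t ^ (k - 1) * poly (cheb (m + 1)) x)
    = rho q r * (real q + real r) * x * (t ^ k * poly (cheb m) x)"
proof -
  obtain k' m' where k': "k = Suc k'" "m = Suc m'" using assms by (metis gr0_implies_Suc)
  have r: "real r * t ^ k' = real q * t ^ Suc (Suc k')"
    by (simp flip: t_square) (simp add: power2_eq_square)
  have "real q * (t ^ Suc k * poly (cheb (m - 1)) x) + real r * (t ^ (k - 1) * poly (cheb (m + 1)) x)
      = real q * t ^ Suc (Suc k') * poly (cheb m') x + (real r * t ^ k') * poly (cheb (Suc (Suc m'))) x"
    by (simp only: k') simp
  also have "\<dots> = real q * t ^ Suc (Suc k') * (poly (cheb m') x + poly (cheb (Suc (Suc m'))) x)"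
    unfolding r by (simp only: distrib_left)
  also have "poly (cheb m') x + poly (cheb (Suc (Suc m'))) x = 2 * x * poly (cheb (Suc m')) x"
    by simp
  finally show ?thesis
    unfolding rho_t k' by (simp only: power_Suc mult_ac)
qed

lemma radial_boundary:
  assumes "m > 0" "poly (bdry_poly m) x = 0"
  shows "t * poly (cheb (m - 1)) x = rho q r * x * poly (cheb m) x"
proof -
  obtain m' where m': "m = Suc m'" using assms by (metis gr0_implies_Suc)
  have "real q * poly (cheb (m + 1)) x = real r * poly (cheb (m - 1)) x"
    using assms(2) by (simp add: bdry_poly_def del: cheb.simps)
  then have "real q * (2 * x * poly (cheb m) x) = (real q + real r) * poly (cheb (m - 1)) x"
    unfolding m' by (simp add: algebra_simps)
  then have "t * ((real q + real r) * poly (cheb (m - 1)) x) = t * (real q * (2 * x * poly (cheb m) x))"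
    by (simp only:)
  also have "\<dots> = (rho q r * (real q + real r)) * x * poly (cheb m) x"
    unfolding rho_t by (simp only: mult_ac)
  finally have "(real q + real r) * (t * poly (cheb (m - 1)) x) = (real q + real r) * (rho q r * x * poly (cheb m) x)"
    by (simp only: mult_ac)
  then show ?thesis using q_ge_2 by simp
qed

end

section \<open>Eigenfunctions on a tetrahedron\<close>

locale dl_tetrahedron = dl_trees q r T1 T2
  for q r and T1 :: "'a ended_tree" and T2 :: "'b ended_tree" +
  fixes a1 :: 'a and a2 :: 'b and n :: nat
  assumes height: "has_height T1 T2 a1 a2 n"
begin

abbreviation S :: "('a \<times> 'b) set" where "S \<equiv> tetrahedron T1 T2 a1 a2"

lemma height_eq: "h1 a1 + h2 a2 = - int n"
  using height by (simp add: has_height_def)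

lemma mem_S: "(x, y) \<in> S \<longleftrightarrow> h1 x + h2 y = 0 \<and> X.anc a1 x \<and> Y.anc a2 y"
  using homogeneous_tree_ancestral(3)[OF T1 q_ge_2] homogeneous_tree_ancestral(3)[OF T2 r_ge_2]
  by (auto simp: tetrahedron_def mem_V X.anc_def Y.anc_def)

definition level :: "'a \<Rightarrow> nat" where "level x = nat (h1 x - h1 a1)"

lemma level:
  assumes "(x, y) \<in> S"
  shows "h1 x = h1 a1 + int (level x)" "level x \<le> n" "h2 y = h2 a2 + int (n - level x)"
  using assms X.anc_lev[of a1 x] Y.anc_lev[of a2 y] height_eq by (auto simp: mem_S level_def)

lemma S_eq: "S = (\<Union>k\<le>n. X.desc k a1 \<times> Y.desc (n - k) a2)"
proof
  show "S \<subseteq> (\<Union>k\<le>n. X.desc k a1 \<times> Y.desc (n - k) a2)"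
  proof
    fix p assume p: "p \<in> S"
    obtain x y where xy: "p = (x, y)" by (cases p)
    with p have xyS: "(x, y) \<in> S" by simp
    have "x \<in> X.desc (level x) a1" "y \<in> Y.desc (n - level x) a2" "level x \<in> {..n}"
      unfolding X.desc_iff_anc Y.desc_iff_anc using level[OF xyS] xyS by (auto simp: mem_S)
    then show "p \<in> (\<Union>k\<le>n. X.desc k a1 \<times> Y.desc (n - k) a2)"
      unfolding xy by (intro UN_I SigmaI)
  qed
  show "(\<Union>k\<le>n. X.desc k a1 \<times> Y.desc (n - k) a2) \<subseteq> S"
    using height_eq by (auto simp: mem_S X.desc_iff_anc Y.desc_iff_anc)
qed

lemma finite_S: "finite S"
  unfolding S_eq by (auto simp: X.finite_desc Y.finite_desc)

lemma card_S: "card S = (\<Sum>k\<le>n. q ^ k * r ^ (n - k))"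
proof -
  have "card S = (\<Sum>k\<le>n. card (X.desc k a1 \<times> Y.desc (n - k) a2))"
    unfolding S_eq
  proof (rule card_UN_disjoint)
    show "\<forall>i\<in>{..n}. \<forall>j\<in>{..n}. i \<noteq> j \<longrightarrow>
        X.desc i a1 \<times> Y.desc (n - i) a2 \<inter> X.desc j a1 \<times> Y.desc (n - j) a2 = {}"
      by (auto simp: X.desc_iff_anc)
  qed (auto simp: X.finite_desc Y.finite_desc)
  then show ?thesis by (simp add: card_cartesian_product X.card_desc Y.card_desc)
qed

lemma nbrs_S:
  assumes "(x, y) \<in> S"
  shows "nbrs E S (x, y) = (if level x < n then {x'. par1 x' = x} \<times> {par2 y} else {}) \<union>
    (if 0 < level x then {par1 x} \<times> {y'. par2 y' = y} else {})"
proof -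
  have xyV: "(x, y) \<in> V" using assms by (simp add: mem_S mem_V)
  have up: "(x', par2 y) \<in> S \<longleftrightarrow> level x < n" if "par1 x' = x" for x'
  proof -
    have "Y.anc a2 (par2 y) \<longleftrightarrow> y \<noteq> a2"
      using assms Y.anc_par_iff[of a2 y] Y.not_anc_par[of a2] by (auto simp: mem_S)
    also have "\<dots> \<longleftrightarrow> level x < n"
    proof -
      have "y = a2 \<longleftrightarrow> level x = n"
        using level[OF assms] assms Y.anc_same_lev[of a2 y] by (auto simp: mem_S)
      then show ?thesis using level(2)[OF assms] by linarith
    qed
    finally show ?thesis
      using that assms X.lev_par[of x'] Y.lev_par[of y] X.anc_par_iff[of a1 x'] by (auto simp: mem_S)
  qed
  have down: "(par1 x, y') \<in> S \<longleftrightarrow> 0 < level x" if "par2 y' = y" for y'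
  proof -
    have "X.anc a1 (par1 x) \<longleftrightarrow> x \<noteq> a1"
      using assms X.anc_par_iff[of a1 x] X.not_anc_par[of a1] by (auto simp: mem_S)
    also have "\<dots> \<longleftrightarrow> 0 < level x"
      using level[OF assms] assms X.anc_same_lev[of a1 x] by (auto simp: mem_S)
    finally show ?thesis
      using that assms Y.lev_par[of y'] X.lev_par[of x] Y.anc_par_iff[of a2 y'] by (auto simp: mem_S)
  qed
  have "nbrs E S (x, y) = nbrs E V (x, y) \<inter> S"
    by (auto simp: nbrs_def tetrahedron_def)
  then show ?thesis
    unfolding nbrs_V[OF xyV] using up down by auto
qed

lemma srw_op_S:
  assumes "(x, y) \<in> S"
  shows "srw_op E S f (x, y) =
    ((if level x < n then \<Sum>x' | par1 x' = x. f (x', par2 y) else 0) +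
     (if 0 < level x then \<Sum>y' | par2 y' = y. f (par1 x, y') else 0)) /
    ((if level x < n then real q else 0) + (if 0 < level x then real r else 0))"
proof -
  have "par1 x \<notin> {x'. par1 x' = x}" by (simp add: X.par_not_child)
  from srw_op_two_directions[OF assms nbrs_S[OF assms] X.finite_children Y.finite_children this, of f]
  show ?thesis by (simp add: X.card_children Y.card_children)
qed

definition d2 :: "'b \<Rightarrow> nat" where "d2 c = nat (h2 c - h2 a2)"

definition ix :: "('a \<times> 'b) set" where
  "ix = {(c1, c2). c1 \<in> X.haar_index a1 \<and> c2 \<in> Y.haar_index a2 \<and> c2 \<noteq> a2 \<and> level c1 + d2 c2 \<le> n}"

text \<open>The parents of \<open>c1\<close> and \<open>c2\<close> are the apices of a sub-tetrahedron, of height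
  \<open>n + 2 - level c1 - d2 c2\<close>; if \<open>c1 = a1\<close>, the first factor is constant and the sub-tetrahedron has the
  apices \<open>a1\<close> and the parent of \<open>c2\<close>. The radial factor vanishes at the level of the parent of \<open>c2\<close>, where
  the index of \<open>cheb\<close> is zero.\<close>

definition eigenfun :: "real \<Rightarrow> 'a \<times> 'b \<Rightarrow> 'a \<times> 'b \<Rightarrow> real" where
  "eigenfun x = (\<lambda>(c1, c2) (u, v). if (u, v) \<in> S then
     X.haar a1 c1 u * Y.haar a2 c2 v * (t ^ level u * poly (cheb (n + 1 - d2 c2 - level u)) x) else 0)"

definition is_eigen :: "real \<Rightarrow> 'a \<times> 'b \<Rightarrow> bool" where
  "is_eigen x = (\<lambda>(c1, c2). if c1 = a1 then poly (bdry_poly (n + 1 - d2 c2)) x = 0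
     else poly (cheb (n + 2 - level c1 - d2 c2)) x = 0)"

lemma haar_index_levels:
  assumes "(c1, c2) \<in> ix"
  shows "h1 c1 = h1 a1 + int (level c1)" "h2 c2 = h2 a2 + int (d2 c2)" "d2 c2 > 0"
    "c1 = a1 \<longleftrightarrow> level c1 = 0" "level c1 + d2 c2 \<le> n"
proof -
  have anc: "X.anc a1 c1" "Y.anc a2 c2" "c2 \<noteq> a2"
    using assms by (auto simp: ix_def X.haar_index_def Y.haar_index_def)
  show "h1 c1 = h1 a1 + int (level c1)" "h2 c2 = h2 a2 + int (d2 c2)"
    using X.anc_lev[OF anc(1)] Y.anc_lev[OF anc(2)] by (auto simp: level_def d2_def)
  then show "d2 c2 > 0" "c1 = a1 \<longleftrightarrow> level c1 = 0"
    using X.anc_same_lev[OF anc(1)] Y.anc_same_lev[OF anc(2)] anc(3) by (auto simp: level_def)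
  show "level c1 + d2 c2 \<le> n" using assms by (simp add: ix_def)
qed

lemma level_child: "par1 x' = x \<Longrightarrow> X.anc a1 x \<Longrightarrow> level x' = Suc (level x)"
  using X.lev_par[of x'] X.anc_lev[of a1 x] by (auto simp: level_def)

lemma level_par: "0 < level x \<Longrightarrow> level (par1 x) = level x - 1"
  using X.lev_par[of x] by (auto simp: level_def)

text \<open>In each direction, the Haar function that is evaluated at a parent may be evaluated at the vertex
  itself instead, because the two values differ only where the radial factor vanishes. This is automatic
  at the level next to the parent of \<open>c2\<close>; next to the parent of \<open>c1\<close> it is the condition on \<open>x\<close> if
  \<open>c1 \<noteq> a1\<close>. What remains is the radial recurrence, or the boundary condition at level zero if \<open>c1 = a1\<close>.\<close>

lemma eigenfun_eigenspace:
  assumes c: "c \<in> ix" "is_eigen x c"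
  shows "eigenfun x c \<in> eigenspace E S (rho q r * x)"
proof -
  obtain c1 c2 where cc: "c = (c1, c2)" by (cases c)
  note L = haar_index_levels[OF c(1)[unfolded cc]]
  define i j where "i = level c1" and "j = d2 c2"
  define \<phi> where "\<phi> k = t ^ k * poly (cheb (n + 1 - j - k)) x" for k
  have F: "eigenfun x c (u, v) = X.haar a1 c1 u * Y.haar a2 c2 v * \<phi> (level u)" if "(u, v) \<in> S" for u v
    using that by (simp add: eigenfun_def cc \<phi>_def j_def)
  have "srw_op E S (eigenfun x c) (u, v) = rho q r * x * eigenfun x c (u, v)" if uv: "(u, v) \<in> S" for u v
  proof -
    let ?A = "X.haar a1 c1 u" and ?B = "Y.haar a2 c2 v" and ?k = "level u"
    note lev = level[OF uv]
    have anc: "X.anc a1 u" "Y.anc a2 v" using uv by (auto simp: mem_S)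
    have up: "(\<Sum>u' | par1 u' = u. eigenfun x c (u', par2 v)) = real q * (?A * ?B * \<phi> (Suc ?k))" if "?k < n"
    proof -
      have "(u', par2 v) \<in> S" if "par1 u' = u" for u'
        using nbrs_S[OF uv] \<open>?k < n\<close> that by (auto simp: nbrs_def)
      then have "(\<Sum>u' | par1 u' = u. eigenfun x c (u', par2 v)) =
          (\<Sum>u' | par1 u' = u. X.haar a1 c1 u' * (Y.haar a2 c2 (par2 v) * \<phi> (Suc ?k)))"
        by (intro sum.cong) (auto simp: F level_child anc)
      also have "\<dots> = real q * ?A * (Y.haar a2 c2 (par2 v) * \<phi> (Suc ?k))"
        by (simp add: X.sum_children_haar[OF anc(1)] flip: sum_distrib_right)
      also have "Y.haar a2 c2 (par2 v) * \<phi> (Suc ?k) = ?B * \<phi> (Suc ?k)"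
      proof (cases "h2 v = h2 c2")
        case True
        then have "n + 1 - j - Suc ?k = 0" using lev L j_def by linarith
        then show ?thesis by (simp add: \<phi>_def)
      qed (simp add: Y.haar_par)
      finally show ?thesis by simp
    qed
    have down: "(\<Sum>v' | par2 v' = v. eigenfun x c (par1 u, v')) = real r * (?A * ?B * \<phi> (?k - 1))" if "0 < ?k"
    proof -
      have "(par1 u, v') \<in> S" if "par2 v' = v" for v'
        using nbrs_S[OF uv] \<open>0 < ?k\<close> that by (auto simp: nbrs_def)
      then have "(\<Sum>v' | par2 v' = v. eigenfun x c (par1 u, v')) =
          (\<Sum>v' | par2 v' = v. Y.haar a2 c2 v' * (X.haar a1 c1 (par1 u) * \<phi> (?k - 1)))"
        using that by (intro sum.cong) (auto simp: F level_par)
      also have "\<dots> = real r * ?B * (X.haar a1 c1 (par1 u) * \<phi> (?k - 1))"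
        by (simp add: Y.sum_children_haar[OF anc(2)] flip: sum_distrib_right)
      also have "X.haar a1 c1 (par1 u) * \<phi> (?k - 1) = ?A * \<phi> (?k - 1)"
      proof (cases "h1 u = h1 c1")
        case True
        then have k: "?k = i" using lev L i_def by simp
        then have "c1 \<noteq> a1" using that L i_def by simp
        then have "poly (cheb (n + 2 - i - j)) x = 0"
          using c(2) by (simp add: is_eigen_def cc i_def j_def)
        moreover have "n + 1 - j - (?k - 1) = n + 2 - i - j"
          using k that L i_def j_def by linarith
        ultimately have "\<phi> (?k - 1) = 0" by (simp add: \<phi>_def)
        then show ?thesis by simp
      qed (simp add: X.haar_par)
      finally show ?thesis by simp
    qed
    show ?thesis
    proof (cases "?A * ?B = 0")
      case True
      then have "(if ?k < n then \<Sum>u' | par1 u' = u. eigenfun x c (u', par2 v) else 0) = 0"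
        "(if 0 < ?k then \<Sum>v' | par2 v' = v. eigenfun x c (par1 u, v') else 0) = 0"
        using up down by auto
      then show ?thesis using True by (simp add: srw_op_S[OF uv] F[OF uv])
    next
      case False
      then have "\<not> h1 u < h1 c1" "\<not> h2 v < h2 c2"
        using X.haar_eq_0 Y.haar_eq_0 by auto
      then have k: "i \<le> ?k" "?k + j \<le> n" "j > 0"
        using lev L i_def j_def by auto
      then have kn: "?k < n" by linarith
      show ?thesis
      proof (cases "?k = 0")
        case True
        then have "c1 = a1" using k L i_def by simp
        then have "poly (bdry_poly (n + 1 - j)) x = 0"
          using c(2) by (simp add: is_eigen_def cc j_def)
        from radial_boundary[OF _ this] have "\<phi> (Suc 0) = rho q r * x * \<phi> 0"
          using k by (simp add: \<phi>_def)
        then show ?thesis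
          using True kn up q_ge_2 by (simp add: srw_op_S[OF uv] F[OF uv])
      next
        case False
        have "real q * \<phi> (Suc ?k) + real r * \<phi> (?k - 1) = rho q r * (real q + real r) * x * \<phi> ?k"
        proof -
          have "n + 1 - j - Suc ?k = (n + 1 - j - ?k) - 1" "n + 1 - j - (?k - 1) = (n + 1 - j - ?k) + 1"
            using k False by linarith+
          then show ?thesis
            using radial_interior[of ?k "n + 1 - j - ?k" x] k False by (simp only: \<phi>_def) simp
        qed
        from arg_cong[OF this, of "(*) (?A * ?B)"]
        have "real q * (?A * ?B * \<phi> (Suc ?k)) + real r * (?A * ?B * \<phi> (?k - 1)) =
            rho q r * x * (?A * ?B * \<phi> ?k) * (real q + real r)"
          by (simp only: distrib_left distrib_right mult_ac)
        then show ?thesis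
          using False kn up down q_ge_2 by (simp add: srw_op_S[OF uv] F[OF uv] divide_eq_eq)
      qed
    qed
  qed
  then show ?thesis
    by (auto simp: eigenspace_def eigenfun_def split: prod.splits)
qed

lemma finite_ix: "finite ix"
proof -
  have "ix \<subseteq> (\<Union>i\<le>n. {c \<in> X.haar_index a1. h1 c = h1 a1 + int i}) \<times>
      (\<Union>j\<le>n. {c \<in> Y.haar_index a2. h2 c = h2 a2 + int j})"
  proof
    fix c assume c: "c \<in> ix"
    obtain c1 c2 where cc: "c = (c1, c2)" by (cases c)
    note L = haar_index_levels[OF c[unfolded cc]]
    have "c1 \<in> X.haar_index a1" "c2 \<in> Y.haar_index a2" using c cc by (auto simp: ix_def)
    moreover have "level c1 \<in> {..n}" "d2 c2 \<in> {..n}" using L by auto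
    ultimately show "c \<in> (\<Union>i\<le>n. {c \<in> X.haar_index a1. h1 c = h1 a1 + int i}) \<times>
        (\<Union>j\<le>n. {c \<in> Y.haar_index a2. h2 c = h2 a2 + int j})"
      unfolding cc using L(1,2) by blast
  qed
  then show ?thesis
    by (rule finite_subset) (auto intro!: X.card_haar_index(1) Y.card_haar_index(1))
qed

text \<open>Independence: in a vanishing combination, take an index \<open>(c1, c2)\<close> with nonzero coefficient, with
  \<open>c2\<close> as close to \<open>a2\<close> as possible and then \<open>c1\<close> as close to \<open>a1\<close> as possible. Summation over the
  vertices \<open>(u, c2)\<close> with \<open>u\<close> below \<open>c1\<close> replaces each first Haar function by a multiple of its value
  at \<open>c1\<close>, and by triangularity kills every other term. The radial factor at this level is
  \<open>t\<^sup>k\<close>, whatever the eigenvalue.\<close>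

lemma eigenfun_independent:
  assumes J: "J \<subseteq> ix" and zero: "\<And>p. p \<in> S \<Longrightarrow> (\<Sum>c\<in>J. a c * eigenfun x c p) = 0"
  shows "\<forall>c\<in>J. a c = 0"
proof (rule ccontr)
  assume "\<not> (\<forall>c\<in>J. a c = 0)"
  then obtain c0 where c0: "c0 \<in> J \<and> a c0 \<noteq> 0" by blast
  \<comment> \<open>As levels are at most \<open>n\<close>, this weight orders lexicographically, first by \<open>c2\<close>.\<close>
  define w where "w = (\<lambda>(c1 :: 'a, c2 :: 'b). d2 c2 * (n + 1) + level c1)"
  from ex_has_least_nat[where P = "\<lambda>c. c \<in> J \<and> a c \<noteq> 0", OF c0, of w]
  obtain c where c: "c \<in> J" "a c \<noteq> 0" and min: "\<And>c'. c' \<in> J \<Longrightarrow> a c' \<noteq> 0 \<Longrightarrow> w c \<le> w c'"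
    by blast
  obtain c1 c2 where cc: "c = (c1, c2)" by (cases c)
  have cix: "(c1, c2) \<in> ix" using c J cc by auto
  note L = haar_index_levels[OF cix]
  have ci: "c1 \<in> X.haar_index a1" "c2 \<in> Y.haar_index a2" using cix by (auto simp: ix_def)
  have anc: "X.anc a1 c1" "Y.anc a2 c2" using ci by (auto simp: X.haar_index_def Y.haar_index_def)
  define m where "m = n - d2 c2 - level c1"
  define D where "D = X.desc m c1"
  have D: "(u, c2) \<in> S \<and> level u = n - d2 c2" if "u \<in> D" for u
  proof -
    have u: "X.anc c1 u" "h1 u = h1 c1 + int m" using that by (auto simp: D_def X.desc_iff_anc)
    have "h1 u = h1 a1 + int (n - d2 c2)" using u(2) L by (simp add: m_def)
    moreover have "h1 u + h2 c2 = 0" using u(2) L height_eq by (simp add: m_def)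
    ultimately show ?thesis
      using X.anc_trans[OF anc(1) u(1)] anc(2) by (simp add: mem_S level_def)
  qed
  define \<psi> where "\<psi> c' = t ^ (n - d2 c2) * poly (cheb (n + 1 - d2 (snd c') - (n - d2 c2))) x" for c' :: "'a \<times> 'b"
  have "(\<Sum>c'\<in>J. a c' * (Y.haar a2 (snd c') c2 * \<psi> c' * (real q ^ m * X.haar a1 (fst c') c1))) =
      (\<Sum>c'\<in>J. \<Sum>u\<in>D. a c' * eigenfun x c' (u, c2))"
  proof (rule sum.cong[OF refl])
    fix c' assume "c' \<in> J"
    have "(\<Sum>u\<in>D. a c' * eigenfun x c' (u, c2)) =
        (\<Sum>u\<in>D. a c' * (Y.haar a2 (snd c') c2 * \<psi> c') * X.haar a1 (fst c') u)"
      using D by (intro sum.cong) (auto simp: eigenfun_def \<psi>_def split: prod.splits)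
    also have "\<dots> = a c' * (Y.haar a2 (snd c') c2 * \<psi> c') * (\<Sum>u\<in>D. X.haar a1 (fst c') u)"
      by (simp only: sum_distrib_left)
    also have "(\<Sum>u\<in>D. X.haar a1 (fst c') u) = real q ^ m * X.haar a1 (fst c') c1"
      unfolding D_def by (rule X.sum_desc_haar[OF anc(1)])
    finally show "a c' * (Y.haar a2 (snd c') c2 * \<psi> c' * (real q ^ m * X.haar a1 (fst c') c1)) =
        (\<Sum>u\<in>D. a c' * eigenfun x c' (u, c2))" by (simp add: mult_ac)
  qed
  also have "\<dots> = (\<Sum>u\<in>D. \<Sum>c'\<in>J. a c' * eigenfun x c' (u, c2))"
    by (rule sum.swap)
  also have "\<dots> = 0"
    using D zero by (intro sum.neutral) auto
  finally have sum0: "(\<Sum>c'\<in>J. a c' * (Y.haar a2 (snd c') c2 * \<psi> c' * (real q ^ m * X.haar a1 (fst c') c1))) = 0" .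
  have others: "a c' * (Y.haar a2 (snd c') c2 * \<psi> c' * (real q ^ m * X.haar a1 (fst c') c1)) = 0"
    if c': "c' \<in> J" "c' \<noteq> c" for c'
  proof (rule ccontr)
    assume nz: "a c' * (Y.haar a2 (snd c') c2 * \<psi> c' * (real q ^ m * X.haar a1 (fst c') c1)) \<noteq> 0"
    obtain c1' c2' where cc': "c' = (c1', c2')" by (cases c')
    have cix': "(c1', c2') \<in> ix" using c' J cc' by auto
    note L' = haar_index_levels[OF cix']
    have ci': "c1' \<in> X.haar_index a1" "c2' \<in> Y.haar_index a2" using cix' by (auto simp: ix_def)
    have nz': "a c' \<noteq> 0" "Y.haar a2 c2' c2 \<noteq> 0" "X.haar a1 c1' c1 \<noteq> 0" using nz cc' by auto
    have w: "d2 c2 * (n + 1) + level c1 \<le> d2 c2' * (n + 1) + level c1'"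
      using min[OF c'(1) nz'(1)] by (simp add: w_def cc cc')
    have "d2 c2 \<le> d2 c2'"
    proof (rule ccontr)
      assume "\<not> d2 c2 \<le> d2 c2'"
      then have "(d2 c2' + 1) * (n + 1) \<le> d2 c2 * (n + 1)" by (intro mult_le_mono1) simp
      then show False using w L'(5) by simp
    qed
    then have "h2 c2 \<le> h2 c2'" using L L' by simp
    then have c2: "c2' = c2" using Y.haar_triangular[OF ci(2) ci'(2)] nz' by blast
    then have "level c1 \<le> level c1'" using w by simp
    then have "h1 c1 \<le> h1 c1'" using L L' by simp
    then have "c1' = c1" using X.haar_triangular[OF ci(1) ci'(1)] nz' by blast
    then show False using c2 c' cc cc' by simp
  qed
  have "a c * (Y.haar a2 c2 c2 * \<psi> c * (real q ^ m * X.haar a1 c1 c1)) = 0"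
    using sum0 others sum.remove[OF finite_subset[OF J finite_ix] c(1),
        of "\<lambda>c'. a c' * (Y.haar a2 (snd c') c2 * \<psi> c' * (real q ^ m * X.haar a1 (fst c') c1))"]
    by (simp add: cc)
  moreover have "\<psi> c = t ^ (n - d2 c2)"
  proof -
    have "n + 1 - d2 c2 - (n - d2 c2) = Suc 0" using L by linarith
    then show ?thesis by (simp add: \<psi>_def cc)
  qed
  ultimately show False
    using c(2) t_pos q_ge_2 X.haar_self[OF ci(1)] Y.haar_self[OF ci(2)] by simp
qed

lemma mult_ge: "card {c \<in> ix. is_eigen x c} \<le> mult E S (rho q r * x)"
proof (rule card_le_mult[OF finite_S])
  show "finite {c \<in> ix. is_eigen x c}" using finite_ix by simp
  show "eigenfun x c \<in> eigenspace E S (rho q r * x)" if "c \<in> {c \<in> ix. is_eigen x c}" for c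
    using that eigenfun_eigenspace by blast
  show "\<forall>c\<in>{c \<in> ix. is_eigen x c}. a c = 0"
    if "\<And>p. p \<in> S \<Longrightarrow> (\<Sum>c\<in>{c \<in> ix. is_eigen x c}. a c * eigenfun x c p) = 0" for a
    using eigenfun_independent[of "{c \<in> ix. is_eigen x c}" a x] that by auto
qed

section \<open>Counting eigenfunctions\<close>

text \<open>Here \<open>N\<close> is the height of the sub-tetrahedron, and the first factor is nonconstant in the first
  definition and constant in the second one.\<close>

definition ix_inner :: "nat \<Rightarrow> ('a \<times> 'b) set" where
  "ix_inner N = {(c1, c2) \<in> ix. c1 \<noteq> a1 \<and> level c1 + d2 c2 + N = n + 2}"

definition ix_outer :: "nat \<Rightarrow> ('a \<times> 'b) set" where
  "ix_outer N = {(c1, c2) \<in> ix. c1 = a1 \<and> d2 c2 + N = n + 1}"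

definition X_index :: "nat \<Rightarrow> 'a set" where
  "X_index i = {c \<in> X.haar_index a1. h1 c = h1 a1 + int i}"

definition Y_index :: "nat \<Rightarrow> 'b set" where
  "Y_index j = {c \<in> Y.haar_index a2. h2 c = h2 a2 + int j}"

lemma mem_X_index: "i > 0 \<Longrightarrow> c \<in> X_index i \<longleftrightarrow> c \<in> X.haar_index a1 \<and> c \<noteq> a1 \<and> level c = i"
  and mem_Y_index: "j > 0 \<Longrightarrow> c' \<in> Y_index j \<longleftrightarrow> c' \<in> Y.haar_index a2 \<and> c' \<noteq> a2 \<and> d2 c' = j"
  using X.anc_lev[of a1 c] Y.anc_lev[of a2 c']
  by (auto simp: X_index_def Y_index_def X.haar_index_def Y.haar_index_def level_def d2_def)

lemma card_X_index: "i > 0 \<Longrightarrow> card (X_index i) = (q - 1) * q ^ (i - 1)" "finite (X_index i)"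
  and card_Y_index: "i > 0 \<Longrightarrow> card (Y_index i) = (r - 1) * r ^ (i - 1)" "finite (Y_index i)"
  unfolding X_index_def Y_index_def using X.card_haar_index Y.card_haar_index by auto

lemma card_ix_outer:
  assumes "1 \<le> N" "N \<le> n"
  shows "card (ix_outer N) = (r - 1) * r ^ (n - N)"
proof -
  have "ix_outer N = {a1} \<times> Y_index (n + 1 - N)"
    using assms by (auto simp: ix_outer_def ix_def mem_Y_index X.haar_index_def level_def)
  then show ?thesis
    using assms card_Y_index(1)[of "n + 1 - N"] by (simp add: card_cartesian_product)
qed

lemma card_ix_inner:
  assumes "2 \<le> N" "N \<le> n"
  shows "card (ix_inner N) = (q - 1) * (r - 1) * (\<Sum>k\<le>n - N. q ^ k * r ^ (n - N - k))"
proof -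
  have "ix_inner N = (\<Union>k\<le>n - N. X_index (k + 1) \<times> Y_index (n - N - k + 1))" (is "_ = ?R")
  proof
    show "ix_inner N \<subseteq> ?R"
    proof
      fix c assume c: "c \<in> ix_inner N"
      obtain c1 c2 where cc: "c = (c1, c2)" by (cases c)
      have "(c1, c2) \<in> ix" using c cc by (auto simp: ix_inner_def)
      note L = haar_index_levels[OF this]
      have i: "c1 \<in> X.haar_index a1" "c2 \<in> Y.haar_index a2" "c1 \<noteq> a1" "c2 \<noteq> a2" "level c1 + d2 c2 + N = n + 2"
        using c cc by (auto simp: ix_inner_def ix_def)
      then have "level c1 > 0" using L by simp
      then have "c1 \<in> X_index (level c1 - 1 + 1)" "c2 \<in> Y_index (n - N - (level c1 - 1) + 1)" "level c1 - 1 \<in> {..n - N}"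
        using i L by (auto simp: mem_X_index mem_Y_index)
      then show "c \<in> ?R" unfolding cc by blast
    qed
    show "?R \<subseteq> ix_inner N"
    proof
      fix c assume c: "c \<in> ?R"
      obtain c1 c2 where cc: "c = (c1, c2)" by (cases c)
      from c obtain k where "k \<le> n - N" "c1 \<in> X_index (k + 1)" "c2 \<in> Y_index (n - N - k + 1)"
        unfolding cc by blast
      then show "c \<in> ix_inner N"
        using assms by (simp add: cc ix_inner_def ix_def mem_X_index mem_Y_index)
    qed
  qed
  also have "card \<dots> = (\<Sum>k\<le>n - N. card (X_index (k + 1) \<times> Y_index (n - N - k + 1)))"
  proof (rule card_UN_disjoint)
    show "\<forall>k\<in>{..n - N}. \<forall>l\<in>{..n - N}. k \<noteq> l \<longrightarrow>
        X_index (k + 1) \<times> Y_index (n - N - k + 1) \<inter> X_index (l + 1) \<times> Y_index (n - N - l + 1) = {}"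
      by (auto simp: X_index_def)
  qed (auto simp: card_X_index card_Y_index)
  also have "\<dots> = (q - 1) * (r - 1) * (\<Sum>k\<le>n - N. q ^ k * r ^ (n - N - k))"
    by (simp add: card_cartesian_product card_X_index card_Y_index sum_distrib_left mult_ac)
  finally show ?thesis .
qed

abbreviation inner_sum :: "real \<Rightarrow> nat" where
  "inner_sum x \<equiv> \<Sum>N\<in>{2..n}. of_bool (poly (cheb N) x = 0) * card (ix_inner N)"

abbreviation outer_sum :: "real \<Rightarrow> nat" where
  "outer_sum x \<equiv> \<Sum>N\<in>{1..n}. of_bool (poly (bdry_poly N) x = 0) * card (ix_outer N)"

lemma card_is_eigen_ge:
  "card {c \<in> ix. is_eigen x c} \<ge> inner_sum x + outer_sum x"
proof -
  define I where "I = {N \<in> {2..n}. poly (cheb N) x = 0}"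
  define K where "K = {N \<in> {1..n}. poly (bdry_poly N) x = 0}"
  have fin: "finite I" "finite K" by (auto simp: I_def K_def)
  have fin': "finite (ix_inner N)" "finite (ix_outer N)" for N
    by (rule finite_subset[OF _ finite_ix], auto simp: ix_inner_def ix_outer_def)+
  have "inner_sum x = (\<Sum>N\<in>I. card (ix_inner N))"
    unfolding I_def by (rule sum.mono_neutral_cong_right) auto
  also have "\<dots> = card (\<Union>N\<in>I. ix_inner N)"
    by (rule card_UN_disjoint[symmetric]) (use fin fin' in \<open>auto simp: ix_inner_def\<close>)
  finally have 1: "inner_sum x = card (\<Union>N\<in>I. ix_inner N)" .
  have "outer_sum x = (\<Sum>N\<in>K. card (ix_outer N))"
    unfolding K_def by (rule sum.mono_neutral_cong_right) auto
  also have "\<dots> = card (\<Union>N\<in>K. ix_outer N)"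
    by (rule card_UN_disjoint[symmetric]) (use fin fin' in \<open>auto simp: ix_outer_def\<close>)
  finally have 2: "outer_sum x = card (\<Union>N\<in>K. ix_outer N)" .
  have "card (\<Union>N\<in>I. ix_inner N) + card (\<Union>N\<in>K. ix_outer N) = card ((\<Union>N\<in>I. ix_inner N) \<union> (\<Union>N\<in>K. ix_outer N))"
    by (rule card_Un_disjoint[symmetric]) (use fin fin' in \<open>auto simp: ix_inner_def ix_outer_def\<close>)
  also have "\<dots> \<le> card {c \<in> ix. is_eigen x c}"
  proof (rule card_mono)
    have "n + 2 - i - j = N" if "i + j + N = n + 2" for i j N :: nat using that by linarith
    moreover have "n + 1 - j = N" if "j + N = n + 1" for j N :: nat using that by linarith
    ultimately show "(\<Union>N\<in>I. ix_inner N) \<union> (\<Union>N\<in>K. ix_outer N) \<subseteq> {c \<in> ix. is_eigen x c}"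
      by (auto simp: ix_inner_def ix_outer_def I_def K_def is_eigen_def)
  qed (simp add: finite_ix)
  finally show ?thesis unfolding 1 2 .
qed

text \<open>Every zero of \<open>cheb N\<close> contributes with all indices in \<open>ix_inner N\<close>, every zero of the boundary
  polynomial with all indices in \<open>ix_outer N\<close>, also when the same eigenvalue arises for several \<open>N\<close>.\<close>

lemma spectral_mass_ge:
  "(\<Sum>N\<in>{2..n}. cheb_count A N * card (ix_inner N)) +
   (\<Sum>N\<in>{1..n}. bdry_count A N * card (ix_outer N))
   \<le> (\<Sum>l\<in>spec E S \<inter> A. mult E S l)"
proof -
  have cheb_nz: "cheb N \<noteq> 0" if "N \<ge> 2" for N
    using cheb_at_1[of N] that by auto
  define R where "R = (\<Union>N\<in>{2..n}. {x. poly (cheb N) x = 0}) \<union> (\<Union>N\<in>{1..n}. roots N)"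
  define B where "B = {x \<in> R. rho q r * x \<in> A}"
  have "finite R"
    unfolding R_def using cheb_nz finite_roots by (auto intro: poly_roots_finite)
  then have fin: "finite B" by (simp add: B_def)
  have cnt: "card {x. P x \<and> rho q r * x \<in> A} = (\<Sum>x\<in>B. of_bool (P x))" if "\<And>x. P x \<Longrightarrow> x \<in> R" for P
  proof -
    have "(\<Sum>x\<in>B. of_bool (P x)) = card {x \<in> B. P x}"
      using fin by (simp add: of_bool_def sum.If_cases Int_def)
    also have "{x \<in> B. P x} = {x. P x \<and> rho q r * x \<in> A}" using that by (auto simp: B_def)
    finally show ?thesis by simp
  qed
  have "(\<Sum>N\<in>{2..n}. cheb_count A N * card (ix_inner N)) =
      (\<Sum>N\<in>{2..n}. \<Sum>x\<in>B. of_bool (poly (cheb N) x = 0) * card (ix_inner N))"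
    by (intro sum.cong refl, subst cnt) (auto simp: R_def sum_distrib_right)
  also have "\<dots> = (\<Sum>x\<in>B. inner_sum x)"
    by (rule sum.swap)
  finally have 1: "(\<Sum>N\<in>{2..n}. cheb_count A N * card (ix_inner N)) = \<dots>" .
  have "(\<Sum>N\<in>{1..n}. bdry_count A N * card (ix_outer N)) =
      (\<Sum>N\<in>{1..n}. \<Sum>x\<in>B. of_bool (poly (bdry_poly N) x = 0) * card (ix_outer N))"
    unfolding mem_Collect_eq
    by (intro sum.cong refl, subst cnt) (auto simp: R_def sum_distrib_right)
  also have "\<dots> = (\<Sum>x\<in>B. outer_sum x)"
    by (rule sum.swap)
  finally have 2: "(\<Sum>N\<in>{1..n}. bdry_count A N * card (ix_outer N)) = \<dots>" .
  have "(\<Sum>x\<in>B. card {c \<in> ix. is_eigen x c}) \<le> (\<Sum>x\<in>B. mult E S (rho q r * x))"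
    by (intro sum_mono mult_ge)
  also have "\<dots> = (\<Sum>l\<in>(*) (rho q r) ` B. mult E S l)"
    using rho_pos by (subst sum.reindex) (auto intro: inj_onI)
  also have "\<dots> = (\<Sum>l\<in>(*) (rho q r) ` B \<inter> spec E S. mult E S l)"
    using fin mult_eq_0_off_spec[OF finite_S] by (intro sum.mono_neutral_right) auto
  also have "\<dots> \<le> (\<Sum>l\<in>spec E S \<inter> A. mult E S l)"
    using finite_spec[OF finite_S] by (intro sum_mono2) (auto simp: B_def)
  finally have "(\<Sum>x\<in>B. card {c \<in> ix. is_eigen x c}) \<le> (\<Sum>l\<in>spec E S \<inter> A. mult E S l)" .
  moreover have "(\<Sum>x\<in>B. inner_sum x +
      outer_sum x) \<le> (\<Sum>x\<in>B. card {c \<in> ix. is_eigen x c})"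
    by (intro sum_mono card_is_eigen_ge)
  ultimately show ?thesis
    unfolding 1 2 by (simp add: sum.distrib)
qed

end

section \<open>The spectral radius\<close>

lemma srw_op_mono:
  assumes "\<And>y. y \<in> S \<Longrightarrow> f y \<le> g y"
  shows "srw_op E S f x \<le> srw_op E S g x"
  using assms by (auto simp: srw_op_def nbrs_def intro!: sum_mono divide_right_mono)

lemma srw_op_pow_mono:
  assumes "\<And>y. y \<in> S \<Longrightarrow> f y \<le> g y" "x \<in> S"
  shows "(srw_op E S ^^ n) f x \<le> (srw_op E S ^^ n) g x"
  using assms(2) by (induction n arbitrary: x) (auto simp: assms(1) intro: srw_op_mono)

lemma srw_op_cong:
  assumes "\<And>y. y \<in> S \<Longrightarrow> f y = g y"
  shows "srw_op E S f x = srw_op E S g x"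
  using assms by (auto simp: srw_op_def nbrs_def intro!: sum.cong)

lemma srw_op_pow_cong:
  assumes "\<And>y. y \<in> S \<Longrightarrow> f y = g y" "x \<in> S"
  shows "(srw_op E S ^^ n) f x = (srw_op E S ^^ n) g x"
  using assms(2) by (induction n arbitrary: x) (auto simp: assms(1) intro: srw_op_cong)

lemma srw_op_sum: "srw_op E S (\<lambda>y. \<Sum>i\<in>I. c i * f i y) = (\<lambda>x. \<Sum>i\<in>I. c i * srw_op E S (f i) x)"
proof (induction I rule: infinite_finite_induct)
  case (insert i I)
  have "(\<lambda>y. \<Sum>i\<in>insert i I. c i * f i y) = (\<lambda>y. c i * f i y) + (\<lambda>y. \<Sum>i\<in>I. c i * f i y)"
    using insert by auto
  then show ?case
    using insert by (simp only: srw_op_add srw_op_scale) (auto simp: fun_eq_iff)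
qed (auto simp: srw_op_def fun_eq_iff)

lemma srw_op_pow_sum:
  "(srw_op E S ^^ n) (\<lambda>y. \<Sum>i\<in>I. c i * f i y) x = (\<Sum>i\<in>I. c i * (srw_op E S ^^ n) (f i) x)"
proof (induction n arbitrary: x)
  case (Suc n)
  have "(srw_op E S ^^ n) (\<lambda>y. \<Sum>i\<in>I. c i * f i y) = (\<lambda>x. \<Sum>i\<in>I. c i * (srw_op E S ^^ n) (f i) x)"
    using Suc by blast
  then show ?case by (simp add: srw_op_sum)
qed simp

lemma srw_op_pow_scale: "(srw_op E S ^^ n) (\<lambda>y. c * f y) x = c * (srw_op E S ^^ n) f x"
  using srw_op_pow_sum[where I = "{()}" and c = "\<lambda>_. c" and f = "\<lambda>_. f"] by simp

lemma sum_mult_indicator: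
  assumes "finite F"
  shows "(\<Sum>w\<in>F. c w * indicator {w} z) = (if z \<in> F then c z else 0 :: real)"
    and "(\<Sum>w\<in>F. indicator {z} w) = (if z \<in> F then 1 else 0 :: real)"
proof -
  have "(\<Sum>w\<in>F. c w * indicator {w} z) = (\<Sum>w\<in>F. if z = w then c w else 0)"
    by (intro sum.cong) (auto simp: indicator_def)
  then show "(\<Sum>w\<in>F. c w * indicator {w} z) = (if z \<in> F then c z else 0)"
    using assms by simp
  have "(\<Sum>w\<in>F. indicator {z} w) = (\<Sum>w\<in>F. if w = z then 1 else 0 :: real)"
    by (intro sum.cong) (auto simp: indicator_def)
  then show "(\<Sum>w\<in>F. indicator {z} w) = (if z \<in> F then 1 else 0 :: real)"
    using assms by simp
qed

lemma cos_pi_div_nonneg: "n \<ge> 2 \<Longrightarrow> 0 \<le> cos (pi / real n)"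
proof (rule cos_ge_zero)
  assume "n \<ge> 2"
  then show "pi / real n \<le> pi / 2" by (intro divide_left_mono) auto
  have "0 \<le> pi / real n" by simp
  then show "- (pi / 2) \<le> pi / real n" using pi_gt_zero by linarith
qed

context dl_trees
begin

abbreviation P :: "('a \<times> 'b \<Rightarrow> real) \<Rightarrow> 'a \<times> 'b \<Rightarrow> real" where "P \<equiv> srw_op E V"

abbreviation \<delta> :: "'a \<times> 'b \<Rightarrow> 'a \<times> 'b \<Rightarrow> real" where "\<delta> x \<equiv> indicator {x}"

lemma E_sym: "E x y \<longleftrightarrow> E y x"
  using T1 T2 by (auto simp: dl_adj_def homogeneous_tree_def is_tree_def dest: sympD)

lemma nbrs_V_finite_card:
  assumes "p \<in> V"
  shows "finite (nbrs E V p)" "card (nbrs E V p) = q + r"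
proof -
  obtain x y where p: "p = (x, y)" by (cases p)
  have disj: "{x'. par1 x' = x} \<times> {par2 y} \<inter> {par1 x} \<times> {y'. par2 y' = y} = {}"
  proof -
    have "{x'. par1 x' = x} \<inter> {par1 x} = {}" by (simp add: X.par_not_child)
    then show ?thesis by (simp only: Times_Int_Times Sigma_empty1)
  qed
  have fin: "finite ({x'. par1 x' = x} \<times> {par2 y})" "finite ({par1 x} \<times> {y'. par2 y' = y})"
    using X.finite_children Y.finite_children by auto
  have N: "nbrs E V p = {x'. par1 x' = x} \<times> {par2 y} \<union> {par1 x} \<times> {y'. par2 y' = y}"
    unfolding p by (rule nbrs_V) (use assms p in simp)
  show "finite (nbrs E V p)" unfolding N using fin by blast
  show "card (nbrs E V p) = q + r"
    unfolding N card_Un_disjoint[OF fin disj] by (simp add: card_cartesian_product X.card_children Y.card_children)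
qed

lemma P_nbrs: "p \<in> V \<Longrightarrow> P f p = (\<Sum>y\<in>nbrs E V p. f y) / real (q + r)"
  by (simp add: srw_op_def nbrs_V_finite_card flip: sum_divide_distrib)

text \<open>The walk is symmetric since all degrees are \<open>q + r\<close>.\<close>

lemma P_pow_symmetric:
  assumes "x \<in> V" "y \<in> V"
  shows "(P ^^ n) (\<delta> y) x = (P ^^ n) (\<delta> x) y"
  using assms
proof (induction n arbitrary: x y)
  case 0
  then show ?case by (auto simp: indicator_def)
next
  case (Suc n)
  have "P (\<delta> x) z = (\<Sum>w\<in>nbrs E V x. (1 / real (q + r)) * \<delta> w z)" if z: "z \<in> V" for z
  proof -
    have "x \<in> nbrs E V z \<longleftrightarrow> z \<in> nbrs E V x"
      using Suc.prems z E_sym by (auto simp only: nbrs_def mem_Collect_eq)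
    then show ?thesis
      by (simp only: P_nbrs[OF z] sum_mult_indicator[OF nbrs_V_finite_card(1)] z Suc.prems) simp
  qed
  then have "(P ^^ n) (P (\<delta> x)) y = (P ^^ n) (\<lambda>z. \<Sum>w\<in>nbrs E V x. (1 / real (q + r)) * \<delta> w z) y"
    using Suc.prems by (intro srw_op_pow_cong) auto
  then have "(P ^^ Suc n) (\<delta> x) y = (\<Sum>w\<in>nbrs E V x. (1 / real (q + r)) * (P ^^ n) (\<delta> w) y)"
    by (simp only: funpow_Suc_right comp_apply srw_op_pow_sum)
  also have "\<dots> = (\<Sum>w\<in>nbrs E V x. (1 / real (q + r)) * (P ^^ n) (\<delta> y) w)"
    using Suc.IH Suc.prems by (intro sum.cong) (auto simp: nbrs_def)
  also have "\<dots> = (P ^^ Suc n) (\<delta> y) x"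
    using Suc.prems by (simp add: P_nbrs sum_divide_distrib)
  finally show ?case by simp
qed

lemma P_pow_nonneg: "x \<in> V \<Longrightarrow> 0 \<le> (P ^^ n) (\<delta> y) x"
  using srw_op_pow_mono[of V "\<lambda>_. 0" "\<delta> y" x n E] srw_op_pow_scale[of n E V 0 "\<lambda>_. 0" x]
  by simp

text \<open>The function \<open>t\<^sup>h\<close>, with \<open>h\<close> the first Busemann function, is an eigenfunction of the walk with
  eigenvalue \<open>\<rho>\<close>.\<close>

lemma return_probability_le:
  assumes "p \<in> V"
  shows "(P ^^ n) (\<delta> p) p \<le> rho q r ^ n"
proof -
  obtain x0 y0 where p: "p = (x0, y0)" by (cases p)
  define f where "f = (\<lambda>(x, y :: 'b). t powi (h1 x - h1 x0))"
  have Pf: "P f z = rho q r * f z" if z: "z \<in> V" for z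
  proof -
    obtain x y where xy: "z = (x, y)" by (cases z)
    define T where "T = t powi (h1 x - h1 x0)"
    have T: "t powi (h1 x - h1 x0 + 1) = t * T" "t powi (h1 x - h1 x0 - 1) = T / t"
      using t_pos by (simp_all add: T_def power_int_add power_int_diff)
    have up: "f (x', par2 y) = t * T" if "par1 x' = x" for x'
    proof -
      have "h1 x' - h1 x0 = h1 x - h1 x0 + 1" using X.lev_par[of x'] that by simp
      then show ?thesis by (simp only: f_def prod.case T)
    qed
    have down: "f (par1 x, y') = T / t" for y'
    proof -
      have "h1 (par1 x) - h1 x0 = h1 x - h1 x0 - 1" using X.lev_par[of x] by simp
      then show ?thesis by (simp only: f_def prod.case T)
    qed
    have "P f z = (real q * (t * T) + real r * (T / t)) / (real q + real r)"
      using srw_op_V[of x y f] z unfolding xy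
      by (simp add: up down X.card_children Y.card_children)
    also have "real r * (T / t) = real q * t * T"
      using t_pos by (simp flip: t_square add: power2_eq_square)
    finally have "P f z * (real q + real r) = (rho q r * (real q + real r)) * T"
      using q_ge_2 unfolding rho_t by (simp add: field_simps)
    then show ?thesis using q_ge_2 by (simp add: xy f_def T_def)
  qed
  have "(P ^^ n) (\<delta> p) z \<le> rho q r ^ n * f z" if "z \<in> V" for z
    using that
  proof (induction n arbitrary: z)
    case 0
    then show ?case using t_pos by (auto simp: indicator_def f_def p split: prod.splits)
  next
    case (Suc n)
    have "(P ^^ Suc n) (\<delta> p) z \<le> P (\<lambda>z. rho q r ^ n * f z) z"
      using Suc.IH by (auto intro: srw_op_mono)
    then show ?case using Pf[OF Suc.prems] srw_op_scale[of E V "rho q r ^ n" f] by (simp add: mult_ac)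
  qed
  from this[OF assms] show ?thesis by (simp add: f_def p)
qed

text \<open>One has \<open>\<lambda>\<^sup>n f(p) \<le> (P\<^sup>n f)(p) = \<Sum>\<^sub>x p\<^sup>(\<^sup>n\<^sup>)(p,x) f(x)\<close>. Apply the Cauchy-Schwarz inequality to the sum,
  together with \<open>\<Sum>\<^sub>x p\<^sup>(\<^sup>n\<^sup>)(p,x)\<^sup>2 \<le> p\<^sup>(\<^sup>2\<^sup>n\<^sup>)(p,p)\<close>, where the sum is over \<open>F\<close> and symmetry enters.\<close>

lemma return_probability_ge:
  assumes "p \<in> V" "finite F" "F \<subseteq> V" "\<And>z. z \<notin> F \<Longrightarrow> f z = 0" "f p > 0" "l \<ge> 0"
    and sub: "\<And>z. z \<in> V \<Longrightarrow> l * f z \<le> P f z"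
  shows "\<exists>C>0. \<forall>n. C * l ^ (2 * n) \<le> (P ^^ (2 * n)) (\<delta> p) p"
proof -
  define B where "B = (\<Sum>x\<in>F. (f x)\<^sup>2)"
  have pF: "p \<in> F" using assms(4)[of p] assms(5) by force
  have "0 < (f p)\<^sup>2" using assms(5) by simp
  also have "\<dots> \<le> B" unfolding B_def using pF assms(2) by (intro member_le_sum) auto
  finally have "B > 0" .
  have "(f p)\<^sup>2 / B * l ^ (2 * n) \<le> (P ^^ (2 * n)) (\<delta> p) p" for n
  proof -
    have pow: "l ^ m * f z \<le> (P ^^ m) f z" if "z \<in> V" for z m
      using that
    proof (induction m arbitrary: z)
      case (Suc m)
      have "l ^ Suc m * f z = l ^ m * (l * f z)" by simp
      also have "\<dots> \<le> l ^ m * P f z" using sub[OF Suc.prems] assms(6) by (intro mult_left_mono) auto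
      also have "\<dots> = P (\<lambda>z. l ^ m * f z) z" by (simp add: srw_op_scale)
      also have "\<dots> \<le> P ((P ^^ m) f) z" using Suc.IH by (intro srw_op_mono)
      finally show ?case by simp
    qed simp
    have "f = (\<lambda>z. \<Sum>x\<in>F. f x * \<delta> x z)"
      using assms(4) by (auto simp: sum_mult_indicator(1)[OF assms(2)])
    then have "(P ^^ n) f p = (\<Sum>x\<in>F. f x * (P ^^ n) (\<delta> x) p)"
      using srw_op_pow_sum[where I = F and c = f and f = \<delta> and x = p and n = n and E = E and S = V] by simp
    also have "\<dots> = (\<Sum>x\<in>F. f x * (P ^^ n) (\<delta> p) x)"
      using P_pow_symmetric[OF assms(1) subsetD[OF assms(3)]] by (intro sum.cong) auto
    finally have expand: "(P ^^ n) f p = (\<Sum>x\<in>F. f x * (P ^^ n) (\<delta> p) x)" .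
    have "(\<Sum>x\<in>F. (P ^^ n) (\<delta> p) x * \<delta> x z) \<le> (P ^^ n) (\<delta> p) z" if "z \<in> V" for z
      using P_pow_nonneg[OF that, of n p] by (simp add: sum_mult_indicator(1)[OF assms(2)])
    then have "(P ^^ n) (\<lambda>z. \<Sum>x\<in>F. (P ^^ n) (\<delta> p) x * \<delta> x z) p \<le> (P ^^ n) ((P ^^ n) (\<delta> p)) p"
      using assms(1) by (intro srw_op_pow_mono)
    also have "\<dots> = (P ^^ (2 * n)) (\<delta> p) p" by (simp add: mult_2 funpow_add)
    also have "(P ^^ n) (\<lambda>z. \<Sum>x\<in>F. (P ^^ n) (\<delta> p) x * \<delta> x z) p = (\<Sum>x\<in>F. (P ^^ n) (\<delta> p) x * (P ^^ n) (\<delta> x) p)"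
      by (rule srw_op_pow_sum)
    also have "\<dots> = (\<Sum>x\<in>F. ((P ^^ n) (\<delta> p) x)\<^sup>2)"
      using P_pow_symmetric[OF assms(1) subsetD[OF assms(3)]] by (intro sum.cong) (auto simp: power2_eq_square)
    finally have sq: "(\<Sum>x\<in>F. ((P ^^ n) (\<delta> p) x)\<^sup>2) \<le> (P ^^ (2 * n)) (\<delta> p) p" .
    have "(l ^ n * f p)\<^sup>2 \<le> ((P ^^ n) f p)\<^sup>2"
      using pow[OF assms(1), of n] assms(5,6) by (intro power_mono) auto
    also have "\<dots> \<le> B * (\<Sum>x\<in>F. ((P ^^ n) (\<delta> p) x)\<^sup>2)"
      unfolding expand B_def by (rule Cauchy_Schwarz_ineq_sum)
    also have "\<dots> \<le> B * (P ^^ (2 * n)) (\<delta> p) p"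
      using sq \<open>B > 0\<close> by (intro mult_left_mono) auto
    finally have "(l ^ n * f p)\<^sup>2 / B \<le> (P ^^ (2 * n)) (\<delta> p) p"
      using \<open>B > 0\<close> by (simp add: pos_divide_le_eq mult.commute)
    moreover have "(l ^ n * f p)\<^sup>2 / B = (f p)\<^sup>2 / B * l ^ (2 * n)"
      by (simp add: power_mult_distrib power_even_eq)
    ultimately show ?thesis by simp
  qed
  moreover have "(f p)\<^sup>2 / B > 0" using \<open>B > 0\<close> assms(5) by simp
  ultimately show ?thesis by blast
qed

end

context dl_tetrahedron
begin

text \<open>The function \<open>t\<^sup>k sin (k \<pi> / n)\<close> of the level \<open>k\<close> satisfies the radial recurrence for the eigenvalue
  \<open>\<rho> cos (\<pi> / n)\<close> and vanishes at both extreme levels. Cut off outside the tetrahedron it still satisfies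
  an inequality, as the walk can only add nonnegative contributions where it vanishes.\<close>

lemma return_probability_ge_tetrahedron:
  assumes p: "(x0, y0) \<in> S" "0 < level x0" "level x0 < n"
  shows "\<exists>C>0. \<forall>m. C * (rho q r * cos (pi / real n)) ^ (2 * m) \<le> (P ^^ (2 * m)) (\<delta> (x0, y0)) (x0, y0)"
proof -
  have n: "n \<ge> 2" using p by linarith
  define s where "s k = sin (real k * (pi / real n))" for k
  have s_nonneg: "0 \<le> s k" if "k \<le> n" for k
    unfolding s_def using that n by (intro sin_ge_zero) (auto simp: field_simps)
  have s_pos: "0 < s k" if "0 < k" "k < n" for k
    unfolding s_def using that by (intro sin_gt_zero) (auto simp: field_simps)
  have s_end: "s 0 = 0" "s n = 0" using n by (auto simp: s_def)
  have s_rec: "s (Suc k) + s (k - 1) = 2 * cos (pi / real n) * s k" if "k > 0" for k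
  proof -
    have "real (Suc k) * (pi / real n) = real k * (pi / real n) + pi / real n"
      "real (k - 1) * (pi / real n) = real k * (pi / real n) - pi / real n"
      using that by (simp_all add: algebra_simps of_nat_diff add_divide_distrib diff_divide_distrib)
    then show ?thesis unfolding s_def by (simp only: sin_add sin_diff) simp
  qed
  define f where "f = (\<lambda>(x, y). if (x, y) \<in> S then t ^ level x * s (level x) else 0)"
  have nonneg: "0 \<le> f z" for z
    using t_pos s_nonneg level(2) by (auto simp: f_def split: prod.splits)
  have l: "rho q r * cos (pi / real n) \<ge> 0"
    using rho_pos cos_pi_div_nonneg[OF n] by simp
  have sub: "rho q r * cos (pi / real n) * f z \<le> P f z" if z: "z \<in> V" for z
  proof (cases "z \<in> S \<and> f z \<noteq> 0")
    case False
    then have "f z = 0" by (auto simp: f_def split: prod.splits)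
    moreover have "0 \<le> P f z" using nonneg by (auto simp: srw_op_def intro!: sum_nonneg)
    ultimately show ?thesis by simp
  next
    case True
    obtain x y where xy: "z = (x, y)" by (cases z)
    let ?k = "level x"
    have S: "(x, y) \<in> S" using True xy by simp
    have fz: "f z = t ^ ?k * s ?k" using True xy by (simp add: f_def)
    then have "?k \<noteq> 0" "?k \<noteq> n" using True s_end by (intro notI; simp)+
    then have k: "0 < ?k" "?k < n" using level(2)[OF S] by linarith+
    have anc: "X.anc a1 x" using S by (simp add: mem_S)
    have up: "f (x', par2 y) = t ^ Suc ?k * s (Suc ?k)" if "par1 x' = x" for x'
    proof -
      have "(x', par2 y) \<in> nbrs E S (x, y)" unfolding nbrs_S[OF S] using k that by simp
      then have "(x', par2 y) \<in> S" by (simp add: nbrs_def)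
      then show ?thesis using level_child[OF that anc] by (simp add: f_def)
    qed
    have down: "f (par1 x, y') = t ^ (?k - 1) * s (?k - 1)" if "par2 y' = y" for y'
    proof -
      have "(par1 x, y') \<in> nbrs E S (x, y)" unfolding nbrs_S[OF S] using k that by simp
      then have "(par1 x, y') \<in> S" by (simp add: nbrs_def)
      then show ?thesis using level_par[OF k(1)] by (simp add: f_def)
    qed
    have "P f z * (real q + real r) = real q * (t ^ Suc ?k * s (Suc ?k)) + real r * (t ^ (?k - 1) * s (?k - 1))"
      using srw_op_V[of x y f] z q_ge_2 unfolding xy by (simp add: up down X.card_children Y.card_children)
    also have "real r * (t ^ (?k - 1) * s (?k - 1)) = real q * (t ^ Suc ?k * s (?k - 1))"
    proof -
      obtain k' where "?k = Suc k'" using k by (metis gr0_implies_Suc)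
      then show ?thesis by (simp flip: t_square) (simp add: power2_eq_square)
    qed
    also have "real q * (t ^ Suc ?k * s (Suc ?k)) + real q * (t ^ Suc ?k * s (?k - 1)) =
        (2 * real q * t) * (t ^ ?k * (s (Suc ?k) + s (?k - 1)) / 2)"
      by (simp add: algebra_simps)
    also have "\<dots> = (rho q r * cos (pi / real n) * f z) * (real q + real r)"
      unfolding s_rec[OF k(1)] fz rho_t[symmetric] by (simp add: algebra_simps)
    finally show ?thesis using q_ge_2 by simp
  qed
  show ?thesis
  proof (rule return_probability_ge)
    show "(x0, y0) \<in> V" "S \<subseteq> V" using p by (auto simp: tetrahedron_def)
    show "f (x0, y0) > 0" using p t_pos s_pos by (simp add: f_def)
    show "f z = 0" if "z \<notin> S" for z using that by (auto simp: f_def split: prod.splits)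
  qed (use finite_S l sub in auto)
qed

end

text \<open>The upper limit dominates the one along the even times, and the constant disappears under the roots.\<close>

lemma limsup_root_ge:
  fixes u :: "nat \<Rightarrow> real"
  assumes "C > 0" "l \<ge> 0" "\<And>n. C * l ^ (2 * n) \<le> u (2 * n)"
  shows "ereal l \<le> limsup (\<lambda>n. ereal (root n (u n)))"
proof -
  have "(\<lambda>n. root (2 * n) C) \<longlonglongrightarrow> 1"
    using LIMSEQ_subseq_LIMSEQ[OF LIMSEQ_root_const[OF assms(1)], of "\<lambda>n. 2 * n"]
    by (simp add: strict_mono_def comp_def)
  then have "(\<lambda>n. root (2 * n) C * l) \<longlonglongrightarrow> 1 * l" by (intro tendsto_intros)
  then have "(\<lambda>n. ereal (root (2 * n) C * l)) \<longlonglongrightarrow> ereal l" by simp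
  then have "ereal l = limsup (\<lambda>n. ereal (root (2 * n) C * l))"
    using lim_imp_Limsup[OF trivial_limit_sequentially] by metis
  also have "\<dots> \<le> limsup (\<lambda>n. ereal (root (2 * n) (u (2 * n))))"
  proof (rule Limsup_mono)
    show "\<forall>\<^sub>F n in sequentially. ereal (root (2 * n) C * l) \<le> ereal (root (2 * n) (u (2 * n)))"
      using eventually_gt_at_top[of 0]
    proof eventually_elim
      case (elim n)
      have "root (2 * n) C * l = root (2 * n) (C * l ^ (2 * n))"
        using elim assms by (simp add: real_root_mult real_root_power_cancel)
      also have "\<dots> \<le> root (2 * n) (u (2 * n))"
        using elim assms by (intro real_root_le_mono) auto
      finally show ?case by simp
    qed
  qed
  also have "\<dots> \<le> limsup (\<lambda>n. ereal (root n (u n)))"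
    using limsup_subseq_mono[of "\<lambda>n. 2 * n" "\<lambda>n. ereal (root n (u n))"]
    by (simp add: strict_mono_def comp_def)
  finally show ?thesis .
qed

locale dl_exhaustion = dl_trees q r T1 T2
  for q r and T1 :: "'a ended_tree" and T2 :: "'b ended_tree" +
  fixes a1 :: "nat \<Rightarrow> 'a" and a2 :: "nat \<Rightarrow> 'b"
  assumes heights: "\<And>n. has_height T1 T2 (a1 n) (a2 n) n"
    and inc: "incseq (\<lambda>n. tetrahedron T1 T2 (a1 n) (a2 n))"
    and union: "(\<Union>n. tetrahedron T1 T2 (a1 n) (a2 n)) = dl_verts T1 T2"
begin

abbreviation Tet :: "nat \<Rightarrow> ('a \<times> 'b) set" where "Tet n \<equiv> tetrahedron T1 T2 (a1 n) (a2 n)"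

lemma dl_tetrahedron: "dl_tetrahedron q r T1 T2 (a1 n) (a2 n) n"
  by unfold_locales (rule heights)

lemma spectral_radius: "srw_spectral_radius E V (base T1, base T2) = ereal (rho q r)"
proof -
  let ?o = "(base T1, base T2)"
  let ?u = "\<lambda>n. (P ^^ n) (\<delta> ?o) ?o"
  have "h1 (base T1) = 0" "h2 (base T2) = 0"
    using homogeneous_tree_ancestral(4)[OF T1 q_ge_2] homogeneous_tree_ancestral(4)[OF T2 r_ge_2] .
  then have oV: "?o \<in> V" by (simp add: mem_V)
  have up: "limsup (\<lambda>n. ereal (root n (?u n))) \<le> ereal (rho q r)"
  proof (rule Limsup_bounded)
    show "\<forall>\<^sub>F n in sequentially. ereal (root n (?u n)) \<le> ereal (rho q r)"
      using eventually_gt_at_top[of 0]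
    proof eventually_elim
      case (elim n)
      have "root n (?u n) \<le> root n (rho q r ^ n)"
        using elim return_probability_le[OF oV] by (intro real_root_le_mono) auto
      then show ?case using elim rho_pos by (simp add: real_root_power_cancel)
    qed
  qed
  \<comment> \<open>One neighbour in each direction: a tetrahedron that contains both has the root at an interior level.\<close>
  define nbr_down where "nbr_down = (X.first_child (base T1), par2 (base T2))"
  define nbr_up where "nbr_up = (par1 (base T1), Y.first_child (base T2))"
  have "nbr_down \<in> V" "nbr_up \<in> V"
    using oV by (auto simp: nbr_down_def nbr_up_def mem_V X.lev_first_child Y.lev_first_child X.lev_par Y.lev_par)
  then obtain n1 n2 n3 where "nbr_down \<in> Tet n1" "nbr_up \<in> Tet n2" "?o \<in> Tet n3"
    using oV unfolding union[symmetric] by blast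
  then have in_S: "nbr_down \<in> Tet n" "nbr_up \<in> Tet n" "?o \<in> Tet n" if "n \<ge> max n1 (max n2 n3)" for n
    using that incseqD[OF inc, of n1 n] incseqD[OF inc, of n2 n] incseqD[OF inc, of n3 n] by auto
  have low: "ereal (rho q r * cos (pi / real n)) \<le> limsup (\<lambda>n. ereal (root n (?u n)))"
    if n: "n \<ge> max n1 (max n2 n3)" for n
  proof -
    interpret dl_tetrahedron q r T1 T2 "a1 n" "a2 n" n by (rule dl_tetrahedron)
    have lev: "level (base T1) < n" "0 < level (base T1)"
    proof -
      have "nbr_up \<in> nbrs E V ?o" "nbr_down \<in> nbrs E V ?o"
        unfolding nbrs_V[OF oV] by (simp_all add: nbr_up_def nbr_down_def X.par_first_child Y.par_first_child)
      then have "nbr_up \<in> nbrs E (Tet n) ?o" "nbr_down \<in> nbrs E (Tet n) ?o"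
        using in_S[OF n] by (simp_all add: nbrs_def)
      then show "level (base T1) < n" "0 < level (base T1)"
        unfolding nbrs_S[OF in_S(3)[OF n]] nbr_up_def nbr_down_def
        using X.par_not_child[of "base T1"] X.lev_par[of "base T1"] X.lev_first_child[of "base T1"]
        by (auto split: if_splits)
    qed
    from return_probability_ge_tetrahedron[OF in_S(3)[OF n] lev(2,1)]
    obtain C where "C > 0" "\<And>m. C * (rho q r * cos (pi / real n)) ^ (2 * m) \<le> ?u (2 * m)" by blast
    moreover have "0 \<le> rho q r * cos (pi / real n)"
      using rho_pos cos_pi_div_nonneg[of n] lev by simp
    ultimately show ?thesis by (intro limsup_root_ge)
  qed
  have "(\<lambda>n. rho q r * cos (pi / real n)) \<longlonglongrightarrow> rho q r * cos 0"
    by (intro tendsto_intros lim_const_over_n)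
  then have "(\<lambda>n. ereal (rho q r * cos (pi / real n))) \<longlonglongrightarrow> ereal (rho q r)" by simp
  then have "ereal (rho q r) \<le> limsup (\<lambda>n. ereal (root n (?u n)))"
    by (rule LIMSEQ_le_const2) (use low in blast)
  with up show ?thesis by (simp add: srw_spectral_radius_def antisym)
qed

end

section \<open>The limit measures\<close>

lemma card_bij_betw_mem:
  assumes "bij_betw f I B"
  shows "card {m \<in> I. f m \<in> A} = card (B \<inter> A)"
proof -
  have "bij_betw f {m \<in> I. f m \<in> A} (B \<inter> A)"
    using assms by (auto simp: bij_betw_def inj_on_def)
  then show ?thesis by (rule bij_betw_same_card)
qed

lemma emeasure_sum_delta:
  assumes "finite I" "A \<in> sets borel"
  shows "emeasure (measure_sum I (\<lambda>i. delta (f i))) A = ennreal (real (card {i \<in> I. f i \<in> A}))"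
proof -
  have "emeasure (measure_sum I (\<lambda>i. delta (f i))) A = (\<integral>\<^sup>+i. indicator A (f i) \<partial>count_space I)"
    using assms(2) by (simp add: emeasure_measure_sum)
  also have "\<dots> = (\<Sum>i\<in>I. indicator A (f i))"
    using assms(1) by (rule nn_integral_count_space_finite)
  also have "\<dots> = (\<Sum>i\<in>I. of_bool (f i \<in> A))"
    by (simp add: indicator_def)
  also have "\<dots> = of_nat (card {i \<in> I. f i \<in> A})"
    using assms(1) by (simp add: of_bool_def sum.If_cases Int_def)
  finally show ?thesis by (simp add: ennreal_of_nat_eq_real_of_nat)
qed

lemma emeasure_cumulative_spectral_measure:
  assumes "finite S" "A \<in> sets borel"
  shows "emeasure (cumulative_spectral_measure E S) A =
    ennreal ((\<Sum>l\<in>spec E S \<inter> A. real (mult E S l)) / real (card S))"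
proof -
  have fin: "finite (spec E S)" using assms(1) by (rule finite_spec)
  have "emeasure (measure_sum (spec E S) (\<lambda>l. scale_measure (of_nat (mult E S l)) (delta l))) A
      = (\<integral>\<^sup>+l. of_nat (mult E S l) * indicator A l \<partial>count_space (spec E S))"
    using assms(2) by (simp add: emeasure_measure_sum)
  also have "\<dots> = (\<Sum>l\<in>spec E S. of_nat (mult E S l) * indicator A l)"
    using fin by (rule nn_integral_count_space_finite)
  also have "\<dots> = (\<Sum>l\<in>spec E S \<inter> A. of_nat (mult E S l))"
    using fin by (simp add: indicator_def sum.If_cases if_distrib[of "\<lambda>u. _ * u"] cong: if_cong)
  also have "\<dots> = ennreal (\<Sum>l\<in>spec E S \<inter> A. real (mult E S l))"
    by (simp add: ennreal_of_nat_eq_real_of_nat flip: of_nat_sum)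
  finally show ?thesis
    using assms(2) by (simp add: cumulative_spectral_measure_def sum_nonneg flip: ennreal_mult)
qed

lemma nn_integral_count_space_nat_set:
  "(\<integral>\<^sup>+N. f N \<partial>count_space I) = (\<Sum>N. f N * indicator I N)" for f :: "nat \<Rightarrow> ennreal"
  by (simp add: nn_integral_count_space_indicator nn_integral_count_space_nat)

lemma nn_integral_count_space_eq_0_iff:
  "(\<integral>\<^sup>+N. f N \<partial>count_space I) = 0 \<longleftrightarrow> (\<forall>N\<in>I. f N = 0)"
  by (simp add: nn_integral_0_iff_AE AE_count_space)

context degrees
begin

definition inner_mass :: "nat \<Rightarrow> real" where
  "inner_mass N = (real q - 1) * (real r - 1) / real r ^ N"

definition outer_mass :: "nat \<Rightarrow> real" where
  "outer_mass N = (real r - real q) * (real r - 1) / real r ^ (N + 1)"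

abbreviation inner_count :: "real set \<Rightarrow> nat \<Rightarrow> nat" where
  "inner_count A N \<equiv> card {m \<in> {1..N - 1}. lambda q r m N \<in> A}"

abbreviation outer_count :: "real set \<Rightarrow> nat \<Rightarrow> nat" where
  "outer_count A N \<equiv> card (eigvals N \<inter> A)"

lemma mass_pos: "inner_mass N > 0" "outer_mass N > 0"
  using q_ge_2 q_less_r by (auto simp: inner_mass_def outer_mass_def)

lemma emeasure_mu_lim:
  assumes A: "A \<in> sets borel"
  shows "emeasure (mu_lim q r) A =
    (\<integral>\<^sup>+N. ennreal (inner_mass N * inner_count A N) \<partial>count_space {2..}) +
    (\<integral>\<^sup>+N. ennreal (outer_mass N * card {m \<in> {0..N - 1}. lambda' q r m N \<in> A})
       \<partial>count_space {N. 1 \<le> N \<and> real N \<le> threshold q r}) +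
    (\<integral>\<^sup>+N. ennreal (outer_mass N * card {m \<in> {1..N - 2}. lambda' q r m N \<in> A})
       \<partial>count_space {N. real N > threshold q r})"
proof -
  have pos: "(real q - 1) * (real r - 1) \<ge> 0" "(real r - real q) * (real r - 1) \<ge> 0" "real r > 0"
    using q_ge_2 q_less_r by auto
  have "emeasure (measure_sum I (\<lambda>N. scale_measure (ennreal (1 / real r ^ k N)) (measure_sum (J N) (\<lambda>m. delta (f m N))))) A
    = (\<integral>\<^sup>+N. ennreal (1 / real r ^ k N * card {m \<in> J N. f m N \<in> A}) \<partial>count_space I)"
    if "\<And>N. finite (J N)" for I :: "nat set" and k and J :: "nat \<Rightarrow> nat set" and f
    using A that pos
    by (subst emeasure_measure_sum) (auto simp: emeasure_sum_delta simp flip: ennreal_mult intro!: nn_integral_cong)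
  then have sc: "emeasure (scale_measure (ennreal c) (measure_sum I (\<lambda>N. scale_measure (ennreal (1 / real r ^ k N)) (measure_sum (J N) (\<lambda>m. delta (f m N)))))) A
    = (\<integral>\<^sup>+N. ennreal (c / real r ^ k N * card {m \<in> J N. f m N \<in> A}) \<partial>count_space I)"
    if "\<And>N. finite (J N)" "c \<ge> 0" for I :: "nat set" and k and J :: "nat \<Rightarrow> nat set" and f c
    using A that pos
    by (simp add: nn_integral_cmult[symmetric] ennreal_mult[symmetric] mult.assoc[symmetric] del: times_divide_eq_left)
  have add: "emeasure (scale_measure c1 (measure_sum I1 F1) \<oplus>\<^sub>M scale_measure c2 (measure_sum I2 F2) \<oplus>\<^sub>M
      scale_measure c3 (measure_sum I3 F3)) A =
    emeasure (scale_measure c1 (measure_sum I1 F1)) A + emeasure (scale_measure c2 (measure_sum I2 F2)) A +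
      emeasure (scale_measure c3 (measure_sum I3 F3)) A"
    for c1 c2 c3 and I1 I2 I3 :: "nat set" and F1 F2 F3
    by (simp add: emeasure_measure_add A)
  show ?thesis
    unfolding mu_lim_def add inner_mass_def outer_mass_def
    by (simp only: sc pos finite_atLeastAtMost)
qed

lemma emeasure_nu_lim:
  assumes A: "A \<in> sets borel"
  shows "emeasure (nu_lim q r) A =
    (\<integral>\<^sup>+N. ennreal (outer_mass N * card (outer_pair N \<inter> A))
       \<partial>count_space {N. real N > threshold q r})"
proof -
  let ?T = "{N. real N > threshold q r}"
  have pos: "(real r - real q) * (real r - 1) \<ge> 0" "real r > 0"
    using q_ge_2 q_less_r by auto
  have two: "emeasure (delta (lambda' q r 0 N) \<oplus>\<^sub>M delta (- lambda' q r 0 N)) A =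
      ennreal (real (card (outer_pair N \<inter> A)))" if "N \<in> ?T" for N
  proof -
    have "lambda' q r 0 N > 0" using lambda'_0_bounds(1)[of N] that rho_pos by simp
    then have "card (outer_pair N \<inter> A) =
        (if lambda' q r 0 N \<in> A then 1 else 0) + (if - lambda' q r 0 N \<in> A then 1 else 0)"
      by (auto simp: Int_insert_left)
    then show ?thesis using A
      by (subst emeasure_measure_add) (auto simp: indicator_def)
  qed
  have "emeasure (nu_lim q r) A = ennreal ((real r - real q) * (real r - 1)) *
      (\<integral>\<^sup>+N. ennreal (1 / real r ^ (N + 1)) * emeasure (delta (lambda' q r 0 N) \<oplus>\<^sub>M delta (- lambda' q r 0 N)) A \<partial>count_space ?T)"
    unfolding nu_lim_def using A by (simp add: emeasure_measure_sum)
  also have "\<dots> = ennreal ((real r - real q) * (real r - 1)) *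
      (\<integral>\<^sup>+N. ennreal (1 / real r ^ (N + 1) * card (outer_pair N \<inter> A)) \<partial>count_space ?T)"
    using two pos by (intro arg_cong2[where f = "(*)"] nn_integral_cong refl)
      (simp add: ennreal_mult[symmetric])
  also have "\<dots> = (\<integral>\<^sup>+N. ennreal ((real r - real q) * (real r - 1) / real r ^ (N + 1) *
      card (outer_pair N \<inter> A)) \<partial>count_space ?T)"
    using pos by (simp add: nn_integral_cmult[symmetric] ennreal_mult[symmetric] del: times_divide_eq_left)
      (simp add: mult.assoc)
  finally show ?thesis by (simp only: outer_mass_def)
qed

definition limit_term :: "real set \<Rightarrow> nat \<Rightarrow> real" where
  "limit_term A N = of_bool (N \<ge> 2) * inner_mass N * inner_count A N +
    of_bool (N \<ge> 1) * outer_mass N * outer_count A N"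

lemma limit_term_nonneg: "limit_term A N \<ge> 0"
  using mass_pos(1)[of N, THEN less_imp_le] mass_pos(2)[of N, THEN less_imp_le]
  by (simp add: limit_term_def)

text \<open>In the sum of the two measures the case distinction by the threshold disappears: the outer pairs in
  \<open>\<nu>\<close> complete the inner values in \<open>\<mu>\<close> to the full zero set of the boundary polynomial.\<close>

lemma emeasure_limit:
  assumes A: "A \<in> sets borel"
  shows "emeasure (mu_lim q r \<oplus>\<^sub>M nu_lim q r) A = (\<Sum>N. ennreal (limit_term A N))"
proof -
  have sets: "sets (mu_lim q r) = sets borel" "sets (nu_lim q r) = sets borel"
    by (simp_all add: mu_lim_def nu_lim_def)
  let ?L = "{N. 1 \<le> N \<and> real N \<le> threshold q r}" and ?T = "{N. real N > threshold q r}"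
  define a b c d where "a N = ennreal (inner_mass N * inner_count A N) * indicator {2..} N"
    and "b N = ennreal (outer_mass N * card {m \<in> {0..N - 1}. lambda' q r m N \<in> A}) * indicator ?L N"
    and "c N = ennreal (outer_mass N * card {m \<in> {1..N - 2}. lambda' q r m N \<in> A}) * indicator ?T N"
    and "d N = ennreal (outer_mass N * card (outer_pair N \<inter> A)) * indicator ?T N" for N
  have "emeasure (mu_lim q r \<oplus>\<^sub>M nu_lim q r) A = (\<Sum>N. a N) + (\<Sum>N. b N) + (\<Sum>N. c N) + (\<Sum>N. d N)"
    unfolding emeasure_measure_add[OF sets A] emeasure_mu_lim[OF A] emeasure_nu_lim[OF A]
      nn_integral_count_space_nat_set a_def b_def c_def d_def ..
  also have "\<dots> = (\<Sum>N. a N + b N + c N + d N)"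
    by (simp add: suminf_add)
  also have "\<dots> = (\<Sum>N. ennreal (limit_term A N))"
  proof (intro suminf_cong)
    fix N
    have nn: "inner_mass N \<ge> 0" "outer_mass N \<ge> 0" using mass_pos[of N] by simp_all
    have aN: "a N = ennreal (of_bool (N \<ge> 2) * inner_mass N * inner_count A N)"
      by (simp add: a_def indicator_def)
    have "b N + c N + d N = ennreal (of_bool (N \<ge> 1) * outer_mass N * outer_count A N)"
    proof -
      consider "N = 0" | "1 \<le> N" "real N \<le> threshold q r" | "real N > threshold q r" by linarith
      then show ?thesis
      proof cases
        case 1
        then show ?thesis using threshold_gt_1 by (simp add: b_def c_def d_def)
      next
        case 2
        then have "bij_betw (\<lambda>m. lambda' q r m N) {0..N - 1} (eigvals N)"
          using bij_betw_lambda'_below[of N] bij_betw_lambda'_at[of N] by (cases "real N = threshold q r") auto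
        from card_bij_betw_mem[OF this] show ?thesis
          using 2 by (simp add: b_def c_def d_def)
      next
        case 3
        then have "bij_betw (\<lambda>m. lambda' q r m N) {1..N - 2} (inner_eigvals N)"
          by (intro bij_betw_lambda'_inner) simp
        note cb = card_bij_betw_mem[OF this, of A]
        have N: "N \<ge> 1" using 3 threshold_gt_1 by linarith
        note R = roots_above_threshold[OF 3]
        have "eigvals N \<inter> A = (inner_eigvals N \<inter> A) \<union> (outer_pair N \<inter> A)"
          unfolding R(1) by blast
        also have "card \<dots> = card (inner_eigvals N \<inter> A) + card (outer_pair N \<inter> A)"
        proof (rule card_Un_disjoint)
          show "finite (inner_eigvals N \<inter> A)" using finite_inner_roots[OF N] by simp
          have "(B \<inter> A) \<inter> (C \<inter> A) = {}" if "B \<inter> C = {}" for B C :: "real set" using that by blast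
          from this[OF R(2)] show "(inner_eigvals N \<inter> A) \<inter> (outer_pair N \<inter> A) = {}" .
        qed simp
        finally have "real (outer_count A N) =
            real (card {m \<in> {1..N - 2}. lambda' q r m N \<in> A}) + real (card (outer_pair N \<inter> A))"
          unfolding cb by (simp only: of_nat_add)
        then have "outer_mass N * card {m \<in> {1..N - 2}. lambda' q r m N \<in> A} +
            outer_mass N * card (outer_pair N \<inter> A) =
            of_bool (N \<ge> 1) * outer_mass N * outer_count A N"
          using N by (simp only: distrib_left) simp
        moreover have "b N = 0"
          "c N = ennreal (outer_mass N * card {m \<in> {1..N - 2}. lambda' q r m N \<in> A})"
          "d N = ennreal (outer_mass N * card (outer_pair N \<inter> A))"
          unfolding b_def c_def d_def using 3 by simp_all
        ultimately show ?thesis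
          using nn by (simp only: add_0 ennreal_plus[symmetric] mult_nonneg_nonneg of_nat_0_le_iff)
      qed
    qed
    then have "a N + b N + c N + d N = a N + ennreal (of_bool (N \<ge> 1) * outer_mass N * outer_count A N)"
      by (simp add: add.assoc)
    then show "a N + b N + c N + d N = ennreal (limit_term A N)"
      unfolding aN limit_term_def using nn by (subst ennreal_plus) auto
  qed
  finally show ?thesis .
qed

lemma limit_term_compl: "limit_term A N + limit_term (- A) N =
    of_bool (N \<ge> 2) * inner_mass N * (real N - 1) + of_bool (N \<ge> 1) * outer_mass N * real N"
proof (cases "N \<ge> 1")
  case True
  have "inner_count A N + inner_count (- A) N =
      card ({m \<in> {1..N - 1}. lambda q r m N \<in> A} \<union> {m \<in> {1..N - 1}. lambda q r m N \<in> - A})"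
    by (rule card_Un_disjoint[symmetric]) auto
  also have "{m \<in> {1..N - 1}. lambda q r m N \<in> A} \<union> {m \<in> {1..N - 1}. lambda q r m N \<in> - A} = {1..N - 1}" by auto
  finally have 1: "real (inner_count A N) + inner_count (- A) N = real N - 1"
    using True by (simp add: of_nat_diff flip: of_nat_add)
  have fin: "finite (eigvals N)" using finite_roots[OF True] by simp
  have "outer_count A N + outer_count (- A) N =
      card ((eigvals N \<inter> A) \<union> (eigvals N \<inter> - A))"
    using fin by (intro card_Un_disjoint[symmetric]) auto
  also have "(eigvals N \<inter> A) \<union> (eigvals N \<inter> - A) = eigvals N" by blast
  also have "card (eigvals N) = N"
    using card_roots[OF True] rho_pos by (subst card_image) (auto intro: inj_onI)
  finally have 2: "real (outer_count A N) + outer_count (- A) N = real N"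
    by (simp flip: of_nat_add)
  have "limit_term A N + limit_term (- A) N =
      of_bool (N \<ge> 2) * inner_mass N * (real (inner_count A N) + inner_count (- A) N) +
      of_bool (N \<ge> 1) * outer_mass N * (real (outer_count A N) + outer_count (- A) N)"
    by (simp add: limit_term_def distrib_left)
  then show ?thesis by (simp only: 1 2)
qed (simp add: limit_term_def)

text \<open>Both parts are derivatives of geometric series, and add up to \<open>((q - 1) + (r - q)) / (r - 1)\<close>.\<close>

lemma limit_term_total: "(\<lambda>N. limit_term A N + limit_term (- A) N) sums 1"
proof -
  have r: "real r > 1" using q_ge_2 q_less_r by simp
  have z: "norm (1 / real r) < 1" using r by simp
  have pos: "real r - 1 \<noteq> 0" "real r \<noteq> 0" using r by auto
  have base: "(\<lambda>n. real (Suc n) * (1 / real r) ^ n) sums (1 / (1 - 1 / real r)\<^sup>2)"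
    using geometric_deriv_sums[OF z] by simp
  have sq: "1 / (1 - 1 / real r)\<^sup>2 = (real r)\<^sup>2 / (real r - 1)\<^sup>2"
  proof -
    have "1 - 1 / real r = (real r - 1) / real r" using pos by (simp add: diff_divide_distrib)
    then show ?thesis by (simp only: power_divide) simp
  qed
  have "(\<lambda>n. outer_mass (n + 1) * real (n + 1)) sums
      ((real r - real q) * (real r - 1) / (real r)\<^sup>2 * ((real r)\<^sup>2 / (real r - 1)\<^sup>2))"
    using sums_mult[OF base[unfolded sq], of "(real r - real q) * (real r - 1) / (real r)\<^sup>2"]
    by (simp add: outer_mass_def power_divide power2_eq_square mult_ac)
  moreover have "(\<lambda>n. inner_mass (n + 2) * (real (n + 2) - 1)) sums
      ((real q - 1) * (real r - 1) / (real r)\<^sup>2 * ((real r)\<^sup>2 / (real r - 1)\<^sup>2))"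
    using sums_mult[OF base[unfolded sq], of "(real q - 1) * (real r - 1) / (real r)\<^sup>2"]
    by (simp add: inner_mass_def power_divide power2_eq_square mult_ac add.commute)
  moreover have "x * d / R\<^sup>2 * (R\<^sup>2 / d\<^sup>2) = x / d" if "d \<noteq> 0" "R \<noteq> 0" for x d R :: real
    using that by (simp add: power2_eq_square)
  note this[OF pos]
  ultimately have
    "(\<lambda>n. outer_mass (n + 1) * real (n + 1)) sums ((real r - real q) / (real r - 1))"
    "(\<lambda>n. inner_mass (n + 2) * (real (n + 2) - 1)) sums ((real q - 1) / (real r - 1))"
    by (simp_all only:)
  then have o: "(\<lambda>n. of_bool (n + 1 \<ge> 1) * outer_mass (n + 1) * real (n + 1)) sums ((real r - real q) / (real r - 1))"
    and i: "(\<lambda>n. of_bool (n + 2 \<ge> 2) * inner_mass (n + 2) * (real (n + 2) - 1)) sums ((real q - 1) / (real r - 1))"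
    by simp_all
  have "(\<lambda>n. of_bool (n \<ge> 1) * outer_mass n * real n) sums ((real r - real q) / (real r - 1))"
    using o by (subst (asm) sums_iff_shift) simp
  moreover have "(\<lambda>n. of_bool (n \<ge> 2) * inner_mass n * (real n - 1)) sums ((real q - 1) / (real r - 1))"
    using i by (subst (asm) sums_iff_shift) (simp add: numeral_2_eq_2)
  ultimately have "(\<lambda>n. of_bool (n \<ge> 2) * inner_mass n * (real n - 1) + of_bool (n \<ge> 1) * outer_mass n * real n)
      sums ((real q - 1) / (real r - 1) + (real r - real q) / (real r - 1))"
    by (intro sums_add)
  also have "(real q - 1) / (real r - 1) + (real r - real q) / (real r - 1) = (real r - 1) / (real r - 1)"
    by (simp flip: add_divide_distrib)
  also have "\<dots> = 1" using pos by simp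
  finally show ?thesis by (simp only: limit_term_compl)
qed

lemma limit_term_summable: "summable (limit_term A)"
  by (rule summable_comparison_test_ev[OF _ sums_summable[OF limit_term_total[of A]]])
    (simp add: limit_term_nonneg)

lemma measure_limit:
  assumes "A \<in> sets borel"
  shows "measure (mu_lim q r \<oplus>\<^sub>M nu_lim q r) A = (\<Sum>N. limit_term A N)"
  unfolding measure_def emeasure_limit[OF assms]
  by (subst suminf_ennreal2) (auto simp: limit_term_nonneg limit_term_summable suminf_nonneg)

lemma mu_lim_pos:
  assumes "A \<in> sets borel" "N \<ge> 2" "1 \<le> m" "m \<le> N - 1" "lambda q r m N \<in> A"
  shows "emeasure (mu_lim q r) A \<noteq> 0"
proof
  assume "emeasure (mu_lim q r) A = 0"
  then have "\<forall>N\<in>{2..}. ennreal (inner_mass N * inner_count A N) = 0"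
    by (simp only: emeasure_mu_lim[OF assms(1)] add_eq_0_iff_both_eq_0 zero_le nn_integral_count_space_eq_0_iff) blast
  then have "ennreal (inner_mass N * inner_count A N) = 0"
    using assms(2) by blast
  then have "inner_mass N * inner_count A N \<le> 0"
    by (simp only: ennreal_eq_0_iff)
  moreover have "inner_count A N > 0"
    using assms by (subst card_gt_0_iff) auto
  then have "inner_mass N * inner_count A N > 0"
    using mass_pos(1)[of N] by (intro mult_pos_pos) (simp_all only: of_nat_0_less_iff)
  ultimately show False by linarith
qed

lemma lambda_bound: "- rho q r \<le> lambda q r m N \<and> lambda q r m N \<le> rho q r"
proof -
  have "\<bar>lambda q r m N\<bar> \<le> rho q r * 1"
    unfolding lambda_def abs_mult using rho_pos by (intro mult_mono) auto
  then show ?thesis by linarith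
qed

lemma mu_lim_null:
  assumes "A \<in> sets borel" "A \<inter> {- rho q r .. rho q r} = {}"
  shows "emeasure (mu_lim q r) A = 0"
proof -
  have 1: "inner_count A N = 0" for N
  proof -
    have "lambda q r m N \<notin> A" for m using lambda_bound[of m N] assms(2) by auto
    then show ?thesis by simp
  qed
  have bnd: "lambda' q r m N \<notin> A" if "\<not> (real N > threshold q r \<and> m = 0)" for m N
  proof -
    have "lambda' q r m N = rho q r * cos (alpha q r m N)"
      using that by (simp only: lambda'_def if_False)
    then have "\<bar>lambda' q r m N\<bar> \<le> rho q r * 1"
      using rho_pos by (simp add: abs_mult)
    then have "lambda' q r m N \<in> {- rho q r .. rho q r}" by (simp add: abs_le_iff)
    then show ?thesis using assms(2) by blast
  qed
  have 2: "card {m \<in> {0..N - 1}. lambda' q r m N \<in> A} = 0" if "real N \<le> threshold q r" for N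
    using bnd[of N] that by simp
  have 3: "card {m \<in> {1..N - 2}. lambda' q r m N \<in> A} = 0" for N
  proof -
    have "{m \<in> {1..N - 2}. lambda' q r m N \<in> A} = {}" using bnd[of N] by auto
    then show ?thesis by (simp only: card.empty)
  qed
  have "(\<integral>\<^sup>+N. ennreal (outer_mass N * card {m \<in> {0..N - 1}. lambda' q r m N \<in> A})
       \<partial>count_space {N. 1 \<le> N \<and> real N \<le> threshold q r}) = 0"
    unfolding nn_integral_count_space_eq_0_iff
  proof
    fix N assume "N \<in> {N. 1 \<le> N \<and> real N \<le> threshold q r}"
    then have "card {m \<in> {0..N - 1}. lambda' q r m N \<in> A} = 0" by (intro 2) simp
    then show "ennreal (outer_mass N * card {m \<in> {0..N - 1}. lambda' q r m N \<in> A}) = 0"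
      by (simp only: of_nat_0 mult_zero_right ennreal_0)
  qed
  then show ?thesis
    unfolding emeasure_mu_lim[OF assms(1)] 1 3 by simp
qed

text \<open>The points \<open>\<lambda>\<^sub>m\<^sub>,\<^sub>N\<close> alone are dense, by density of the rationals \<open>m / N\<close>.\<close>

lemma measure_supp_mu_lim: "measure_supp (mu_lim q r) = {- rho q r .. rho q r}"
proof
  show "measure_supp (mu_lim q r) \<subseteq> {- rho q r .. rho q r}"
  proof
    fix x assume x: "x \<in> measure_supp (mu_lim q r)"
    show "x \<in> {- rho q r .. rho q r}"
    proof (rule ccontr)
      assume "x \<notin> {- rho q r .. rho q r}"
      moreover have "open (- {- rho q r .. rho q r})" by (simp add: open_Compl)
      ultimately have "emeasure (mu_lim q r) (- {- rho q r .. rho q r}) \<noteq> 0"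
        using x unfolding measure_supp_def by blast
      then show False using mu_lim_null[of "- {- rho q r .. rho q r}"] by auto
    qed
  qed
  show "{- rho q r .. rho q r} \<subseteq> measure_supp (mu_lim q r)"
  proof
    fix x assume x: "x \<in> {- rho q r .. rho q r}"
    show "x \<in> measure_supp (mu_lim q r)"
      unfolding measure_supp_def
    proof (intro CollectI allI impI)
      fix U :: "real set" assume U: "open U" "x \<in> U"
      define f where "f s = rho q r * cos (s * pi)" for s
      define s0 where "s0 = arccos (x / rho q r) / pi"
      have xr: "- 1 \<le> x / rho q r" "x / rho q r \<le> 1" using x rho_pos by (auto simp: field_simps)
      have s0: "0 \<le> s0" "s0 \<le> 1" "f s0 = x"
        using xr rho_pos arccos_lbound[OF xr] arccos_ubound[OF xr] by (auto simp: s0_def f_def)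
      have "continuous_on UNIV f" unfolding f_def by (intro continuous_intros)
      then have "open (f -` U)" using U(1) by (simp add: continuous_on_open_vimage)
      then obtain e where e: "e > 0" "\<And>s. dist s s0 < e \<Longrightarrow> s \<in> f -` U"
        using s0(3) U(2) unfolding open_dist by (metis vimageI2)
      define lo hi where "lo = max 0 (s0 - e)" and "hi = min 1 (s0 + e)"
      have "lo < hi" using s0 e(1) by (auto simp: lo_def hi_def)
      then obtain s where s: "s \<in> \<rat>" "lo < s" "s < hi" using Rats_dense_in_real by blast
      then have "s > 0" "s < 1" "dist s s0 < e"
        by (auto simp: lo_def hi_def dist_real_def)
      then obtain m N :: nat where mN: "N \<noteq> 0" "s = real m / real N"
        using Rats_abs_nat_div_natE[OF s(1)] by (metis abs_of_pos)
      have "m \<noteq> 0" using mN \<open>s > 0\<close> by (intro notI) simp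
      moreover have "real m < real N" using mN \<open>s < 1\<close> by (simp add: divide_less_eq)
      ultimately have "1 \<le> m" "m \<le> N - 1" "N \<ge> 2" by auto
      moreover have "lambda q r m N \<in> U"
        using e(2)[OF \<open>dist s s0 < e\<close>] by (simp add: f_def lambda_def mN(2))
      ultimately show "emeasure (mu_lim q r) U \<noteq> 0"
        using U(1) by (intro mu_lim_pos[of U N m]) auto
    qed
  qed
qed

definition outer_atoms :: "real set" where
  "outer_atoms = {s * lambda' q r 0 N | s N. s \<in> {1, -1} \<and> real N > threshold q r}"

lemma mem_outer_atoms: "x \<in> outer_atoms \<longleftrightarrow>
    (\<exists>N. real N > threshold q r \<and> x \<in> outer_pair N)"
proof
  assume "\<exists>N. real N > threshold q r \<and> x \<in> outer_pair N"
  then obtain N where "real N > threshold q r" "x = 1 * lambda' q r 0 N \<or> x = -1 * lambda' q r 0 N" by auto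
  then show "x \<in> outer_atoms" unfolding outer_atoms_def by blast
qed (auto simp: outer_atoms_def)

lemma nu_lim_null_iff:
  assumes A: "A \<in> sets borel"
  shows "emeasure (nu_lim q r) A = 0 \<longleftrightarrow> A \<inter> outer_atoms = {}"
proof -
  have "emeasure (nu_lim q r) A = 0 \<longleftrightarrow>
      (\<forall>N. real N > threshold q r \<longrightarrow> outer_mass N * card (outer_pair N \<inter> A) \<le> 0)"
    unfolding emeasure_nu_lim[OF A] by (simp add: nn_integral_count_space_eq_0_iff ennreal_eq_0_iff)
  also have "\<dots> \<longleftrightarrow> (\<forall>N. real N > threshold q r \<longrightarrow> outer_pair N \<inter> A = {})"
  proof -
    have "outer_mass N * card B \<le> 0 \<longleftrightarrow> B = {}" if "finite B" for N and B :: "real set"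
      using mass_pos(2)[of N] that by (simp add: mult_le_0_iff not_le[symmetric] card_eq_0_iff)
    moreover have "finite (outer_pair N \<inter> A)" for N by simp
    ultimately show ?thesis by presburger
  qed
  also have "\<dots> \<longleftrightarrow> A \<inter> outer_atoms = {}"
    unfolding disjoint_iff mem_outer_atoms by blast
  finally show ?thesis .
qed

lemma nu_lim_atoms: "{x. emeasure (nu_lim q r) {x} \<noteq> 0} = outer_atoms"
  using nu_lim_null_iff[of "{_}"] by auto

lemma measure_supp_nu_lim: "measure_supp (nu_lim q r) = closure outer_atoms"
proof -
  have "emeasure (nu_lim q r) U \<noteq> 0 \<longleftrightarrow> U \<inter> outer_atoms \<noteq> {}" if "open U" for U
    using nu_lim_null_iff[OF borel_open[OF that]] by blast
  then have "x \<in> measure_supp (nu_lim q r) \<longleftrightarrow> (\<forall>U. open U \<longrightarrow> x \<in> U \<longrightarrow> U \<inter> outer_atoms \<noteq> {})" for x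
    unfolding measure_supp_def by blast
  also have "(\<forall>U. open U \<longrightarrow> x \<in> U \<longrightarrow> U \<inter> outer_atoms \<noteq> {}) \<longleftrightarrow> x \<in> closure outer_atoms" for x
    unfolding closure_iff_nhds_not_empty by blast
  finally show ?thesis by blast
qed

lemma measure_supp_nu_lim_subset:
  "measure_supp (nu_lim q r) \<subseteq> {-1 .. - rho q r} \<union> {rho q r .. 1}"
  unfolding measure_supp_nu_lim
proof (rule closure_minimal)
  show "outer_atoms \<subseteq> {-1 .. - rho q r} \<union> {rho q r .. 1}"
  proof
    fix x assume "x \<in> outer_atoms"
    then obtain N where "real N > threshold q r" "x \<in> outer_pair N"
      unfolding mem_outer_atoms by blast
    then show "x \<in> {-1 .. - rho q r} \<union> {rho q r .. 1}"
      using lambda'_0_bounds[of N] by auto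
  qed
qed auto

end

section \<open>Weak convergence\<close>

text \<open>Here \<open>g\<close> and \<open>g'\<close> are the masses of a set and of its complement. The termwise lower bounds give
  \<open>liminf g \<ge> suminf c\<close> and \<open>liminf g' \<ge> suminf c'\<close>, as in Fatou's lemma; since \<open>g \<le> 1 - g'\<close>, the
  second one is an upper bound for \<open>g\<close>.\<close>

lemma tendsto_of_lower_bounds:
  fixes g g' :: "nat \<Rightarrow> real" and c c' :: "nat \<Rightarrow> real" and e e' :: "nat \<Rightarrow> nat \<Rightarrow> real"
  assumes low: "\<And>M. eventually (\<lambda>n. (\<Sum>N<M. e n N) \<le> g n) sequentially"
    and low': "\<And>M. eventually (\<lambda>n. (\<Sum>N<M. e' n N) \<le> g' n) sequentially"
    and lim: "\<And>N. (\<lambda>n. e n N) \<longlonglongrightarrow> c N" and lim': "\<And>N. (\<lambda>n. e' n N) \<longlonglongrightarrow> c' N"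
    and summable: "summable c" "summable c'" and total: "suminf c + suminf c' = 1"
    and le: "\<And>n. g n + g' n \<le> 1"
  shows "g \<longlonglongrightarrow> suminf c"
proof -
  have low_ev: "eventually (\<lambda>n. suminf c - \<epsilon> < g n) sequentially"
    if "\<epsilon> > 0" "\<And>M. eventually (\<lambda>n. (\<Sum>N<M. e n N) \<le> g n) sequentially"
      "\<And>N. (\<lambda>n. e n N) \<longlonglongrightarrow> c N" "summable c" for \<epsilon> and g :: "nat \<Rightarrow> real" and c e
  proof -
    have "(\<lambda>M. \<Sum>N<M. c N) \<longlonglongrightarrow> suminf c" using that(4) by (rule summable_LIMSEQ)
    then have "eventually (\<lambda>M. suminf c - \<epsilon> < (\<Sum>N<M. c N)) sequentially"
      using that(1) by (intro order_tendstoD) auto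
    then obtain M where M: "suminf c - \<epsilon> < (\<Sum>N<M. c N)" by (auto simp: eventually_sequentially)
    have "(\<lambda>n. \<Sum>N<M. e n N) \<longlonglongrightarrow> (\<Sum>N<M. c N)" by (intro tendsto_sum that(3))
    then have "eventually (\<lambda>n. suminf c - \<epsilon> < (\<Sum>N<M. e n N)) sequentially"
      using M by (rule order_tendstoD)
    then show ?thesis using that(2)[of M] by eventually_elim simp
  qed
  show ?thesis
  proof (rule order_tendstoI)
    fix a assume "a < suminf c"
    then show "eventually (\<lambda>n. a < g n) sequentially"
      using low_ev[OF _ low lim summable(1), of "suminf c - a"] by simp
  next
    fix a assume "suminf c < a"
    then have "eventually (\<lambda>n. suminf c' - (a - suminf c) < g' n) sequentially"
      using low_ev[OF _ low' lim' summable(2), of "a - suminf c"] by simp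
    then show "eventually (\<lambda>n. g n < a) sequentially"
    proof eventually_elim
      case (elim n)
      then show ?case using le[of n] total by linarith
    qed
  qed
qed

context degrees
begin

definition tetra_size :: "nat \<Rightarrow> nat" where
  "tetra_size n = (\<Sum>k\<le>n. q ^ k * r ^ (n - k))"

lemma tetra_size_pos: "tetra_size n > 0"
proof -
  have "r ^ n \<le> tetra_size n"
    unfolding tetra_size_def using member_le_sum[of 0 "{..n}" "\<lambda>k. q ^ k * r ^ (n - k)"] by simp
  then show ?thesis using q_ge_2 q_less_r by (metis gr0I le_zero_eq not_less_zero power_not_zero)
qed

lemma tetra_size_asymp: "(\<lambda>n. real (tetra_size n) / real r ^ n) \<longlonglongrightarrow> real r / (real r - real q)"
proof -
  have r: "real r > 0" "real q / real r < 1" using q_ge_2 q_less_r by auto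
  have "real (tetra_size n) / real r ^ n = (\<Sum>k\<le>n. (real q / real r) ^ k)" for n
    unfolding tetra_size_def of_nat_sum sum_divide_distrib
  proof (rule sum.cong[OF refl])
    fix k assume "k \<in> {..n}"
    then have "real r ^ n = real r ^ k * real r ^ (n - k)" by (simp flip: power_add)
    then show "real (q ^ k * r ^ (n - k)) / real r ^ n = (real q / real r) ^ k"
      using r by (simp add: power_divide)
  qed
  moreover have "(\<lambda>n. \<Sum>k\<le>n. (real q / real r) ^ k) \<longlonglongrightarrow> 1 / (1 - real q / real r)"
    using geometric_sums[of "real q / real r"] r by (simp add: sums_def_le)
  moreover have "1 / (1 - real q / real r) = real r / (real r - real q)"
    using r by (simp add: field_simps)
  ultimately show ?thesis by simp
qed

lemma inner_count_limit:
  "(\<lambda>n. real ((q - 1) * (r - 1) * tetra_size (n - N)) / real (tetra_size n)) \<longlonglongrightarrow> inner_mass N"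
proof -
  have r: "real r > 0" "real r - real q > 0" using q_ge_2 q_less_r by auto
  define a where "a n = real (tetra_size n) / real r ^ n" for n
  have lim: "a \<longlonglongrightarrow> real r / (real r - real q)" using tetra_size_asymp unfolding a_def[abs_def] .
  have "(\<lambda>n. a (n - N)) \<longlonglongrightarrow> real r / (real r - real q)"
    using lim by (rule filterlim_compose) (rule filterlim_minus_const_nat_at_top)
  then have "(\<lambda>n. inner_mass N * (a (n - N) / a n)) \<longlonglongrightarrow>
      inner_mass N * ((real r / (real r - real q)) / (real r / (real r - real q)))"
    using r by (intro tendsto_intros lim) auto
  then have "(\<lambda>n. inner_mass N * (a (n - N) / a n)) \<longlonglongrightarrow> inner_mass N" using r by simp
  then show ?thesis
  proof (rule Lim_transform_eventually)
    show "\<forall>\<^sub>F n in sequentially. inner_mass N * (a (n - N) / a n) =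
        real ((q - 1) * (r - 1) * tetra_size (n - N)) / real (tetra_size n)"
      using eventually_ge_at_top[of N]
    proof eventually_elim
      case (elim n)
      then have "real r ^ n = real r ^ N * real r ^ (n - N)" by (simp flip: power_add)
      then show ?case
        using r q_ge_2 q_less_r tetra_size_pos[of n] by (simp add: a_def inner_mass_def of_nat_diff field_simps)
    qed
  qed
qed

lemma outer_count_limit:
  "(\<lambda>n. real ((r - 1) * r ^ (n - N)) / real (tetra_size n)) \<longlonglongrightarrow> outer_mass N"
proof -
  have r: "real r > 0" "real r - real q > 0" using q_ge_2 q_less_r by auto
  define a where "a n = real (tetra_size n) / real r ^ n" for n
  have lim: "a \<longlonglongrightarrow> real r / (real r - real q)" using tetra_size_asymp unfolding a_def[abs_def] .
  have "(\<lambda>n. (real r - 1) / real r ^ N / a n) \<longlonglongrightarrow> (real r - 1) / real r ^ N / (real r / (real r - real q))"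
    using r by (intro tendsto_intros lim) auto
  moreover have "(real r - 1) / real r ^ N / (real r / (real r - real q)) = outer_mass N"
    using r by (simp add: outer_mass_def mult_ac)
  ultimately have "(\<lambda>n. (real r - 1) / real r ^ N / a n) \<longlonglongrightarrow> outer_mass N" by simp
  then show ?thesis
  proof (rule Lim_transform_eventually)
    show "\<forall>\<^sub>F n in sequentially. (real r - 1) / real r ^ N / a n =
        real ((r - 1) * r ^ (n - N)) / real (tetra_size n)"
      using eventually_ge_at_top[of N]
    proof eventually_elim
      case (elim n)
      then have "real r ^ n = real r ^ N * real r ^ (n - N)" by (simp flip: power_add)
      then show ?case
        using r q_ge_2 q_less_r tetra_size_pos[of n] by (simp add: a_def of_nat_diff)
    qed
  qed
qed

lemma cheb_roots_ge:
  assumes "N \<ge> 2"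
  shows "inner_count A N \<le> cheb_count A N"
proof (rule card_inj_on_le)
  let ?f = "\<lambda>m. cos (real m / real N * pi)"
  have rng: "0 < real m / real N * pi" "real m / real N * pi < pi" if "m \<in> {1..N - 1}" for m
    using that assms by (auto simp: field_simps)
  show "inj_on ?f {m \<in> {1..N - 1}. lambda q r m N \<in> A}"
  proof (rule inj_onI)
    fix m k assume mk: "m \<in> {m \<in> {1..N - 1}. lambda q r m N \<in> A}" "k \<in> {m \<in> {1..N - 1}. lambda q r m N \<in> A}" "?f m = ?f k"
    then have "real m / real N * pi = real k / real N * pi"
      using cos_inj_pi[OF less_imp_le less_imp_le less_imp_le less_imp_le, OF rng(1,2) rng(1,2), of m k] by blast
    then have "real m / real N = real k / real N"
      by (simp only: mult_cancel_right pi_neq_zero simp_thms)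
    moreover have "real N \<noteq> 0" using assms by simp
    ultimately have "real m = real k" by (simp only: divide_cancel_right simp_thms)
    then show "m = k" by (simp only: of_nat_eq_iff)
  qed
  show "?f ` {m \<in> {1..N - 1}. lambda q r m N \<in> A} \<subseteq> {x. poly (cheb N) x = 0 \<and> rho q r * x \<in> A}"
  proof
    fix x assume "x \<in> ?f ` {m \<in> {1..N - 1}. lambda q r m N \<in> A}"
    then obtain m where m: "m \<in> {1..N - 1}" "lambda q r m N \<in> A" "x = ?f m" by auto
    have "poly (cheb N) x * sin (real m / real N * pi) = sin (real N * (real m / real N * pi))"
      unfolding m(3) by (rule cheb_cos)
    also have "real N * (real m / real N * pi) = real m * pi" using assms by simp
    finally have "poly (cheb N) x * sin (real m / real N * pi) = 0" by simp
    moreover have "sin (real m / real N * pi) > 0" using rng[OF m(1)] by (rule sin_gt_zero)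
    ultimately show "x \<in> {x. poly (cheb N) x = 0 \<and> rho q r * x \<in> A}"
      using m by (simp add: lambda_def)
  qed
  have "cheb N \<noteq> 0" using cheb_at_1[of N] assms by auto
  then show "finite {x. poly (cheb N) x = 0 \<and> rho q r * x \<in> A}"
    using poly_roots_finite[of "cheb N"] by (rule_tac finite_subset) auto
qed

end

context dl_exhaustion
begin

definition mass :: "nat \<Rightarrow> real set \<Rightarrow> real" where
  "mass n A = (\<Sum>l\<in>spec E (Tet n) \<inter> A. real (mult E (Tet n) l)) / real (card (Tet n))"

definition mass_term :: "real set \<Rightarrow> nat \<Rightarrow> nat \<Rightarrow> real" where
  "mass_term A n N =
     of_bool (N \<ge> 2) * (real ((q - 1) * (r - 1) * tetra_size (n - N)) / real (tetra_size n)) *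
       inner_count A N +
     of_bool (N \<ge> 1) * (real ((r - 1) * r ^ (n - N)) / real (tetra_size n)) * outer_count A N"

lemma finite_card_Tet: "finite (Tet n)" "card (Tet n) = tetra_size n"
proof -
  interpret T: dl_tetrahedron q r T1 T2 "a1 n" "a2 n" n by (rule dl_tetrahedron)
  show "finite (Tet n)" "card (Tet n) = tetra_size n"
    using T.finite_S T.card_S by (simp_all add: tetra_size_def)
qed

lemma measure_cumulative:
  assumes "A \<in> sets borel"
  shows "measure (cumulative_spectral_measure E (Tet n)) A = mass n A"
  unfolding measure_def emeasure_cumulative_spectral_measure[OF finite_card_Tet(1) assms]
  by (simp add: mass_def sum_nonneg)

lemma mass_term_tendsto: "(\<lambda>n. mass_term A n N) \<longlonglongrightarrow> limit_term A N"
  unfolding mass_term_def limit_term_def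
  by (intro tendsto_intros inner_count_limit outer_count_limit)

lemma mass_compl_le: "mass n A + mass n (- A) \<le> 1"
proof -
  have fin: "finite (spec E (Tet n))" by (rule finite_spec[OF finite_card_Tet(1)])
  have "(\<Sum>l\<in>spec E (Tet n) \<inter> A. mult E (Tet n) l) + (\<Sum>l\<in>spec E (Tet n) \<inter> - A. mult E (Tet n) l) =
      (\<Sum>l\<in>(spec E (Tet n) \<inter> A) \<union> (spec E (Tet n) \<inter> - A). mult E (Tet n) l)"
    using fin by (intro sum.union_disjoint[symmetric]) auto
  also have "(spec E (Tet n) \<inter> A) \<union> (spec E (Tet n) \<inter> - A) = spec E (Tet n)" by blast
  also have "(\<Sum>l\<in>spec E (Tet n). mult E (Tet n) l) \<le> card (Tet n)"
    by (rule sum_mult_le_card[OF finite_card_Tet(1) fin])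
  finally have "(\<Sum>l\<in>spec E (Tet n) \<inter> A. real (mult E (Tet n) l)) + (\<Sum>l\<in>spec E (Tet n) \<inter> - A. real (mult E (Tet n) l))
      \<le> real (card (Tet n))"
    by (simp only: of_nat_sum[symmetric] of_nat_add[symmetric] of_nat_le_iff)
  then show ?thesis
    using tetra_size_pos[of n] by (simp add: mass_def finite_card_Tet flip: add_divide_distrib)
qed

lemma mass_ge: "eventually (\<lambda>n. (\<Sum>N<M. mass_term A n N) \<le> mass n A) sequentially"
  using eventually_ge_at_top[of M]
proof eventually_elim
  case (elim n)
  interpret T: dl_tetrahedron q r T1 T2 "a1 n" "a2 n" n by (rule dl_tetrahedron)
  define i where "i N = of_bool (N \<ge> 2) * (inner_count A N * ((q - 1) * (r - 1) * tetra_size (n - N)))" for N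
  define j where "j N = of_bool (N \<ge> 1) * (outer_count A N * ((r - 1) * r ^ (n - N)))" for N
  have "(\<Sum>N<M. i N + j N) \<le> (\<Sum>N\<le>n. i N + j N)"
    using elim by (intro sum_mono2) auto
  also have "\<dots> = (\<Sum>N\<le>n. i N) + (\<Sum>N\<le>n. j N)" by (rule sum.distrib)
  also have "(\<Sum>N\<le>n. i N) = (\<Sum>N\<in>{2..n}. i N)"
    by (rule sum.mono_neutral_right) (auto simp: i_def)
  also have "(\<Sum>N\<le>n. j N) = (\<Sum>N\<in>{1..n}. j N)"
    by (rule sum.mono_neutral_right) (auto simp: j_def)
  also have "(\<Sum>N\<in>{2..n}. i N) \<le> (\<Sum>N\<in>{2..n}. cheb_count A N * card (T.ix_inner N))"
    using cheb_roots_ge by (intro sum_mono) (auto simp: i_def T.card_ix_inner tetra_size_def intro!: mult_right_mono)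
  also have "(\<Sum>N\<in>{1..n}. j N) = (\<Sum>N\<in>{1..n}. bdry_count A N * card (T.ix_outer N))"
  proof (rule sum.cong[OF refl])
    fix N assume N: "N \<in> {1..n}"
    have "eigvals N \<inter> A = (*) (rho q r) ` {x \<in> roots N. rho q r * x \<in> A}" by auto
    then have "outer_count A N = bdry_count A N"
      using rho_pos by (simp only:) (subst card_image, auto intro: inj_onI)
    then show "j N = bdry_count A N * card (T.ix_outer N)"
      using N by (simp add: j_def T.card_ix_outer)
  qed
  also have "(\<Sum>N\<in>{2..n}. cheb_count A N * card (T.ix_inner N)) +
      (\<Sum>N\<in>{1..n}. bdry_count A N * card (T.ix_outer N))
      \<le> (\<Sum>l\<in>spec E (Tet n) \<inter> A. mult E (Tet n) l)"
    by (rule T.spectral_mass_ge)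
  finally have "real (\<Sum>N<M. i N + j N) \<le> (\<Sum>l\<in>spec E (Tet n) \<inter> A. real (mult E (Tet n) l))"
    by (simp only: of_nat_sum[symmetric] of_nat_le_iff)
  then have "real (\<Sum>N<M. i N + j N) / real (tetra_size n) \<le> mass n A"
    unfolding mass_def finite_card_Tet by (rule divide_right_mono) simp
  also have "real (\<Sum>N<M. i N + j N) / real (tetra_size n) = (\<Sum>N<M. mass_term A n N)"
    unfolding of_nat_sum sum_divide_distrib
    by (intro sum.cong) (simp_all add: mass_term_def i_def j_def add_divide_distrib mult_ac)
  finally show ?case .
qed

text \<open>Up to a negligible mass the atoms do not move with \<open>n\<close>, only their weights change. Hence convergence
  on every set.\<close>

lemma mass_tendsto: "(\<lambda>n. mass n A) \<longlonglongrightarrow> (\<Sum>N. limit_term A N)"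
proof (rule tendsto_of_lower_bounds)
  show "(\<Sum>N. limit_term A N) + (\<Sum>N. limit_term (- A) N) = 1"
    using sums_unique[OF limit_term_total[of A]] suminf_add[OF limit_term_summable[of A] limit_term_summable[of "- A"]]
    by simp
qed (rule mass_ge mass_term_tendsto limit_term_summable mass_compl_le)+

lemma cumulative_weak_conv:
  "weak_conv_m (\<lambda>n. cumulative_spectral_measure E (Tet n)) (mu_lim q r \<oplus>\<^sub>M nu_lim q r)"
  unfolding weak_conv_m_def weak_conv_def cdf_def2
  using mass_tendsto by (simp add: measure_cumulative measure_limit)

end

theorem proposition6p20:
  fixes q r :: nat
    and T1 :: "'a ended_tree" and T2 :: "'b ended_tree"
    and a1 :: "nat \<Rightarrow> 'a" and a2 :: "nat \<Rightarrow> 'b"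
    and S :: "nat \<Rightarrow> ('a \<times> 'b) set"
  assumes "2 \<le> q" and "q < r"
    and "homogeneous_tree q T1" and "homogeneous_tree r T2"
    and "\<And>n. has_height T1 T2 (a1 n) (a2 n) n"
    and "\<And>n. S n = tetrahedron T1 T2 (a1 n) (a2 n)"
    and "incseq S"
    and "(\<Union>n. S n) = dl_verts T1 T2"
  shows
    "srw_spectral_radius (dl_adj T1 T2) (dl_verts T1 T2) (base T1, base T2) = ereal (rho q r) \<and>
     (\<forall>N\<ge>1. real N < threshold q r \<longrightarrow>
        finite (cot_solutions q r N) \<and> card (cot_solutions q r N) = N) \<and>
     (\<forall>N. real N = threshold q r \<longrightarrow>
        finite (cot_solutions q r N) \<and> card (cot_solutions q r N) = N - 2) \<and>
     (\<forall>N. real N > threshold q r \<longrightarrow>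
        finite (cot_solutions q r N) \<and> card (cot_solutions q r N) = N - 2 \<and>
        (\<exists>!\<alpha>. is_exp_solution q r N \<alpha>)) \<and>
     weak_conv_m (\<lambda>n. cumulative_spectral_measure (dl_adj T1 T2) (S n))
       (mu_lim q r \<oplus>\<^sub>M nu_lim q r) \<and>
     measure_supp (mu_lim q r) = {- rho q r .. rho q r} \<and>
     {x. emeasure (nu_lim q r) {x} \<noteq> 0} =
       {s * lambda' q r 0 N | s N. s \<in> {1, -1} \<and> real N > threshold q r} \<and>
     measure_supp (nu_lim q r) =
       closure {s * lambda' q r 0 N | s N. s \<in> {1, -1} \<and> real N > threshold q r} \<and>
     measure_supp (nu_lim q r) \<subseteq> {-1 .. - rho q r} \<union> {rho q r .. 1} \<and>
     strict_mono_on {N. real N > threshold q r} (\<lambda>N. lambda' q r 0 N) \<and>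
     (\<lambda>N. lambda' q r 0 N) \<longlonglongrightarrow> 1"
proof -
  have S: "S = (\<lambda>n. tetrahedron T1 T2 (a1 n) (a2 n))"
    by (rule ext) (rule assms(6))
  interpret dl_exhaustion q r T1 T2 a1 a2
    using assms(1-5,7,8) unfolding S by unfold_locales auto
  have below: "finite (cot_solutions q r N) \<and> card (cot_solutions q r N) = N"
    if "N \<ge> 1" "real N < threshold q r" for N
    using cot_solutions_card[OF that(1)] roots_below_threshold[OF that] by simp
  have at: "finite (cot_solutions q r N) \<and> card (cot_solutions q r N) = N - 2"
    if "real N = threshold q r" for N
    using cot_solutions_card[of N] roots_at_threshold(2)[OF that] threshold_le_imp_ge_2[of N] that by simp
  have over: "finite (cot_solutions q r N) \<and> card (cot_solutions q r N) = N - 2 \<and>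
      (\<exists>!\<alpha>. is_exp_solution q r N \<alpha>)"
    if "real N > threshold q r" for N
    using cot_solutions_card[of N] roots_above_threshold(3)[OF that] threshold_le_imp_ge_2[of N] that
      exp_solution_unique[OF that] by simp
  show ?thesis
    unfolding S outer_atoms_def[symmetric]
    using spectral_radius below at over cumulative_weak_conv measure_supp_mu_lim nu_lim_atoms
      measure_supp_nu_lim measure_supp_nu_lim_subset lambda'_0_strict_mono lambda'_0_tendsto
    by blast
qed

end
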